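(* Let $\{X_{k,n},\ 1\le k\le k(n)\}_{n\ge1}$ be an array of real-valued, square integrable, centered random variables, with $k(n)\to+\infty$, such that for each $n$ the variables $X_{1,n},\dots,X_{k(n),n}$ are independent, and put $S_n=\sum_{k=1}^{k(n)}X_{k,n}$. Let $F_{k,n}$ be the cumulative distribution function of $X_{k,n}$ and let $K_n$ be the distribution function given by $dK_n(x)=x^2\sum_{k=1}^{k(n)}dF_{k,n}(x)$, i.e. $K_n(x)=\sum_{k=1}^{k(n)}\int_{(-\infty,x]}y^2\,dF_{k,n}(y)$. Then: (a) Suppose the BVH and the UAN condition hold. If $S_n\rightsquigarrow\mathcal K$, where $\mathcal K$ is a probability law on $\mathbb R$, then $\mathcal K$ is infinitely decomposable. (b) Let $\mathcal K$ be any infinitely decomposable probability law of a centered and square integrable random variable $Z$, so that for every $n\ge1$ there exist independent and identically distributed random variables $X_{1,n},\dots,X_{n,n}$ (they are necessarily centered and square integrable) such that $Z=_d X_{1,n}+\cdots+X_{n,n}=:S_n$. Then $\mathcal K$ is a weak limit of sums of independent, centered and square integrable real-valued random variables under the BVH and the UAN condition. (c) Suppose the BVH and the UAN condition hold, and let $K$ be a distribution function. Then $S_n\rightsquigarrow\mathcal K_K$ if and only if $K_n\rightsquigarrow_{pre}K$. Moreover the function $$\Psi_K(u)=\int\frac{e^{iux}-1-iux}{x^2}\,dK(x),\qquad u\in\mathbb R,$$ and $K$ characterize each other, and $\exp(\Psi_K(\cdot))$ is the characteristic function of $\mathcal K_K$.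
   Context: Weak convergence (convergence in distribution) of random variables is denoted $\rightsquigarrow$; equality in law is $=_d$. BVH (Bounded Variance Hypothesis): $\sup_{n\ge1}\sum_{k=1}^{k(n)}\mathrm{Var}(X_{k,n})<+\infty$. UAN (Uniform Asymptotic Negligibility): for every $\varepsilon>0$, $\sup_{1\le k\le k(n)}\mathbb P(|X_{k,n}|\ge\varepsilon)\to0$ as $n\to+\infty$. A probability law on $\mathbb R$ with characteristic function $\psi$ is infinitely decomposable if for every integer $p\ge1$ there is a characteristic function $\psi_p$ with $\psi=\psi_p^p$; equivalently, for every $p\ge1$ it is the law of a sum of $p$ i.i.d. random variables. A distribution function (df) $K$ here is a bounded nondecreasing right-continuous function on $\mathbb R$; $\lambda_K$ is the associated finite Lebesgue–Stieltjes measure, $\lambda_K(]a,b])=K(b)-K(a)$, and integrals $dK$ are with respect to $\lambda_K$. Pre-weak convergence $K_n\rightsquigarrow_{pre}K$ means: $K_n(x)\to K(x)$ as $n\to+\infty$ for every continuity point $x$ of $K$ (total masses need not converge). The integrand $\frac{e^{iux}-1-iux}{x^2}$ is taken to be its limit $-u^2/2$ at $x=0$. For a df $K$, $\mathcal K_K$ denotes the probability law associated with $K$, namely the one with characteristic function $\exp(\Psi_K)$.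
   Formalization: In (c), K_n converges pre-weakly to K only up to additive constants c_n (the literal "only if" fails if mass of K_n escapes to −∞ or K is not normalised); it is literal when K(−∞)=0 and no mass escapes to −∞. Ψ_K determines K up to an additive constant. *)

theory Defs
  imports "HOL-Probability.Probability"
begin

section \<open>Triangular arrays\<close>

text \<open>
  The \<open>n\<close>-th row \<open>X 1 n, \<dots>, X (kn n) n\<close> (\<open>n \<ge> 1\<close>) lives on its own probability space \<open>M n\<close>;
  a common space is the special case of constant \<open>M\<close>. Integrability of each variable follows from
  square integrability.
\<close>

definition centered_array ::
    "(nat \<Rightarrow> 'a measure) \<Rightarrow> (nat \<Rightarrow> nat) \<Rightarrow> (nat \<Rightarrow> nat \<Rightarrow> 'a \<Rightarrow> real) \<Rightarrow> bool" where
  "centered_array M kn X \<longleftrightarrow>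
     filterlim kn at_top sequentially \<and>
     (\<forall>n\<ge>1. prob_space (M n) \<and>
        prob_space.indep_vars (M n) (\<lambda>_. borel) (\<lambda>k. X k n) {1..kn n} \<and>
        (\<forall>k\<in>{1..kn n}. integrable (M n) (\<lambda>\<omega>. (X k n \<omega>)\<^sup>2) \<and>
                        prob_space.expectation (M n) (X k n) = 0))"

definition BVH ::
    "(nat \<Rightarrow> 'a measure) \<Rightarrow> (nat \<Rightarrow> nat) \<Rightarrow> (nat \<Rightarrow> nat \<Rightarrow> 'a \<Rightarrow> real) \<Rightarrow> bool" where
  "BVH M kn X \<longleftrightarrow>
     bdd_above ((\<lambda>n. \<Sum>k=1..kn n. prob_space.variance (M n) (X k n)) ` {1..})"

definition UAN ::
    "(nat \<Rightarrow> 'a measure) \<Rightarrow> (nat \<Rightarrow> nat) \<Rightarrow> (nat \<Rightarrow> nat \<Rightarrow> 'a \<Rightarrow> real) \<Rightarrow> bool" where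
  "UAN M kn X \<longleftrightarrow>
     (\<forall>\<epsilon>>0. (\<lambda>n. SUP k\<in>{1..kn n}. measure (M n) {\<omega>\<in>space (M n). \<bar>X k n \<omega>\<bar> \<ge> \<epsilon>})
              \<longlonglongrightarrow> 0)"

definition row_sum_law ::
    "(nat \<Rightarrow> 'a measure) \<Rightarrow> (nat \<Rightarrow> nat) \<Rightarrow> (nat \<Rightarrow> nat \<Rightarrow> 'a \<Rightarrow> real) \<Rightarrow> nat \<Rightarrow> real measure" where
  "row_sum_law M kn X n = distr (M n) borel (\<lambda>\<omega>. \<Sum>k=1..kn n. X k n \<omega>)"

text \<open>For a cumulative distribution function \<open>F\<close>, integration \<open>dF\<close> is integration with respect to
  \<open>interval_measure F\<close>.\<close>

definition array_df ::
    "(nat \<Rightarrow> 'a measure) \<Rightarrow> (nat \<Rightarrow> nat) \<Rightarrow> (nat \<Rightarrow> nat \<Rightarrow> 'a \<Rightarrow> real) \<Rightarrow> nat \<Rightarrow> real \<Rightarrow> real" where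
  "array_df M kn X n x =
     (\<Sum>k=1..kn n. LINT y:{..x}|interval_measure (cdf (distr (M n) borel (X k n))). y\<^sup>2)"

section \<open>Infinitely decomposable laws\<close>

definition infinitely_decomposable :: "real measure \<Rightarrow> bool" where
  "infinitely_decomposable P \<longleftrightarrow>
     (\<forall>p\<ge>1::nat. \<exists>Q. real_distribution Q \<and> (\<forall>u. char P u = char Q u ^ p))"

text \<open>\<open>Y 1, \<dots>, Y n\<close> are independent and identically distributed on \<open>M\<close> and their sum has law \<open>P\<close>.\<close>

definition iid_decomposition ::
    "real measure \<Rightarrow> nat \<Rightarrow> 'a measure \<Rightarrow> (nat \<Rightarrow> 'a \<Rightarrow> real) \<Rightarrow> bool" where
  "iid_decomposition P n M Y \<longleftrightarrow>
     prob_space M \<and>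
     prob_space.indep_vars M (\<lambda>_. borel) Y {1..n} \<and>
     (\<forall>i\<in>{1..n}. \<forall>j\<in>{1..n}. distr M borel (Y i) = distr M borel (Y j)) \<and>
     distr M borel (\<lambda>\<omega>. \<Sum>i=1..n. Y i \<omega>) = P"

section \<open>Distribution functions and their associated laws\<close>

definition dist_fun :: "(real \<Rightarrow> real) \<Rightarrow> bool" where
  "dist_fun K \<longleftrightarrow> bounded (range K) \<and> mono K \<and> (\<forall>x. continuous (at_right x) K)"

text \<open>
  A distribution function enters only through the increments \<open>K b - K a\<close> of its measure, so it is
  determined up to an additive constant, and pre-weak convergence (\<open>weak_conv\<close>: pointwise convergence
  at the continuity points of the limit) is understood up to additive constants \<open>c n\<close>. They cannot
  be dispensed with by normalising to limit 0 at \<open>-\<infinity>\<close>, since mass of \<open>Kn n\<close> may escape to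
  \<open>-\<infinity>\<close>: for \<open>n \<ge> 2\<close> take \<open>n\<close> independent copies of a centered variable that is \<open>-n\<close> with probability \<open>1/n^3\<close>
  and constant otherwise. Their sums tend to 0 in law, the law associated with \<open>K = 0\<close>, but their
  second-moment distribution functions tend to 1 everywhere; if every other row is replaced by its
  mirror image they do not converge at all. When no mass escapes to \<open>-\<infinity>\<close>
  (\<open>no_escape_at_bot\<close>), normalised \<open>K\<close> needs no constants.
\<close>

definition pre_weak_conv :: "(nat \<Rightarrow> real \<Rightarrow> real) \<Rightarrow> (real \<Rightarrow> real) \<Rightarrow> bool" where
  "pre_weak_conv Kn K \<longleftrightarrow> (\<exists>c. weak_conv (\<lambda>n x. Kn n x - c n) K)"

definition no_escape_at_bot :: "(nat \<Rightarrow> real \<Rightarrow> real) \<Rightarrow> bool" where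
  "no_escape_at_bot Kn \<longleftrightarrow> (\<forall>\<epsilon>>0. \<exists>a. \<forall>\<^sub>F n in sequentially. Kn n a < \<epsilon>)"

definition Psi :: "(real \<Rightarrow> real) \<Rightarrow> real \<Rightarrow> complex" where
  "Psi K u =
     (CLINT x|interval_measure K.
        (if x = 0 then - complex_of_real (u\<^sup>2 / 2)
         else (iexp (u * x) - 1 - \<i> * complex_of_real (u * x)) / complex_of_real (x\<^sup>2)))"

definition assoc_law :: "(real \<Rightarrow> real) \<Rightarrow> real measure" where
  "assoc_law K = (THE P. real_distribution P \<and> (\<forall>u. char P u = exp (Psi K u)))"

end

theory Submission
  imports Defs
begin

text \<open>
  Write \<open>k u x\<close> for the kernel \<open>(exp (\<i>ux) - 1 - \<i>ux) / x\<^sup>2\<close>, so that \<open>Psi K u\<close> is the integral of \<open>k u\<close> against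
  \<open>dK\<close>. A centered square integrable \<open>X\<close> with law \<open>F\<close> and characteristic function \<open>\<phi>\<close> satisfies
  \<open>\<phi> u - 1 = \<integral>x\<^sup>2 k u x dF x\<close>, because subtracting \<open>\<i>ux\<close> costs nothing. Summed over a row of the array this
  says that \<open>Psi\<close> of the second-moment distribution function \<open>K\<^sub>n\<close> is the sum of the \<open>\<phi>\<^sub>k u - 1\<close>. The
  characteristic function of the row sum is the product of the \<open>\<phi>\<^sub>k\<close>, and it differs from
  \<open>exp (\<Sum>k. \<phi>\<^sub>k - 1)\<close> by at most a constant times \<open>max\<^sub>k \<bar>\<phi>\<^sub>k - 1\<bar>\<close> times \<open>\<Sum>k. \<bar>\<phi>\<^sub>k - 1\<bar>\<close>. Negligibility
  sends the first factor to 0 and the variance bound controls the second, so the characteristic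
  function of the row sum is asymptotically \<open>exp (Psi K\<^sub>n)\<close> (\<open>char_row_sum_asymp\<close>). What remains is
  to understand the map from \<open>K\<close> to \<open>exp (Psi K)\<close>.

  Since \<open>k u\<close> is continuous and vanishes at infinity, \<open>Psi\<close> is continuous for convergence of
  distribution functions at continuity points with bounded total mass, whether or not mass escapes
  (\<open>vague_convergence_integral\<close>). It is injective up to additive constants, because its second
  difference quotients recover the Fourier transform of \<open>dK\<close> (\<open>Psi_inj\<close>); and \<open>exp (Psi K)\<close>
  determines \<open>Psi K\<close>, a continuous function that vanishes at 0 (\<open>exp_Psi_inj\<close>). Every
  \<open>exp (Psi K)\<close> is a characteristic function, as a limit of laws of sums of independent identically
  distributed variables (\<open>exp_Psi_is_char\<close>).

  These facts give the theorem. If \<open>K\<^sub>n\<close> converges, so does \<open>exp (Psi K\<^sub>n)\<close>, and the continuity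
  theorem of Levy yields convergence of the row sums. Conversely, Helly's selection theorem extracts
  from every subsequence of \<open>K\<^sub>n\<close> a further one with a limit \<open>L\<close> (\<open>vague_subsequence\<close>), along which
  the row sums converge to the law of exponent \<open>Psi L\<close>. Therefore any limit law has a characteristic
  function \<open>exp (Psi L)\<close>, whose \<open>p\<close>-th root \<open>exp (Psi (L / p))\<close> is again a characteristic function; and if the
  limit law is that of \<open>K\<close>, all the subsequential limits \<open>L\<close> equal \<open>K\<close> up to constants. Finally, the
  \<open>n\<close> independent identically distributed summands of a square integrable law share its variance
  equally, so by Chebyshev's inequality they form a negligible array (\<open>iid_decomposition_array\<close>).
\<close>

section \<open>The Kolmogorov kernel\<close>

definition kolmogorov_kernel :: "real \<Rightarrow> real \<Rightarrow> complex" where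
  "kolmogorov_kernel u x =
     (if x = 0 then - complex_of_real (u\<^sup>2 / 2)
      else (iexp (u * x) - 1 - \<i> * complex_of_real (u * x)) / complex_of_real (x\<^sup>2))"

lemma Psi_kolmogorov_kernel: "Psi K u = (CLINT x|interval_measure K. kolmogorov_kernel u x)"
  by (simp add: Psi_def kolmogorov_kernel_def)

lemma norm_iexp_taylor1: "cmod (iexp y - 1 - \<i> * complex_of_real y) \<le> y\<^sup>2 / 2"
  using iexp_approx1[of y 1] by (simp add: diff_diff_eq power2_eq_square)

lemma norm_iexp_taylor2:
  "cmod (iexp y - (1 + \<i> * complex_of_real y - complex_of_real (y\<^sup>2 / 2))) \<le> \<bar>y\<bar>^3 / 6"
proof -
  have "(\<Sum>k\<le>2. (\<i> * complex_of_real y)^k / fact k) = 1 + \<i> * complex_of_real y - complex_of_real (y\<^sup>2 / 2)"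
    by (simp add: numeral_2_eq_2 power2_eq_square algebra_simps)
  then show ?thesis
    using iexp_approx1[of y 2] by (simp add: fact_numeral numeral_3_eq_3)
qed

lemma square_mult_kolmogorov_kernel:
  "complex_of_real (x\<^sup>2) * kolmogorov_kernel u x = iexp (u * x) - 1 - \<i> * complex_of_real (u * x)"
  by (simp add: kolmogorov_kernel_def)

lemma norm_kolmogorov_kernel_le: "cmod (kolmogorov_kernel u x) \<le> u\<^sup>2 / 2"
proof (cases "x = 0")
  case False
  have "cmod (kolmogorov_kernel u x) = cmod (iexp (u * x) - 1 - \<i> * complex_of_real (u * x)) / x\<^sup>2"
    using False by (simp add: kolmogorov_kernel_def norm_divide norm_power del: of_real_mult)
  also have "\<dots> \<le> ((u * x)\<^sup>2 / 2) / x\<^sup>2"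
    by (intro divide_right_mono norm_iexp_taylor1) simp
  finally show ?thesis using False by (simp add: power_mult_distrib)
qed (simp add: kolmogorov_kernel_def norm_power norm_divide)

text \<open>
  The value \<open>- u\<^sup>2 / 2\<close> at 0 is the one that the second-order Taylor polynomial of \<open>exp (\<i>ux)\<close> forces.
  Continuity there is what lets mass of \<open>K\<close> at 0, the Gaussian part of the law, arise as a limit of
  small jumps.
\<close>

lemma isCont_kolmogorov_kernel: "isCont (kolmogorov_kernel u) x"
proof (cases "x = 0")
  case False
  have "isCont (\<lambda>x. (iexp (u * x) - 1 - \<i> * complex_of_real (u * x)) / complex_of_real (x\<^sup>2)) x"
    using False by (intro continuous_intros) auto
  moreover have "\<forall>\<^sub>F y in nhds x. (iexp (u * y) - 1 - \<i> * complex_of_real (u * y)) / complex_of_real (y\<^sup>2)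
      = kolmogorov_kernel u y"
    using t1_space_nhds[OF False] by eventually_elim (simp add: kolmogorov_kernel_def)
  ultimately show ?thesis
    by (simp add: isCont_cong)
next
  case True
  have bound: "cmod (kolmogorov_kernel u y - kolmogorov_kernel u 0) \<le> \<bar>u\<bar>^3 * \<bar>y\<bar> / 6" for y
  proof (cases "y = 0")
    case False
    have "cmod (iexp (u * y) - (1 + \<i> * complex_of_real (u * y) - complex_of_real (u\<^sup>2 * y\<^sup>2 / 2))) \<le> \<bar>u * y\<bar>^3 / 6"
      using norm_iexp_taylor2[of "u * y"] unfolding power_mult_distrib .
    moreover have "kolmogorov_kernel u y - kolmogorov_kernel u 0 = 
       (iexp (u * y) - (1 + \<i> * complex_of_real (u * y) - complex_of_real (u\<^sup>2 * y\<^sup>2 / 2))) / complex_of_real (y\<^sup>2)"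
      using False by (simp add: kolmogorov_kernel_def field_simps)
    ultimately have "cmod (kolmogorov_kernel u y - kolmogorov_kernel u 0) \<le> (\<bar>u * y\<bar>^3 / 6) / y\<^sup>2"
      by (simp only: norm_divide norm_of_real abs_power2) (intro divide_right_mono; simp)
    also have "\<dots> = \<bar>u\<bar>^3 * \<bar>y\<bar> / 6"
      using False by (simp add: abs_mult field_simps power2_eq_square power3_eq_cube)
    finally show ?thesis .
  qed simp
  have "((\<lambda>y. \<bar>u\<bar>^3 * \<bar>y\<bar> / 6) \<longlongrightarrow> \<bar>u\<bar>^3 * \<bar>0\<bar> / 6) (at 0)"
    by (intro tendsto_intros) auto
  then have "((\<lambda>y. kolmogorov_kernel u y - kolmogorov_kernel u 0) \<longlongrightarrow> 0) (at 0)"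
    by (intro Lim_null_comparison[OF always_eventually[OF allI[OF bound]]]) simp
  then show ?thesis
    using True by (simp add: isCont_def LIM_zero_iff)
qed

lemma borel_measurable_kolmogorov_kernel [measurable]: "kolmogorov_kernel u \<in> borel_measurable borel"
  by (intro borel_measurable_continuous_onI continuous_at_imp_continuous_on ballI isCont_kolmogorov_kernel)

lemma isCont_kolmogorov_kernel_frequency: "isCont (\<lambda>u. kolmogorov_kernel u x) u"
  unfolding kolmogorov_kernel_def by (cases "x = 0") (auto intro!: continuous_intros)

text \<open>
  The linear term grows more slowly than \<open>x\<^sup>2\<close>. Because of this decay, mass that escapes to infinity
  does not contribute to the limit of \<open>Psi\<close>.
\<close>

lemma kolmogorov_kernel_at_infinity: "(kolmogorov_kernel u \<longlongrightarrow> 0) at_infinity"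
proof (rule Lim_null_comparison)
  have "cmod (kolmogorov_kernel u x) \<le> 2 * inverse \<bar>x\<bar> ^ 2 + \<bar>u\<bar> * inverse \<bar>x\<bar>" if "x \<noteq> 0" for x
  proof -
    have "cmod (iexp (u * x) - 1 - \<i> * complex_of_real (u * x)) \<le> 2 + \<bar>u * x\<bar>"
      using norm_triangle_ineq4[of "iexp (u * x) - 1" "\<i> * complex_of_real (u * x)"]
        norm_triangle_ineq4[of "iexp (u * x)" 1] norm_exp_i_times[of "u * x"]
      by (simp only: norm_mult norm_ii norm_of_real norm_one)
    then have "cmod (kolmogorov_kernel u x) \<le> (2 + \<bar>u * x\<bar>) / x\<^sup>2"
      using that by (simp add: kolmogorov_kernel_def norm_divide norm_power divide_right_mono del: of_real_mult)
    also have "\<dots> = 2 * inverse \<bar>x\<bar> ^ 2 + \<bar>u\<bar> * inverse \<bar>x\<bar>"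
      using that by (simp add: field_simps abs_mult power2_eq_square)
    finally show ?thesis .
  qed
  then show "\<forall>\<^sub>F x in at_infinity. cmod (kolmogorov_kernel u x) \<le> 2 * inverse \<bar>x\<bar> ^ 2 + \<bar>u\<bar> * inverse \<bar>x\<bar>"
    by (auto simp: eventually_at_infinity intro!: exI[of _ 1])
  have "((\<lambda>x::real. inverse \<bar>x\<bar>) \<longlongrightarrow> 0) at_infinity"
    by (rule tendsto_inverse_0_at_top)
       (use filterlim_norm_at_top[where 'a=real] in \<open>simp add: real_norm_def[abs_def]\<close>)
  then have "((\<lambda>x::real. 2 * inverse \<bar>x\<bar> ^ 2 + \<bar>u\<bar> * inverse \<bar>x\<bar>) \<longlongrightarrow> 2 * 0 ^ 2 + \<bar>u\<bar> * 0) at_infinity"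
    by (intro tendsto_intros)
  then show "((\<lambda>x::real. 2 * inverse \<bar>x\<bar> ^ 2 + \<bar>u\<bar> * inverse \<bar>x\<bar>) \<longlongrightarrow> 0) at_infinity" by simp
qed

section \<open>Distribution functions as finite measures\<close>

text \<open>
  Weak convergence, thinning and uniqueness of Fourier transforms concern probability laws. Finite
  measures are brought into their scope by this factorization; a null measure gets an arbitrary law
  with weight 0.
\<close>

lemma finite_borel_measure_normalize:
  assumes "finite_borel_measure N"
  obtains R where "real_distribution R" "N = density R (\<lambda>_. ennreal (measure N UNIV))"
proof -
  interpret N: finite_borel_measure N by fact
  note [measurable_cong] = N.M_is_borel
  have emN: "emeasure N UNIV = ennreal (measure N UNIV)"
    using N.emeasure_eq_measure by simp
  show ?thesis
  proof (cases "measure N UNIV = 0")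
    case True
    have "N = density (return borel 0) (\<lambda>_. ennreal (measure N UNIV))"
    proof (rule measure_eqI)
      fix A assume "A \<in> sets N"
      then have "emeasure N A \<le> emeasure N UNIV" 
        using N.borel_UNIV by (metis emeasure_space)
      then show "emeasure N A = emeasure (density (return borel 0) (\<lambda>_. ennreal (measure N UNIV))) A"
        using True \<open>A \<in> sets N\<close> N.M_is_borel emN by (simp add: emeasure_density)
    qed (simp add: N.M_is_borel)
    moreover have "real_distribution (return borel 0)"
      by (auto simp: real_distribution_def real_distribution_axioms_def intro!: prob_space_return)
    ultimately show thesis by (intro that)
  next
    case False
    define m where "m = measure N UNIV"
    have m: "m > 0" using False by (simp add: m_def zero_less_measure_iff)
    define R where "R = density N (\<lambda>_. ennreal (1 / m))"
    have "N = density R (\<lambda>_. ennreal m)"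
      using m by (simp add: R_def density_density_eq ennreal_mult[symmetric] density_1)
    moreover have "real_distribution R"
      unfolding real_distribution_def real_distribution_axioms_def
    proof
      show "prob_space R"
      proof
        have "emeasure R UNIV = ennreal (1 / m) * emeasure N UNIV"
          using N.M_is_borel by (simp add: R_def emeasure_density_const)
        then show "emeasure R (space R) = 1"
          using m emN by (simp add: R_def N.borel_UNIV m_def[symmetric] ennreal_mult[symmetric])
      qed
    qed (simp add: R_def N.M_is_borel)
    ultimately show thesis using that by (simp add: m_def)
  qed
qed

lemma integral_density_const:
  fixes f :: "real \<Rightarrow> 'b::{banach, second_countable_topology}"
  assumes "f \<in> borel_measurable R" "0 \<le> c"
  shows "(\<integral>x. f x \<partial>density R (\<lambda>_. ennreal c)) = c *\<^sub>R (\<integral>x. f x \<partial>R)"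
  using assms by (subst integral_density) auto

lemma cdf_density_const:
  assumes "sets R = sets borel" "0 \<le> c"
  shows "cdf (density R (\<lambda>_. ennreal c)) x = c * cdf R x"
  using assms by (simp add: cdf_def measure_def emeasure_density_const enn2real_mult)

lemma dist_funD:
  assumes "dist_fun K"
  shows "mono K" "continuous (at_right x) K" "bounded (range K)"
  using assms by (auto simp: dist_fun_def)

text \<open>
  Only increments enter the associated measure, so a distribution function matters up to an additive
  constant.
\<close>

lemma interval_measure_shift: "interval_measure (\<lambda>x. K x + c) = interval_measure K"
  by (simp add: interval_measure_def)

lemma mono_bounded_limits:
  fixes K :: "real \<Rightarrow> real"
  assumes "mono K" "bounded (range K)"
  obtains a b where "(K \<longlongrightarrow> a) at_bot" "(K \<longlongrightarrow> b) at_top" "\<And>x. a \<le> K x" "\<And>x. K x \<le> b"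
proof -
  have bdd: "bdd_above (range K)" "bdd_below (range K)"
    using assms(2) by (auto intro: bounded_imp_bdd_above bounded_imp_bdd_below)
  have 1: "(K \<longlongrightarrow> (INF x. K x)) at_bot"
  proof (rule decreasing_tendsto)
    show "\<forall>\<^sub>F n in at_bot. (INF x. K x) \<le> K n"
      by (intro always_eventually allI cINF_lower bdd) auto
    fix x assume "(INF x. K x) < x"
    then obtain y where "K y < x" using cINF_less_iff[of UNIV K x] bdd by auto
    then show "\<forall>\<^sub>F n in at_bot. K n < x"
      using assms(1) by (auto simp: eventually_at_bot_linorder mono_def intro!: exI[of _ y] intro: le_less_trans)
  qed
  have 2: "(K \<longlongrightarrow> (SUP x. K x)) at_top"
  proof (rule increasing_tendsto)
    show "\<forall>\<^sub>F n in at_top. K n \<le> (SUP x. K x)"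
      by (intro always_eventually allI cSUP_upper bdd) auto
    fix x assume "x < (SUP x. K x)"
    then obtain y where "x < K y" using less_cSUP_iff[of UNIV K x] bdd by auto
    then show "\<forall>\<^sub>F n in at_top. x < K n"
      using assms(1) by (auto simp: eventually_at_top_linorder mono_def intro!: exI[of _ y] intro: less_le_trans)
  qed
  show thesis
    by (rule that[OF 1 2]) (auto intro!: cINF_lower cSUP_upper bdd)
qed

text \<open>
  Subtracting the limit at \<open>-\<infinity>\<close> turns \<open>K\<close> into the cumulative function of its own measure.
\<close>

lemma dist_fun_interval_measure:
  assumes "dist_fun K"
  shows "finite_borel_measure (interval_measure K)"
    and "\<exists>a. (K \<longlongrightarrow> a) at_bot \<and> (\<forall>x. K x = a + cdf (interval_measure K) x)"
proof -
  obtain a b where ab: "(K \<longlongrightarrow> a) at_bot" "(K \<longlongrightarrow> b) at_top" "\<And>x. a \<le> K x" "\<And>x. K x \<le> b"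
    using mono_bounded_limits[OF dist_funD(1,3)[OF assms]] by blast
  define F where "F x = K x + - a" for x
  have F: "\<And>x y. x \<le> y \<Longrightarrow> F x \<le> F y" "\<And>x. continuous (at_right x) F"
    "(F \<longlongrightarrow> 0) at_bot" "(F \<longlongrightarrow> b - a) at_top" "0 \<le> b - a"
    using dist_funD[OF assms] ab order_trans[OF ab(3) ab(4)] unfolding F_def
    by (auto simp: mono_def intro!: continuous_intros tendsto_eq_intros)
  have eq: "interval_measure K = interval_measure F"
    unfolding F_def by (rule interval_measure_shift[symmetric])
  show "finite_borel_measure (interval_measure K)"
    unfolding eq by (rule finite_borel_measure_interval_measure[OF F])
  show "\<exists>a. (K \<longlongrightarrow> a) at_bot \<and> (\<forall>x. K x = a + cdf (interval_measure K) x)"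
    unfolding eq cdf_interval_measure[OF F(1-3), simplified] using ab(1) 
    by (intro exI[of _ a]) (simp add: F_def)
qed

lemma dist_fun_cdf:
  assumes "finite_borel_measure N"
  shows "dist_fun (cdf N)"
proof -
  interpret N: finite_borel_measure N by fact
  have "\<bar>cdf N x\<bar> \<le> measure N (space N)" for x
    using N.cdf_nonneg N.cdf_bounded by simp
  then show ?thesis
    unfolding dist_fun_def bounded_iff
    by (auto simp: mono_def N.cdf_nondecreasing N.cdf_is_right_cont)
qed

lemma interval_measure_cdf:
  assumes "finite_borel_measure N"
  shows "interval_measure (cdf N) = N"
proof (rule cdf_unique'[OF dist_fun_interval_measure(1)[OF dist_fun_cdf[OF assms]] assms])
  interpret N: finite_borel_measure N by fact
  show "cdf (interval_measure (cdf N)) = cdf N"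
    by (rule cdf_interval_measure) (auto simp: N.cdf_nondecreasing N.cdf_is_right_cont N.cdf_lim_at_bot)
qed

lemma Psi_cdf: "finite_borel_measure N \<Longrightarrow> Psi (cdf N) u = (CLINT x|N. kolmogorov_kernel u x)"
  by (simp add: Psi_kolmogorov_kernel interval_measure_cdf)

lemma finite_borel_measure_density_const:
  assumes "finite_borel_measure N"
  shows "finite_borel_measure (density N (\<lambda>_. ennreal c))"
proof -
  interpret N: finite_borel_measure N by fact
  show ?thesis
    unfolding finite_borel_measure_def finite_borel_measure_axioms_def
  proof
    show "finite_measure (density N (\<lambda>_. ennreal c))"
      by standard (auto simp: emeasure_density_const N.emeasure_eq_measure ennreal_mult[symmetric] ennreal_mult_eq_top_iff)
  qed (simp add: N.M_is_borel)
qed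

text \<open>
  Dividing \<open>K\<close> by \<open>p\<close> divides the exponent by \<open>p\<close>. This is where \<open>p\<close>-th roots of \<open>exp (Psi K)\<close> come from.
\<close>

lemma Psi_scale:
  assumes "dist_fun K" "0 \<le> c"
  shows "dist_fun (\<lambda>x. c * K x)" "Psi (\<lambda>x. c * K x) u = c * Psi K u"
proof -
  let ?N = "interval_measure K" and ?cN = "density (interval_measure K) (\<lambda>_. ennreal c)"
  have fin: "finite_borel_measure ?N" "finite_borel_measure ?cN"
    using dist_fun_interval_measure(1)[OF assms(1)] finite_borel_measure_density_const by auto
  obtain a where a: "\<And>x. K x = a + cdf ?N x"
    using dist_fun_interval_measure(2)[OF assms(1)] by blast
  have eq: "(\<lambda>x. c * K x) = (\<lambda>x. cdf ?cN x + c * a)"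
    using a assms(2) by (subst cdf_density_const) (auto simp: algebra_simps)
  show "dist_fun (\<lambda>x. c * K x)"
    unfolding dist_fun_def
  proof (intro conjI allI)
    show "bounded (range (\<lambda>x. c * K x))"
      using bounded_scaling[OF dist_funD(3)[OF assms(1)], of c] by (simp add: image_image)
    show "mono (\<lambda>x. c * K x)"
      using dist_funD(1)[OF assms(1)] assms(2) by (auto simp: mono_def intro: mult_left_mono)
    show "continuous (at_right x) (\<lambda>x. c * K x)" for x
      by (intro continuous_intros dist_funD[OF assms(1)])
  qed
  have "Psi (\<lambda>x. c * K x) u = (CLINT x|?cN. kolmogorov_kernel u x)"
    unfolding Psi_kolmogorov_kernel eq interval_measure_shift interval_measure_cdf[OF fin(2)] ..
  also have "\<dots> = c * Psi K u"
    using assms(2) by (subst integral_density_const) (auto simp: Psi_kolmogorov_kernel scaleR_conv_of_real)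
  finally show "Psi (\<lambda>x. c * K x) u = c * Psi K u" .
qed

section \<open>Thinned distributions\<close>

text \<open>
  The law of the following experiment: draw \<open>x\<close> from \<open>R\<close>, then report \<open>T x\<close> with probability \<open>p x\<close> and
  the default value \<open>c\<close> otherwise. The second coordinate is the uniform variable that decides.
\<close>

definition thinned :: "real measure \<Rightarrow> (real \<Rightarrow> real) \<Rightarrow> (real \<Rightarrow> real) \<Rightarrow> real \<Rightarrow> real measure" where
  "thinned R p T c =
     distr (R \<Otimes>\<^sub>M uniform_measure lborel {0<..1}) borel (\<lambda>(x, y). if y \<le> p x then T x else c)"

locale thinning = real_distribution R for R :: "real measure" +
  fixes p T :: "real \<Rightarrow> real" and c :: real
  assumes measurable_p: "p \<in> borel_measurable borel"
    and measurable_T: "T \<in> borel_measurable borel"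
    and p_nonneg: "\<And>x. 0 \<le> p x" and p_le_1: "\<And>x. p x \<le> 1"
begin

abbreviation U :: "real measure" where "U \<equiv> uniform_measure lborel {0<..1}"

lemma prob_space_U: "prob_space U"
  by (rule prob_space_uniform_measure) auto

lemma measure_U: "0 \<le> a \<Longrightarrow> a \<le> 1 \<Longrightarrow> measure U {..a} = a" "0 \<le> a \<Longrightarrow> a \<le> 1 \<Longrightarrow> measure U {a<..} = 1 - a"
proof -
  assume a: "0 \<le> a" "a \<le> 1"
  have "{0<..1} \<inter> {..a} = {0<..a}" "{0<..1} \<inter> {a<..} = {a<..1}" using a by auto
  then show "measure U {..a} = a" "measure U {a<..} = 1 - a"
    using a by (simp_all add: measure_uniform_measure)
qed

lemma real_distribution_thinned: "real_distribution (thinned R p T c)"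
proof -
  note [measurable] = measurable_p measurable_T
  interpret U: prob_space U by (rule prob_space_U)
  interpret P: pair_prob_space R U ..
  show ?thesis
    unfolding thinned_def by (intro P.real_distribution_distr) measurable
qed

lemma integral_U:
  fixes v w :: "'b::{banach, second_countable_topology}"
  assumes "0 \<le> a" "a \<le> 1"
  shows "(\<integral>y. (if y \<le> a then v else w) \<partial>U) = a *\<^sub>R v + (1 - a) *\<^sub>R w"
proof -
  interpret U: prob_space U by (rule prob_space_U)
  have "(\<integral>y. (if y \<le> a then v else w) \<partial>U) = (\<integral>y. indicator {..a} y *\<^sub>R v + indicator {a<..} y *\<^sub>R w \<partial>U)"
    by (intro Bochner_Integration.integral_cong) (auto split: split_indicator)
  also have "\<dots> = measure U {..a} *\<^sub>R v + measure U {a<..} *\<^sub>R w"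
  proof -
    have ind: "integrable U (indicator {..a} :: real \<Rightarrow> real)" "integrable U (indicator {a<..} :: real \<Rightarrow> real)"
      by (auto intro!: U.integrable_const_bound[where B=1])
    have "(\<integral>y. indicator {..a} y *\<^sub>R v + indicator {a<..} y *\<^sub>R w \<partial>U)
        = (\<integral>y. indicator {..a} y *\<^sub>R v \<partial>U) + (\<integral>y. indicator {a<..} y *\<^sub>R w \<partial>U)"
      by (intro Bochner_Integration.integral_add integrable_scaleR_left ind)
    also have "\<dots> = (\<integral>y. indicator {..a} y \<partial>U) *\<^sub>R v + (\<integral>y. indicator {a<..} y \<partial>U) *\<^sub>R w"
      by (simp add: integral_scaleR_left ind)
    finally show ?thesis by simp
  qed
  finally show ?thesis by (simp only: measure_U[OF assms])
qed

lemma integrable_thinned: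
  fixes f :: "real \<Rightarrow> 'b::{banach, second_countable_topology}"
  assumes [measurable]: "f \<in> borel_measurable borel"
    and int: "integrable R (\<lambda>x. p x * norm (f (T x)))"
  shows "integrable (thinned R p T c) f"
    and "(\<integral>x. f x \<partial>thinned R p T c) = (\<integral>x. p x *\<^sub>R f (T x) + (1 - p x) *\<^sub>R f c \<partial>R)"
proof -
  note [measurable] = measurable_p measurable_T
  interpret U: prob_space U by (rule prob_space_U)
  interpret P: pair_prob_space R U ..
  let ?g = "\<lambda>(x, y). if y \<le> p x then f (T x) else f c"
  have eq: "(\<lambda>z. f (case z of (x, y) \<Rightarrow> if y \<le> p x then T x else c)) = ?g"
    by (auto simp: fun_eq_iff)
  have g: "integrable (R \<Otimes>\<^sub>M U) ?g"
  proof (rule P.Fubini_integrable)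
    show "?g \<in> borel_measurable (R \<Otimes>\<^sub>M U)" by measurable
    have "(\<integral>y. norm (?g (x, y)) \<partial>U) = p x * norm (f (T x)) + (1 - p x) * norm (f c)" for x
      using integral_U[OF p_nonneg p_le_1, of x "norm (f (T x))" "norm (f c)"]
      by (simp add: if_distrib[of norm] if_distribR cong: if_cong)
    moreover have "integrable R (\<lambda>x. p x * norm (f (T x)) + (1 - p x) * norm (f c))"
      by (intro Bochner_Integration.integrable_add int integrable_const_bound[of _ "norm (f c)"] AE_I2)
         (auto simp: abs_mult p_nonneg p_le_1 intro!: mult_left_le_one_le)
    ultimately show "integrable R (\<lambda>x. \<integral>y. norm (?g (x, y)) \<partial>U)" by simp
    show "AE x in R. integrable U (\<lambda>y. ?g (x, y))"
    proof (rule AE_I2)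
      fix x
      show "integrable U (\<lambda>y. ?g (x, y))"
        by (intro U.integrable_const_bound[where B="max (norm (f (T x))) (norm (f c))"]) auto
    qed
  qed
  have [measurable]: "(\<lambda>(x, y). if y \<le> p x then T x else c) \<in> borel_measurable (R \<Otimes>\<^sub>M U)"
    by measurable
  show "integrable (thinned R p T c) f"
    unfolding thinned_def using g by (subst integrable_distr_eq) (simp_all add: eq)
  have "(\<integral>x. f x \<partial>thinned R p T c) = (\<integral>z. ?g z \<partial>(R \<Otimes>\<^sub>M U))"
    unfolding thinned_def by (subst integral_distr) (simp_all add: eq)
  also have "\<dots> = (\<integral>x. \<integral>y. ?g (x, y) \<partial>U \<partial>R)"
    by (rule P.integral_fst'[symmetric]) (rule g)
  also have "\<dots> = (\<integral>x. p x *\<^sub>R f (T x) + (1 - p x) *\<^sub>R f c \<partial>R)"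
    by (simp add: integral_U p_nonneg p_le_1)
  finally show "(\<integral>x. f x \<partial>thinned R p T c) = (\<integral>x. p x *\<^sub>R f (T x) + (1 - p x) *\<^sub>R f c \<partial>R)" .
qed

end

section \<open>Vague convergence\<close>

lemma mono_continuity_point:
  fixes F :: "real \<Rightarrow> real"
  assumes "mono F" "a < b"
  obtains x where "a < x" "x < b" "isCont F x"
proof -
  have "\<not> {a<..<b} \<subseteq> {x. \<not> isCont F x}"
    using mono_ctble_discont[OF assms(1)] uncountable_open_interval[of a b] assms(2) countable_subset by blast
  then show thesis using that by auto
qed

text \<open>
  The part of \<open>N\<close> on \<open>]a, b]\<close> is scaled by \<open>1 / C\<close>, and the missing mass is put at \<open>b\<close>, which makes a
  probability law to which weak convergence applies. Outside \<open>]a, b[\<close> the integrand is at most \<open>e\<close>, so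
  neither the discarded mass nor the mass added at \<open>b\<close> changes the integral by more than \<open>C * e\<close>.
\<close>

lemma truncated_distribution:
  fixes f :: "real \<Rightarrow> complex"
  assumes N: "finite_borel_measure N" and C: "measure N UNIV \<le> C" "0 < C" and ab: "a < b"
    and f [measurable]: "f \<in> borel_measurable borel" and B: "\<And>x. norm (f x) \<le> B"
    and e: "\<And>x. x \<le> a \<or> b \<le> x \<Longrightarrow> norm (f x) \<le> e"
  obtains D where "real_distribution D"
    "\<And>x. cdf D x = (if x < a then 0 else if x < b then (cdf N x - cdf N a) / C else 1)"
    "norm (C *\<^sub>R (\<integral>x. f x \<partial>D) - (\<integral>x. f x \<partial>N)) \<le> 2 * C * e"
proof -
  interpret N: finite_borel_measure N by fact
  define m where "m = measure N UNIV"
  obtain R where R: "real_distribution R" "N = density R (\<lambda>_. ennreal m)"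
    using finite_borel_measure_normalize[OF N] unfolding m_def by blast
  interpret R: real_distribution R by fact
  have m: "0 \<le> m" "m \<le> C" using C by (auto simp: m_def)
  have meas: "measure N A = m * measure R A" if "A \<in> sets borel" for A
    unfolding R(2) measure_def using that m(1) by (subst emeasure_density_const) (auto simp: enn2real_mult)
  \<comment> \<open>Thinning the normalized law \<open>R\<close> with default value \<open>b\<close> realizes the truncation.\<close>
  define p where "p x = m / C * indicator {a<..b} x" for x :: real
  have p: "p \<in> borel_measurable borel" "0 \<le> p x" "p x \<le> 1" for x
    using m C(2) by (auto simp: p_def[abs_def] indicator_def divide_simps)
  interpret thinning R p "\<lambda>x. x" b
    by (intro thinning.intro thinning_axioms.intro R p) measurable
  let ?D = "thinned R p (\<lambda>x. x) b"
  interpret D: real_distribution ?D by (rule real_distribution_thinned)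
  have p_int: "integrable R (\<lambda>x. p x * norm (g x))"
    if g: "g \<in> borel_measurable borel" and le: "\<And>x. norm (g x) \<le> B"
    for g :: "real \<Rightarrow> 'b::{banach, second_countable_topology}" and B
  proof -
    have "norm (p x * norm (g x)) \<le> B" for x
    proof -
      have "p x * norm (g x) \<le> 1 * norm (g x)"
        by (intro mult_right_mono p_le_1 norm_ge_zero)
      then show ?thesis using le[of x] p_nonneg[of x] by (simp add: abs_mult)
    qed
    moreover have "(\<lambda>x. p x * norm (g x)) \<in> borel_measurable R"
      using g p(1) by measurable
    ultimately show ?thesis
      by (intro R.integrable_const_bound[where B=B] AE_I2) auto
  qed
  show thesis
  proof (rule that)
    show "real_distribution ?D" by (rule real_distribution_thinned)
  next
    fix x
    have "cdf ?D x = (\<integral>y. indicator {..x} y \<partial>?D)"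
      by (simp add: cdf_def)
    also have "\<dots> = (\<integral>y. p y *\<^sub>R indicator {..x} y + (1 - p y) *\<^sub>R indicator {..x} b \<partial>R)"
      by (intro integrable_thinned(2) p_int[of _ 1]) (auto split: split_indicator)
    also have "\<dots> = (if x < a then 0 else if x < b then (cdf N x - cdf N a) / C else 1)"
    proof (cases "x < b")
      case True
      then have "(\<integral>y. p y *\<^sub>R indicator {..x} y + (1 - p y) *\<^sub>R indicator {..x} b \<partial>R) 
        = (\<integral>y. m / C * indicator ({a<..b} \<inter> {..x}) y \<partial>R)"
        by (intro Bochner_Integration.integral_cong) (auto simp: p_def split: split_indicator)
      also have "\<dots> = measure N ({a<..b} \<inter> {..x}) / C"
        by (simp add: meas)
      also have "{a<..b} \<inter> {..x} = {a<..x}" using True by auto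
      also have "measure N {a<..x} = (if x < a then 0 else cdf N x - cdf N a)"
      proof (cases "a < x")
        case True
        then show ?thesis using N.cdf_diff_eq by auto
      qed (auto simp: not_less)
      finally show ?thesis using True by simp
    next
      case False
      then have "(\<integral>y. p y *\<^sub>R indicator {..x} y + (1 - p y) *\<^sub>R indicator {..x} b \<partial>R) = (\<integral>y. (1::real) \<partial>R)"
        by (intro Bochner_Integration.integral_cong) (auto simp: p_def split: split_indicator)
      also have "\<dots> = 1" using R.prob_space by simp
      finally show ?thesis using False ab by simp
    qed
    finally show "cdf ?D x = (if x < a then 0 else if x < b then (cdf N x - cdf N a) / C else 1)" .
  next
    have f_int: "integrable R f" by (rule R.integrable_const_bound[of _ B]) (auto simp: B)
    have D_int: "integrable R (\<lambda>x. p x *\<^sub>R f x + (1 - p x) *\<^sub>R f b)"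
    proof (rule R.integrable_const_bound)
      show "AE x in R. norm (p x *\<^sub>R f x + (1 - p x) *\<^sub>R f b) \<le> B + B"
      proof (intro AE_I2 order_trans[OF norm_triangle_ineq] add_mono)
        fix x
        show "norm (p x *\<^sub>R f x) \<le> B" "norm ((1 - p x) *\<^sub>R f b) \<le> B"
          using mult_mono[OF p_le_1[of x] B[of x]] p_nonneg[of x] p_le_1[of x]
            mult_mono[of "1 - p x" 1, OF _ B[of b]] by simp_all
      qed
    qed (use p(1) in measurable)
    have "C *\<^sub>R (\<integral>x. f x \<partial>?D) - (\<integral>x. f x \<partial>N)
        = C *\<^sub>R (\<integral>x. p x *\<^sub>R f x + (1 - p x) *\<^sub>R f b \<partial>R) - m *\<^sub>R (\<integral>x. f x \<partial>R)"
    proof -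
      have "(\<integral>x. f x \<partial>?D) = (\<integral>x. p x *\<^sub>R f x + (1 - p x) *\<^sub>R f b \<partial>R)"
        by (intro integrable_thinned(2) p_int[OF _ B]) measurable
      moreover have "(\<integral>x. f x \<partial>N) = m *\<^sub>R (\<integral>x. f x \<partial>R)"
        unfolding R(2) by (intro integral_density_const m(1)) measurable
      ultimately show ?thesis by simp
    qed
    also have "\<dots> = (\<integral>x. C *\<^sub>R (p x *\<^sub>R f x + (1 - p x) *\<^sub>R f b) - m *\<^sub>R f x \<partial>R)"
      using f_int D_int by (subst Bochner_Integration.integral_diff) auto
    also have "norm \<dots> \<le> (\<integral>x. norm (C *\<^sub>R (p x *\<^sub>R f x + (1 - p x) *\<^sub>R f b) - m *\<^sub>R f x) \<partial>R)"
      by (rule integral_norm_bound)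
    also have "\<dots> \<le> (\<integral>x. 2 * C * e \<partial>R)"
    proof (rule integral_mono)
      show "integrable R (\<lambda>x. norm (C *\<^sub>R (p x *\<^sub>R f x + (1 - p x) *\<^sub>R f b) - m *\<^sub>R f x))"
        using f_int D_int by (intro integrable_norm Bochner_Integration.integrable_diff integrable_scaleR_right)
      fix x
      have e0: "0 \<le> e" using order_trans[OF norm_ge_zero e[of a]] by simp
      show "norm (C *\<^sub>R (p x *\<^sub>R f x + (1 - p x) *\<^sub>R f b) - m *\<^sub>R f x) \<le> 2 * C * e"
      proof (cases "x \<in> {a<..b}")
        case True
        then have "C *\<^sub>R (p x *\<^sub>R f x + (1 - p x) *\<^sub>R f b) - m *\<^sub>R f x = (C - m) *\<^sub>R f b"
          using C by (simp add: p_def scaleR_add_right scaleR_diff_left scaleR_diff_right right_diff_distrib)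
        then have "norm (C *\<^sub>R (p x *\<^sub>R f x + (1 - p x) *\<^sub>R f b) - m *\<^sub>R f x) = (C - m) * norm (f b)"
          using m by simp
        also have "\<dots> \<le> C * e" using m e[of b] e0 by (intro mult_mono) auto
        finally show ?thesis using mult_nonneg_nonneg[of C e] C e0 by linarith
      next
        case False
        then have "C *\<^sub>R (p x *\<^sub>R f x + (1 - p x) *\<^sub>R f b) - m *\<^sub>R f x = C *\<^sub>R f b - m *\<^sub>R f x"
          by (simp add: p_def)
        also have "norm \<dots> \<le> C * norm (f b) + m * norm (f x)"
          using norm_triangle_ineq4[of "C *\<^sub>R f b" "m *\<^sub>R f x"] C m by simp
        also have "\<dots> \<le> C * e + C * e"
          using False m C e[of x] e[of b] e0 by (intro add_mono mult_mono) auto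
        finally show ?thesis by simp
      qed
    qed simp
    also have "\<dots> = 2 * C * e" using R.prob_space by simp
    finally show "norm (C *\<^sub>R (\<integral>x. f x \<partial>?D) - (\<integral>x. f x \<partial>N)) \<le> 2 * C * e" .
  qed
qed

text \<open>
  The constants \<open>c n\<close> cancel in increments, and truncation at continuity points \<open>a\<close> and \<open>b\<close> only sees
  increments. Truncating where \<open>f\<close> is small reduces the claim to weak convergence of the truncated
  laws, at a cost that is uniform in \<open>n\<close> because the total masses are bounded. Mass that
  escapes beyond \<open>a\<close> or \<open>b\<close> meets a small integrand.
\<close>

theorem vague_convergence_integral:
  fixes f :: "real \<Rightarrow> complex" and N :: "nat \<Rightarrow> real measure"
  assumes N: "\<And>n. finite_borel_measure (N n)" and L: "finite_borel_measure L"
    and mass: "\<And>n. measure (N n) UNIV \<le> C"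
    and conv: "weak_conv (\<lambda>n x. cdf (N n) x - c n) (cdf L)"
    and f: "\<And>x. isCont f x" "\<And>x. norm (f x) \<le> B" "(f \<longlongrightarrow> 0) at_infinity"
  shows "(\<lambda>n. \<integral>x. f x \<partial>N n) \<longlonglongrightarrow> (\<integral>x. f x \<partial>L)"
proof (rule tendstoI)
  fix e :: real assume "e > 0"
  interpret L: finite_borel_measure L by fact
  have [measurable]: "f \<in> borel_measurable borel"
    by (intro borel_measurable_continuous_onI continuous_at_imp_continuous_on ballI f(1))
  define C' where "C' = max C (measure L UNIV) + 1"
  have C': "C' > 0" "measure (N n) UNIV \<le> C'" "measure L UNIV \<le> C'" for n
    using mass[of n] measure_nonneg[of L UNIV] unfolding C'_def by linarith+
  define \<epsilon> where "\<epsilon> = e / (6 * C')"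
  have "\<epsilon> > 0" using \<open>e > 0\<close> C' by (simp add: \<epsilon>_def)
  then obtain r where r: "\<And>x. r \<le> \<bar>x\<bar> \<Longrightarrow> norm (f x) < \<epsilon>" "r > 0"
    using tendstoD[OF f(3) \<open>\<epsilon> > 0\<close>] by (auto simp: eventually_at_infinity_pos)
  have mono: "mono (cdf L)" by (auto simp: mono_def L.cdf_nondecreasing)
  obtain a where a: "a < - r" "isCont (cdf L) a"
    using mono_continuity_point[OF mono, of "- r - 1" "- r"] by auto
  obtain b where b: "r < b" "isCont (cdf L) b"
    using mono_continuity_point[OF mono, of r "r + 1"] by auto
  have ab: "a < b" and fe: "\<And>x. x \<le> a \<or> b \<le> x \<Longrightarrow> norm (f x) \<le> \<epsilon>"
    using a b r by (auto intro!: less_imp_le[OF r(1)])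
  let ?P = "\<lambda>M D. real_distribution D \<and>
    (\<forall>x. cdf D x = (if x < a then 0 else if x < b then (cdf M x - cdf M a) / C' else 1)) \<and>
    norm (C' *\<^sub>R (\<integral>x. f x \<partial>D) - (\<integral>x. f x \<partial>M)) \<le> 2 * C' * \<epsilon>"
  have ex: "\<exists>D. ?P M D"
    if M: "finite_borel_measure M" "measure M UNIV \<le> C'" for M
  proof -
    obtain D where "real_distribution D"
      "\<And>x. cdf D x = (if x < a then 0 else if x < b then (cdf M x - cdf M a) / C' else 1)"
      "norm (C' *\<^sub>R (\<integral>x. f x \<partial>D) - (\<integral>x. f x \<partial>M)) \<le> 2 * C' * \<epsilon>"
      by (rule truncated_distribution[OF M C'(1) ab _ f(2) fe]) measurable
    then show ?thesis
      by (intro exI[of _ D]) auto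
  qed
  define D where "D M = (SOME D. ?P M D)" for M
  have D: "real_distribution (D M)"
    "\<And>x. cdf (D M) x = (if x < a then 0 else if x < b then (cdf M x - cdf M a) / C' else 1)"
    "norm (C' *\<^sub>R (\<integral>x. f x \<partial>D M) - (\<integral>x. f x \<partial>M)) \<le> 2 * C' * \<epsilon>"
    if "finite_borel_measure M" "measure M UNIV \<le> C'" for M
    using someI_ex[OF ex[OF that]] unfolding D_def by simp_all
  note DN = D[OF N C'(2)] and DL = D[OF L C'(3)]
  have "weak_conv_m (\<lambda>n. D (N n)) (D L)"
    unfolding weak_conv_m_def weak_conv_def
  proof (intro allI impI)
    fix x assume x: "isCont (cdf (D L)) x"
    have "(\<lambda>n. (cdf (N n) x - cdf (N n) a) / C') \<longlonglongrightarrow> (cdf L x - cdf L a) / C'" if "a < x" "x < b"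
    proof -
      have "\<forall>\<^sub>F y in nhds x. y \<in> {a<..<b}"
        using that by (intro eventually_nhds_in_open) auto
      then have ev: "\<forall>\<^sub>F y in nhds x. C' * cdf (D L) y + cdf L a = cdf L y"
        by eventually_elim (use C' in \<open>simp add: DL(2)\<close>)
      have "isCont (\<lambda>y. C' * cdf (D L) y + cdf L a) x"
        by (intro continuous_intros x)
      then have "isCont (cdf L) x"
        using isCont_cong[OF ev] by simp
      then have "(\<lambda>n. ((cdf (N n) x - c n) - (cdf (N n) a - c n)) / C') \<longlonglongrightarrow> (cdf L x - cdf L a) / C'"
        using conv a(2) C' by (intro tendsto_intros) (auto simp: weak_conv_def)
      then show ?thesis by simp
    qed
    then show "(\<lambda>n. cdf (D (N n)) x) \<longlonglongrightarrow> cdf (D L) x"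
      unfolding DN(2) DL(2) by (cases "x = a") auto
  qed
  then have "(\<lambda>n. C' *\<^sub>R (\<integral>x. f x \<partial>D (N n))) \<longlonglongrightarrow> C' *\<^sub>R (\<integral>x. f x \<partial>D L)"
    by (intro tendsto_intros weak_conv_imp_integral_bdd_continuous_conv[where B=B] DN(1) DL(1) f)
  from tendstoD[OF this, of "e / 3"] \<open>e > 0\<close>
  have "\<forall>\<^sub>F n in sequentially. dist (C' *\<^sub>R (\<integral>x. f x \<partial>D (N n))) (C' *\<^sub>R (\<integral>x. f x \<partial>D L)) < e / 3" by simp
  then show "\<forall>\<^sub>F n in sequentially. dist (\<integral>x. f x \<partial>N n) (\<integral>x. f x \<partial>L) < e"
  proof eventually_elim
    case (elim n)
    have eps: "2 * C' * \<epsilon> = e / 3" using C' by (simp add: \<epsilon>_def)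
    have "dist (\<integral>x. f x \<partial>N n) (\<integral>x. f x \<partial>L) \<le> 
        dist (\<integral>x. f x \<partial>N n) (C' *\<^sub>R (\<integral>x. f x \<partial>D (N n))) +
        (dist (C' *\<^sub>R (\<integral>x. f x \<partial>D (N n))) (C' *\<^sub>R (\<integral>x. f x \<partial>D L)) +
         dist (C' *\<^sub>R (\<integral>x. f x \<partial>D L)) (\<integral>x. f x \<partial>L))"
      using dist_triangle[of "\<integral>x. f x \<partial>N n" "\<integral>x. f x \<partial>L" "C' *\<^sub>R (\<integral>x. f x \<partial>D (N n))"]
        dist_triangle[of "C' *\<^sub>R (\<integral>x. f x \<partial>D (N n))" "\<integral>x. f x \<partial>L" "C' *\<^sub>R (\<integral>x. f x \<partial>D L)"]
      by linarith
    moreover have "dist (\<integral>x. f x \<partial>N n) (C' *\<^sub>R (\<integral>x. f x \<partial>D (N n))) \<le> e / 3"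
      using DN(3)[of n] unfolding eps by (subst dist_commute) (simp only: dist_norm)
    moreover have "dist (C' *\<^sub>R (\<integral>x. f x \<partial>D L)) (\<integral>x. f x \<partial>L) \<le> e / 3"
      using DL(3) unfolding eps by (simp only: dist_norm)
    ultimately show ?case using elim by linarith
  qed
qed

section \<open>The exponent determines the distribution function\<close>

lemma (in finite_borel_measure) integrable_kolmogorov_kernel: "integrable M (kolmogorov_kernel u)"
  using borel_measurable_kolmogorov_kernel[of u] M_is_borel
  by (intro integrable_const_bound[where B="u\<^sup>2 / 2"] AE_I2 norm_kolmogorov_kernel_le)
     (simp add: measurable_cong_sets[OF M_is_borel refl])

text \<open>
  For \<open>x \<noteq> 0\<close>, with \<open>E = exp (\<i>hx) + exp (-\<i>hx) - 2\<close> the second difference in the frequency equals \<open>exp (\<i>vx) E / x\<^sup>2\<close>,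
  since constant and linear terms cancel; and \<open>E\<close> is \<open>- h\<^sup>2x\<^sup>2\<close> up to third order.
\<close>

lemma kolmogorov_kernel_second_difference:
  fixes v h x :: real
  defines "\<Delta> \<equiv> kolmogorov_kernel (v + h) x + kolmogorov_kernel (v - h) x - 2 * kolmogorov_kernel v x"
  shows "cmod \<Delta> \<le> h\<^sup>2" and "cmod (\<Delta> + complex_of_real (h\<^sup>2) * iexp (v * x)) \<le> \<bar>h\<bar>^3 * \<bar>x\<bar> / 3"
proof -
  define E where "E = iexp (h * x) + iexp (- (h * x)) - 2"
  have 1: "cmod E \<le> (h * x)\<^sup>2"
  proof -
    have "E = (iexp (h * x) - 1 - \<i> * complex_of_real (h * x)) + (iexp (- (h * x)) - 1 - \<i> * complex_of_real (- (h * x)))"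
      by (simp add: E_def)
    then have "cmod E \<le> cmod (iexp (h * x) - 1 - \<i> * complex_of_real (h * x)) + 
        cmod (iexp (- (h * x)) - 1 - \<i> * complex_of_real (- (h * x)))"
      by (simp only: norm_triangle_ineq)
    also have "\<dots> \<le> (h * x)\<^sup>2 / 2 + (- (h * x))\<^sup>2 / 2"
      by (intro add_mono norm_iexp_taylor1)
    finally show ?thesis by simp
  qed
  have 2: "cmod (E + complex_of_real ((h * x)\<^sup>2)) \<le> \<bar>h * x\<bar>^3 / 3"
  proof -
    let ?t = "\<lambda>y. iexp y - (1 + \<i> * complex_of_real y - complex_of_real (y\<^sup>2 / 2))"
    have "E + complex_of_real ((h * x)\<^sup>2) = ?t (h * x) + ?t (- (h * x))"
      by (simp add: E_def)
    then have "cmod (E + complex_of_real ((h * x)\<^sup>2)) \<le> cmod (?t (h * x)) + cmod (?t (- (h * x)))"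
      by (simp only: norm_triangle_ineq)
    also have "\<dots> \<le> \<bar>h * x\<bar>^3 / 6 + \<bar>- (h * x)\<bar>^3 / 6"
      by (intro add_mono norm_iexp_taylor2)
    finally show ?thesis by simp
  qed
  show "cmod \<Delta> \<le> h\<^sup>2" and "cmod (\<Delta> + complex_of_real (h\<^sup>2) * iexp (v * x)) \<le> \<bar>h\<bar>^3 * \<bar>x\<bar> / 3"
  proof (atomize(full), cases "x = 0")
    case True
    have "\<Delta> = - complex_of_real (h\<^sup>2)"
      using True by (simp add: \<Delta>_def kolmogorov_kernel_def power2_eq_square field_simps)
    then show "cmod \<Delta> \<le> h\<^sup>2 \<and> cmod (\<Delta> + complex_of_real (h\<^sup>2) * iexp (v * x)) \<le> \<bar>h\<bar>^3 * \<bar>x\<bar> / 3"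
      using True by (simp add: norm_power)
  next
    case False
    have exps: "iexp ((v + h) * x) = iexp (v * x) * iexp (h * x)"
      "iexp ((v - h) * x) = iexp (v * x) * iexp (- (h * x))"
      by (simp_all add: exp_add[symmetric] algebra_simps)
    have "\<Delta> * complex_of_real (x\<^sup>2) = complex_of_real (x\<^sup>2) * kolmogorov_kernel (v + h) x +
        complex_of_real (x\<^sup>2) * kolmogorov_kernel (v - h) x - 2 * (complex_of_real (x\<^sup>2) * kolmogorov_kernel v x)"
      by (simp add: \<Delta>_def algebra_simps)
    also have "\<dots> = iexp (v * x) * E"
      unfolding square_mult_kolmogorov_kernel exps E_def by (simp add: algebra_simps)
    finally have "\<Delta> * complex_of_real (x\<^sup>2) = iexp (v * x) * E" .
    then have D: "\<Delta> = iexp (v * x) * E / complex_of_real (x\<^sup>2)"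
      using False by (subst eq_divide_eq) simp
    have "cmod \<Delta> = cmod E / x\<^sup>2"
      by (simp only: D norm_divide norm_mult norm_exp_i_times norm_of_real) simp
    also have "\<dots> \<le> (h * x)\<^sup>2 / x\<^sup>2"
      by (intro divide_right_mono 1) simp
    finally have *: "cmod \<Delta> \<le> h\<^sup>2" using False by (simp add: power_mult_distrib)
    have "\<Delta> + complex_of_real (h\<^sup>2) * iexp (v * x) = iexp (v * x) * (E + complex_of_real ((h * x)\<^sup>2)) / complex_of_real (x\<^sup>2)"
    proof -
      have "complex_of_real ((h * x)\<^sup>2) = complex_of_real (h\<^sup>2) * complex_of_real (x\<^sup>2)"
        by (simp add: power_mult_distrib)
      then show ?thesis
        unfolding D using False by (simp only: distrib_left add_divide_distrib) simp
    qed
    then have "cmod (\<Delta> + complex_of_real (h\<^sup>2) * iexp (v * x)) = cmod (E + complex_of_real ((h * x)\<^sup>2)) / x\<^sup>2"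
      by (simp only: norm_divide norm_mult norm_exp_i_times norm_of_real) simp
    also have "\<dots> \<le> (\<bar>h * x\<bar>^3 / 3) / x\<^sup>2"
      by (intro divide_right_mono 2) simp
    also have "\<dots> = \<bar>h\<bar>^3 * \<bar>x\<bar> / 3"
      using False by (simp add: abs_mult field_simps power2_eq_square power3_eq_cube)
    finally show "cmod \<Delta> \<le> h\<^sup>2 \<and> cmod (\<Delta> + complex_of_real (h\<^sup>2) * iexp (v * x)) \<le> \<bar>h\<bar>^3 * \<bar>x\<bar> / 3"
      using * by simp
  qed
qed

text \<open>
  The second derivative of the kernel in \<open>u\<close> is \<open>- exp (\<i>ux)\<close>. It is taken here along \<open>h = 1 / (n + 1)\<close>,
  where dominated convergence with bound 1 applies.
\<close>

lemma kolmogorov_transform_second_derivative: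
  assumes M: "finite_borel_measure M"
  defines "\<psi> \<equiv> \<lambda>u. \<integral>x. kolmogorov_kernel u x \<partial>M"
  shows "(\<lambda>n. - (complex_of_real (real (Suc n)))\<^sup>2 *
      (\<psi> (v + 1 / real (Suc n)) + \<psi> (v - 1 / real (Suc n)) - 2 * \<psi> v)) \<longlonglongrightarrow> (\<integral>x. iexp (v * x) \<partial>M)"
proof -
  interpret M: finite_borel_measure M by fact
  have meas: "f \<in> borel_measurable M" if "f \<in> borel_measurable borel" for f :: "real \<Rightarrow> complex"
    using that by (simp add: measurable_cong_sets[OF M.M_is_borel refl])
  define g where "g n x = - (complex_of_real (real (Suc n)))\<^sup>2 * (kolmogorov_kernel (v + 1 / real (Suc n)) x +
      kolmogorov_kernel (v - 1 / real (Suc n)) x - 2 * kolmogorov_kernel v x)" for n x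
  have "(\<lambda>n. \<integral>x. g n x \<partial>M) \<longlonglongrightarrow> (\<integral>x. iexp (v * x) \<partial>M)"
  proof (rule integral_dominated_convergence[where w="\<lambda>_. 1"])
    show "(\<lambda>x. iexp (v * x)) \<in> borel_measurable M" "g n \<in> borel_measurable M" for n
      by (auto intro!: meas simp: g_def[abs_def])
    show "integrable M (\<lambda>_. 1::real)" by simp
    show "AE x in M. norm (g n x) \<le> 1" for n
    proof (rule AE_I2)
      fix x
      have "norm (g n x) \<le> (real (Suc n))\<^sup>2 * (1 / real (Suc n))\<^sup>2"
        unfolding g_def norm_mult norm_minus_cancel norm_power norm_of_real abs_of_nat
        by (intro mult_left_mono kolmogorov_kernel_second_difference(1)) simp
      also have "\<dots> = 1"
        unfolding power_mult_distrib[symmetric] by simp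
      finally show "norm (g n x) \<le> 1" .
    qed
    show "AE x in M. (\<lambda>n. g n x) \<longlonglongrightarrow> iexp (v * x)"
    proof (rule AE_I2)
      fix x
      have bound: "cmod (g n x - iexp (v * x)) \<le> (\<bar>x\<bar> / 3) * inverse (real (Suc n))" for n
      proof -
        define N where "N = real (Suc n)"
        have N: "N > 0" by (simp add: N_def)
        have "g n x - iexp (v * x) = - (complex_of_real N)\<^sup>2 * ((kolmogorov_kernel (v + 1 / N) x +
            kolmogorov_kernel (v - 1 / N) x - 2 * kolmogorov_kernel v x) + complex_of_real ((1 / N)\<^sup>2) * iexp (v * x))"
        proof -
          have "(complex_of_real N)\<^sup>2 * complex_of_real ((1 / N)\<^sup>2) = 1"
            using N by (simp add: power_divide)
          then show ?thesis
            unfolding g_def N_def[symmetric] distrib_left mult.assoc[symmetric] by simp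
        qed
        then have "cmod (g n x - iexp (v * x)) = N\<^sup>2 * cmod ((kolmogorov_kernel (v + 1 / N) x +
            kolmogorov_kernel (v - 1 / N) x - 2 * kolmogorov_kernel v x) + complex_of_real ((1 / N)\<^sup>2) * iexp (v * x))"
          using N by (simp only: norm_mult norm_minus_cancel norm_power norm_of_real abs_of_pos)
        also have "\<dots> \<le> N\<^sup>2 * (\<bar>1 / N\<bar>^3 * \<bar>x\<bar> / 3)"
          by (intro mult_left_mono kolmogorov_kernel_second_difference(2)) simp
        also have "\<dots> = (\<bar>x\<bar> / 3) * inverse N"
          using N by (simp add: field_simps power2_eq_square power3_eq_cube)
        finally show ?thesis unfolding N_def .
      qed
      have "(\<lambda>n. (\<bar>x\<bar> / 3) * inverse (real (Suc n))) \<longlonglongrightarrow> (\<bar>x\<bar> / 3) * 0"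
        by (rule tendsto_mult_left[OF LIMSEQ_inverse_real_of_nat])
      then have lim: "(\<lambda>n. (\<bar>x\<bar> / 3) * inverse (real (Suc n))) \<longlonglongrightarrow> 0" by simp
      have "(\<lambda>n. g n x - iexp (v * x)) \<longlonglongrightarrow> 0"
        by (rule Lim_null_comparison[OF always_eventually lim]) (intro allI bound)
      then show "(\<lambda>n. g n x) \<longlonglongrightarrow> iexp (v * x)" by (simp add: LIM_zero_iff)
    qed
  qed
  moreover have "(\<integral>x. g n x \<partial>M) = - (complex_of_real (real (Suc n)))\<^sup>2 *
      (\<psi> (v + 1 / real (Suc n)) + \<psi> (v - 1 / real (Suc n)) - 2 * \<psi> v)" for n
    unfolding g_def \<psi>_def
    by (simp add: M.integrable_kolmogorov_kernel Bochner_Integration.integral_add Bochner_Integration.integral_diff)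
  ultimately show ?thesis by simp
qed

lemma finite_borel_measure_fourier_unique:
  assumes "finite_borel_measure M" "finite_borel_measure L"
    and eq: "\<And>v. (\<integral>x. iexp (v * x) \<partial>M) = (\<integral>x. iexp (v * x) \<partial>L)"
  shows "M = L"
proof -
  obtain R where R: "real_distribution R" "M = density R (\<lambda>_. ennreal (measure M UNIV))"
    by (rule finite_borel_measure_normalize[OF assms(1)])
  obtain R' where R': "real_distribution R'" "L = density R' (\<lambda>_. ennreal (measure L UNIV))"
    by (rule finite_borel_measure_normalize[OF assms(2)])
  define m m' where "m = measure M UNIV" and "m' = measure L UNIV"
  have mm: "0 \<le> m" "0 \<le> m'" by (simp_all add: m_def m'_def)
  interpret R: real_distribution R by fact
  interpret R': real_distribution R' by fact
  have M: "M = density R (\<lambda>_. ennreal m)" and L: "L = density R' (\<lambda>_. ennreal m')"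
    unfolding m_def m'_def by (rule R(2), rule R'(2))
  have *: "m *\<^sub>R char R v = m' *\<^sub>R char R' v" for v
  proof -
    have "(\<integral>x. iexp (v * x) \<partial>M) = m *\<^sub>R char R v" "(\<integral>x. iexp (v * x) \<partial>L) = m' *\<^sub>R char R' v"
      unfolding M L char_def by (intro integral_density_const mm; simp)+
    then show ?thesis using eq[of v] by simp
  qed
  have "m = m'" using *[of 0] by (simp add: R.char_zero R'.char_zero)
  show ?thesis
  proof (cases "m = 0")
    case True
    then show ?thesis using \<open>m = m'\<close> unfolding M L
      by (intro measure_eqI) (simp_all add: emeasure_density)
  next
    case False
    then have "char R = char R'" using * \<open>m = m'\<close> by (auto simp: fun_eq_iff)
    then show ?thesis using Levy_uniqueness[OF R(1) R'(1)] \<open>m = m'\<close> M L by simp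
  qed
qed

lemma Psi_inj:
  assumes K: "dist_fun K" and L: "dist_fun L" and eq: "Psi K = Psi L"
  shows "\<exists>c. \<forall>x. K x = L x + c"
proof -
  note fin = dist_fun_interval_measure(1)[OF K] dist_fun_interval_measure(1)[OF L]
  have same: "interval_measure K = interval_measure L"
  proof (rule finite_borel_measure_fourier_unique[OF fin])
    fix v
    have e: "(\<integral>x. kolmogorov_kernel u x \<partial>interval_measure K) = (\<integral>x. kolmogorov_kernel u x \<partial>interval_measure L)" for u
      using fun_cong[OF eq, of u] by (simp add: Psi_kolmogorov_kernel)
    show "(\<integral>x. iexp (v * x) \<partial>interval_measure K) = (\<integral>x. iexp (v * x) \<partial>interval_measure L)"
      using kolmogorov_transform_second_derivative[OF fin(1), of v]
        kolmogorov_transform_second_derivative[OF fin(2), of v]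
      unfolding e by (rule LIMSEQ_unique)
  qed
  obtain a where a: "\<And>x. K x = a + cdf (interval_measure K) x"
    using dist_fun_interval_measure(2)[OF K] by blast
  obtain b where b: "\<And>x. L x = b + cdf (interval_measure L) x"
    using dist_fun_interval_measure(2)[OF L] by blast
  have "K x = L x + (a - b)" for x
    using a[of x] b[of x] unfolding same by linarith
  then show ?thesis by blast
qed

lemma Psi_shift:
  assumes "\<And>x. K x = L x + c"
  shows "Psi K = Psi L"
proof -
  have "K = (\<lambda>x. L x + c)" using assms by auto
  then show ?thesis
    by (intro ext) (simp only: Psi_kolmogorov_kernel interval_measure_shift)
qed

lemma isCont_Psi:
  assumes "dist_fun K"
  shows "isCont (Psi K) u"
  unfolding continuous_at_sequentially
proof safe
  fix X assume X: "X \<longlonglongrightarrow> u"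
  interpret N: finite_borel_measure "interval_measure K"
    by (rule dist_fun_interval_measure(1)[OF assms])
  obtain B where B: "\<And>n. norm (X n) \<le> B"
    using convergent_imp_Bseq[OF convergentI[OF X]] by (auto simp: Bseq_def)
  have "(\<lambda>n. \<integral>x. kolmogorov_kernel (X n) x \<partial>interval_measure K) \<longlonglongrightarrow> (\<integral>x. kolmogorov_kernel u x \<partial>interval_measure K)"
  proof (rule integral_dominated_convergence[where w="\<lambda>_. B\<^sup>2 / 2"])
    show "AE x in interval_measure K. (\<lambda>n. kolmogorov_kernel (X n) x) \<longlonglongrightarrow> kolmogorov_kernel u x"
      by (intro AE_I2 isCont_tendsto_compose[OF isCont_kolmogorov_kernel_frequency X])
    show "AE x in interval_measure K. norm (kolmogorov_kernel (X n) x) \<le> B\<^sup>2 / 2" for n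
    proof (rule AE_I2)
      fix x
      have "(X n)\<^sup>2 \<le> B\<^sup>2" using power_mono[OF B[of n], of 2] by simp
      then show "norm (kolmogorov_kernel (X n) x) \<le> B\<^sup>2 / 2"
        using norm_kolmogorov_kernel_le[of "X n" x] by simp
    qed
  qed simp_all
  then show "(Psi K \<circ> X) \<longlonglongrightarrow> Psi K u"
    by (simp add: comp_def Psi_kolmogorov_kernel)
qed

lemma Psi_zero: "Psi K 0 = 0"
proof -
  have "kolmogorov_kernel 0 = (\<lambda>_. 0)" by (auto simp: kolmogorov_kernel_def)
  then show ?thesis by (simp add: Psi_kolmogorov_kernel)
qed

text \<open>
  The difference of the two exponents is continuous with values in \<open>2\<pi>\<i>\<int>\<close>, hence constant, and it is
  0 at frequency 0.
\<close>

lemma exp_Psi_inj: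
  assumes K: "dist_fun K" and L: "dist_fun L" and eq: "\<And>u. exp (Psi K u) = exp (Psi L u)"
  shows "Psi K = Psi L"
proof -
  define d where "d u = Psi K u - Psi L u" for u
  have ed: "exp (d u) = 1" for u using eq[of u] by (simp add: d_def exp_diff)
  have "d constant_on UNIV"
  proof (rule continuous_discrete_range_constant)
    show "continuous_on UNIV d"
      unfolding d_def by (intro continuous_at_imp_continuous_on ballI continuous_intros isCont_Psi K L)
    fix x :: real
    have "2 * pi \<le> norm (d y - d x)" if "d y \<noteq> d x" for y
    proof -
      have "exp (d y - d x) = 1" using ed by (simp add: exp_diff)
      then obtain n :: int where n: "Re (d y - d x) = 0" "Im (d y - d x) = of_int (2 * n) * pi"
        by (auto simp: exp_eq_1)
      then have "n \<noteq> 0" using that by (auto simp: complex_eq_iff)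
      then have "2 * pi \<le> \<bar>of_int (2 * n) * pi\<bar>" by (simp add: abs_mult)
      also have "\<dots> \<le> norm (d y - d x)" using abs_Im_le_cmod[of "d y - d x"] n by simp
      finally show ?thesis .
    qed
    then show "\<exists>e>0. \<forall>y. y \<in> UNIV \<and> d y \<noteq> d x \<longrightarrow> e \<le> norm (d y - d x)"
      by (intro exI[of _ "2 * pi"]) auto
  qed simp
  then obtain c where "\<And>u. d u = c" by (auto simp: constant_on_def)
  moreover have "d 0 = 0" by (simp add: d_def Psi_zero)
  ultimately have "d u = 0" for u by simp
  then show ?thesis by (simp add: d_def fun_eq_iff)
qed

section \<open>Independent sums\<close>

lemma iid_coordinates:
  fixes Q :: "real measure" and n :: nat
  assumes Q: "real_distribution Q" and n: "1 \<le> n"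
  defines "M \<equiv> PiM {1..n} (\<lambda>_. Q)"
  shows "prob_space M"
    and "\<And>k. k \<in> {1..n} \<Longrightarrow> distr M borel (\<lambda>\<omega>. \<omega> k) = Q"
    and "prob_space.indep_vars M (\<lambda>_. borel) (\<lambda>k \<omega>. \<omega> k) {1..n}"
proof -
  interpret Q: real_distribution Q by fact
  show M: "prob_space M"
    unfolding M_def by (intro prob_space_PiM) (rule Q.prob_space_axioms)
  interpret M: prob_space M by (rule M)
  have sets_M: "sets M = sets (PiM {1..n} (\<lambda>_. borel))"
    unfolding M_def by (intro sets_PiM_cong) simp_all
  show comp: "distr M borel (\<lambda>\<omega>. \<omega> k) = Q" if "k \<in> {1..n}" for k
  proof -
    have "distr M borel (\<lambda>\<omega>. \<omega> k) = distr M Q (\<lambda>\<omega>. \<omega> k)"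
      by (intro distr_cong) simp_all
    also have "\<dots> = Q"
      unfolding M_def using that by (intro distr_PiM_component) (auto intro: Q.prob_space_axioms)
    finally show ?thesis .
  qed
  show "M.indep_vars (\<lambda>_. borel) (\<lambda>k \<omega>. \<omega> k) {1..n}"
  proof (subst M.indep_vars_iff_distr_eq_PiM')
    show "{1..n} \<noteq> {}" using n by simp
    show "M.random_variable borel (\<lambda>\<omega>. \<omega> k)" if "k \<in> {1..n}" for k
      using that by (subst measurable_cong_sets[OF sets_M refl]) (rule measurable_component_singleton)
    have "distr M (PiM {1..n} (\<lambda>_. borel)) (\<lambda>x. \<lambda>i\<in>{1..n}. x i) = distr M M (\<lambda>x. x)"
    proof (intro distr_cong)
      fix x assume "x \<in> space M"
      then have "x \<in> extensional {1..n}" by (auto simp: M_def space_PiM PiE_def)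
      then show "(\<lambda>i\<in>{1..n}. x i) = x" by (rule extensional_restrict)
    qed (simp_all add: sets_M)
    also have "\<dots> = M" by (rule distr_id)
    also have "\<dots> = (\<Pi>\<^sub>M i\<in>{1..n}. distr M borel (\<lambda>\<omega>. \<omega> i))"
      unfolding M_def by (intro PiM_cong refl) (rule comp[unfolded M_def, symmetric])
    finally show "distr M (PiM {1..n} (\<lambda>_. borel)) (\<lambda>x. \<lambda>i\<in>{1..n}. x i) =
      (\<Pi>\<^sub>M i\<in>{1..n}. distr M borel (\<lambda>\<omega>. \<omega> i))" .
  qed
qed

text \<open>
  Mixed terms have mean 0 by independence and centering, so second moments add.
\<close>

lemma (in prob_space) second_moment_indep_sum:
  fixes X :: "'i \<Rightarrow> 'a \<Rightarrow> real"
  assumes "finite A" and "indep_vars (\<lambda>_. borel) X A"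
    and "\<And>k. k \<in> A \<Longrightarrow> integrable M (\<lambda>\<omega>. (X k \<omega>)\<^sup>2)"
    and "\<And>k. k \<in> A \<Longrightarrow> expectation (X k) = 0"
  shows "integrable M (\<lambda>\<omega>. (\<Sum>k\<in>A. X k \<omega>)\<^sup>2) \<and>
    expectation (\<lambda>\<omega>. (\<Sum>k\<in>A. X k \<omega>)\<^sup>2) = (\<Sum>k\<in>A. expectation (\<lambda>\<omega>. (X k \<omega>)\<^sup>2))"
  using assms
proof (induction A rule: finite_induct)
  case empty
  then show ?case by simp
next
  case (insert i A)
  define S where "S \<omega> = (\<Sum>k\<in>A. X k \<omega>)" for \<omega>
  have rv: "random_variable borel (X k)" if "k \<in> insert i A" for k
    using insert.prems(1) that by (auto simp: indep_vars_def)
  have indep: "indep_var borel (X i) borel S"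
    unfolding S_def by (rule indep_vars_sum[OF insert.hyps insert.prems(1)])
  have IH: "integrable M (\<lambda>\<omega>. (S \<omega>)\<^sup>2)" "expectation (\<lambda>\<omega>. (S \<omega>)\<^sup>2) = (\<Sum>k\<in>A. expectation (\<lambda>\<omega>. (X k \<omega>)\<^sup>2))"
    using insert.IH insert.prems indep_vars_subset[OF insert.prems(1)] unfolding S_def by auto
  have Xi2: "integrable M (\<lambda>\<omega>. (X i \<omega>)\<^sup>2)" using insert.prems by auto
  have Xi: "integrable M (X i)"
    by (rule square_integrable_imp_integrable[OF rv Xi2]) simp
  have S: "integrable M S"
    by (rule square_integrable_imp_integrable[OF _ IH(1)]) (rule indep_var_rv2[OF indep])
  note XS = indep_var_integrable[OF indep Xi S] indep_var_lebesgue_integral[OF indep Xi S]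
  have "expectation (X i) = 0" using insert.prems by auto
  then have XS0: "expectation (\<lambda>\<omega>. X i \<omega> * S \<omega>) = 0" using XS(2) by simp
  have eq: "(\<lambda>\<omega>. (\<Sum>k\<in>insert i A. X k \<omega>)\<^sup>2) = (\<lambda>\<omega>. (X i \<omega>)\<^sup>2 + (2 * (X i \<omega> * S \<omega>) + (S \<omega>)\<^sup>2))"
    using insert.hyps by (simp add: S_def power2_sum algebra_simps)
  have int: "integrable M (\<lambda>\<omega>. 2 * (X i \<omega> * S \<omega>))" "integrable M (\<lambda>\<omega>. 2 * (X i \<omega> * S \<omega>) + (S \<omega>)\<^sup>2)"
    using XS(1) IH(1) by auto
  have "expectation (\<lambda>\<omega>. (X i \<omega>)\<^sup>2 + (2 * (X i \<omega> * S \<omega>) + (S \<omega>)\<^sup>2)) =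
    expectation (\<lambda>\<omega>. (X i \<omega>)\<^sup>2) + (2 * expectation (\<lambda>\<omega>. X i \<omega> * S \<omega>) + expectation (\<lambda>\<omega>. (S \<omega>)\<^sup>2))"
    by (subst Bochner_Integration.integral_add[OF Xi2 int(2)], subst Bochner_Integration.integral_add[OF int(1) IH(1)]) simp
  then show ?case
    unfolding eq using Xi2 int XS0 IH(2) insert.hyps by simp
qed

text \<open>
  The second moment is recorded because it yields tightness of such laws.
\<close>

lemma convolution_power:
  assumes Q: "real_distribution Q" and n: "1 \<le> n"
    and sq: "integrable Q (\<lambda>x. x\<^sup>2)" and mean: "(\<integral>x. x \<partial>Q) = 0"
  obtains S where "real_distribution S" "\<And>u. char S u = char Q u ^ n"
    "integrable S (\<lambda>x. x\<^sup>2)" "(\<integral>x. x\<^sup>2 \<partial>S) = real n * (\<integral>x. x\<^sup>2 \<partial>Q)"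
proof -
  define M where "M = PiM {1..n} (\<lambda>_. Q)"
  note iid = iid_coordinates[OF Q n, folded M_def]
  interpret M: prob_space M by (rule iid)
  have rv: "(\<lambda>\<omega>. \<omega> k) \<in> borel_measurable M" if "k \<in> {1..n}" for k
    using iid(3) that by (auto simp: M.indep_vars_def)
  have rv_sum: "(\<lambda>\<omega>. \<Sum>k\<in>{1..n}. \<omega> k) \<in> borel_measurable M"
    by (intro borel_measurable_sum rv)
  define S where "S = distr M borel (\<lambda>\<omega>. \<Sum>k\<in>{1..n}. \<omega> k)"
  have sq_k: "integrable M (\<lambda>\<omega>. (\<omega> k)\<^sup>2)" "M.expectation (\<lambda>\<omega>. (\<omega> k)\<^sup>2) = (\<integral>x. x\<^sup>2 \<partial>Q)" "M.expectation (\<lambda>\<omega>. \<omega> k) = 0"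
    if "k \<in> {1..n}" for k
  proof -
    show "integrable M (\<lambda>\<omega>. (\<omega> k)\<^sup>2)"
      using sq integrable_distr[OF rv[OF that], of "\<lambda>x. x\<^sup>2"] unfolding iid(2)[OF that] by simp
    show "M.expectation (\<lambda>\<omega>. (\<omega> k)\<^sup>2) = (\<integral>x. x\<^sup>2 \<partial>Q)"
      using integral_distr[OF rv[OF that], of "\<lambda>x. x\<^sup>2"] unfolding iid(2)[OF that] by simp
    show "M.expectation (\<lambda>\<omega>. \<omega> k) = 0"
      using integral_distr[OF rv[OF that], of "\<lambda>x. x"] mean unfolding iid(2)[OF that] by simp
  qed
  have sum: "integrable M (\<lambda>\<omega>. (\<Sum>k\<in>{1..n}. \<omega> k)\<^sup>2)"
    "M.expectation (\<lambda>\<omega>. (\<Sum>k\<in>{1..n}. \<omega> k)\<^sup>2) = (\<Sum>k\<in>{1..n}. M.expectation (\<lambda>\<omega>. (\<omega> k)\<^sup>2))"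
    using M.second_moment_indep_sum[OF _ iid(3)] sq_k by auto
  show thesis
  proof (rule that)
    show "real_distribution S" unfolding S_def by (rule M.real_distribution_distr[OF rv_sum])
    show "char S u = char Q u ^ n" for u
      unfolding S_def M.char_distr_sum[OF iid(3)] using iid(2) by simp
    show "integrable S (\<lambda>x. x\<^sup>2)"
      unfolding S_def by (subst integrable_distr_eq[OF rv_sum]) (simp, rule sum(1))
    show "(\<integral>x. x\<^sup>2 \<partial>S) = real n * (\<integral>x. x\<^sup>2 \<partial>Q)"
      unfolding S_def by (subst integral_distr[OF rv_sum]) (simp, use sum(2) sq_k(2) in simp)
  qed
qed

text \<open>
  Chebyshev's inequality, applied to the radius \<open>r\<close> with \<open>r\<^sup>2 = (\<bar>C\<bar> + 1) / \<epsilon>\<close>.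
\<close>

lemma tight_second_moment:
  assumes \<mu>: "\<And>n. real_distribution (\<mu> n)" and sq: "\<And>n. integrable (\<mu> n) (\<lambda>x. x\<^sup>2)"
    and C: "\<And>n. (\<integral>x. x\<^sup>2 \<partial>\<mu> n) \<le> C"
  shows "tight \<mu>"
  unfolding tight_def
proof (intro conjI allI impI \<mu>)
  fix \<epsilon> :: real assume "\<epsilon> > 0"
  define r where "r = sqrt ((\<bar>C\<bar> + 1) / \<epsilon>)"
  have r: "r > 0" "r\<^sup>2 = (\<bar>C\<bar> + 1) / \<epsilon>" using \<open>\<epsilon> > 0\<close> by (auto simp: r_def)
  have "1 - \<epsilon> < measure (\<mu> n) {-r<..r}" for n
  proof -
    interpret real_distribution "\<mu> n" by (rule \<mu>)
    have "prob {x \<in> space (\<mu> n). \<bar>x\<bar> \<ge> r} \<le> (\<integral>x. x\<^sup>2 \<partial>\<mu> n) / r\<^sup>2"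
      using second_moment_method[of "\<lambda>x. x" r] sq[of n] r(1) by simp
    also have "\<dots> \<le> C / r\<^sup>2"
      by (intro divide_right_mono C) simp
    also have "\<dots> < (\<bar>C\<bar> + 1) / r\<^sup>2"
      using r(1) by (intro divide_strict_right_mono) auto
    also have "\<dots> = \<epsilon>" using \<open>\<epsilon> > 0\<close> unfolding r(2) by simp
    finally have "prob {x \<in> space (\<mu> n). \<bar>x\<bar> \<ge> r} < \<epsilon>" .
    moreover have "prob (space (\<mu> n) - {x \<in> space (\<mu> n). \<bar>x\<bar> \<ge> r}) = 1 - prob {x \<in> space (\<mu> n). \<bar>x\<bar> \<ge> r}"
      by (rule prob_compl) measurable
    moreover have "prob (space (\<mu> n) - {x \<in> space (\<mu> n). \<bar>x\<bar> \<ge> r}) \<le> prob {-r<..r}"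
      by (intro finite_measure_mono) auto
    ultimately show ?thesis by linarith
  qed
  then show "\<exists>a b. a < b \<and> (\<forall>n. 1 - \<epsilon> < measure (\<mu> n) {a<..b})"
    using r(1) by (intro exI[of _ "-r"] exI[of _ r]) auto
qed

section \<open>Comparing a characteristic function with a compound Poisson one\<close>

text \<open>
  A value \<open>z\<close> of a characteristic function is replaced by \<open>exp (z - 1)\<close>, the value for a
  compound Poisson law. The two agree to first order in \<open>z - 1\<close>, and both stay in the unit disc, which is what
  allows a comparison of products factor by factor.
\<close>

lemma norm_exp_minus_one_le:
  fixes z :: complex
  assumes "norm z \<le> 1"
  shows "norm (exp (z - 1)) \<le> 1" and "norm (z - exp (z - 1)) \<le> exp 2 * (norm (z - 1))\<^sup>2"
proof -
  have "Re z \<le> 1" using complex_Re_le_cmod[of z] assms by linarith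
  then show "norm (exp (z - 1)) \<le> 1" by simp
  have "norm (exp (z - 1) - (\<Sum>k\<le>1. (z - 1) ^ k / fact k)) \<le> exp \<bar>Re (z - 1)\<bar> * norm (z - 1) ^ Suc 1 / fact 1"
    by (rule Taylor_exp)
  moreover have "exp (z - 1) - (\<Sum>k\<le>1. (z - 1) ^ k / fact k) = exp (z - 1) - z" by simp
  ultimately have "norm (z - exp (z - 1)) \<le> exp \<bar>Re (z - 1)\<bar> * (norm (z - 1))\<^sup>2"
    by (simp add: norm_minus_commute numeral_2_eq_2)
  also have "\<bar>Re (z - 1)\<bar> \<le> 2"
    using abs_Re_le_cmod[of "z - 1"] norm_triangle_ineq4[of z 1] assms by simp
  then have "exp \<bar>Re (z - 1)\<bar> * (norm (z - 1))\<^sup>2 \<le> exp 2 * (norm (z - 1))\<^sup>2"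
    by (intro mult_right_mono) auto
  finally show "norm (z - exp (z - 1)) \<le> exp 2 * (norm (z - 1))\<^sup>2" .
qed

lemma norm_prod_minus_exp_sum_le:
  fixes \<phi> :: "'i \<Rightarrow> complex"
  assumes "\<And>k. k \<in> A \<Longrightarrow> norm (\<phi> k) \<le> 1" and "\<And>k. k \<in> A \<Longrightarrow> norm (\<phi> k - 1) \<le> \<delta>"
    and fin: "finite A"
  shows "norm ((\<Prod>k\<in>A. \<phi> k) - exp (\<Sum>k\<in>A. \<phi> k - 1)) \<le> exp 2 * \<delta> * (\<Sum>k\<in>A. norm (\<phi> k - 1))"
proof -
  have "norm ((\<Prod>k\<in>A. \<phi> k) - (\<Prod>k\<in>A. exp (\<phi> k - 1))) \<le> (\<Sum>k\<in>A. norm (\<phi> k - exp (\<phi> k - 1)))"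
    by (intro norm_prod_diff assms norm_exp_minus_one_le)
  also have "\<dots> \<le> (\<Sum>k\<in>A. exp 2 * (\<delta> * norm (\<phi> k - 1)))"
  proof (intro sum_mono)
    fix k assume k: "k \<in> A"
    have "norm (\<phi> k - exp (\<phi> k - 1)) \<le> exp 2 * (norm (\<phi> k - 1) * norm (\<phi> k - 1))"
      using norm_exp_minus_one_le(2)[OF assms(1)[OF k]] by (simp add: power2_eq_square)
    also have "\<dots> \<le> exp 2 * (\<delta> * norm (\<phi> k - 1))"
      by (intro mult_left_mono mult_right_mono assms(2) k) auto
    finally show "norm (\<phi> k - exp (\<phi> k - 1)) \<le> exp 2 * (\<delta> * norm (\<phi> k - 1))" .
  qed
  finally show ?thesis
    by (simp add: exp_sum[OF fin] sum_distrib_left mult.assoc)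
qed

text \<open>
  The \<open>k j\<close>-fold convolution power of \<open>Q j\<close> has the characteristic function \<open>(char (Q j))^(k j)\<close>, which is
  close to \<open>exp (k j * (char (Q j) - 1))\<close> and so tends to \<open>exp \<circ> \<psi>\<close>. The bound on second moments makes
  these laws tight, and a subsequential weak limit is the wanted law.
\<close>

theorem exp_is_char:
  fixes Q :: "nat \<Rightarrow> real measure" and k :: "nat \<Rightarrow> nat"
  assumes Q: "\<And>j. real_distribution (Q j)" and k: "\<And>j. 1 \<le> k j" "filterlim k at_top sequentially"
    and sq: "\<And>j. integrable (Q j) (\<lambda>x. x\<^sup>2)" and mean: "\<And>j. (\<integral>x. x \<partial>Q j) = 0"
    and C: "\<And>j. real (k j) * (\<integral>x. x\<^sup>2 \<partial>Q j) \<le> C"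
    and lim: "\<And>u. (\<lambda>j. of_nat (k j) * (char (Q j) u - 1)) \<longlonglongrightarrow> \<psi> u"
  shows "\<exists>P. real_distribution P \<and> (\<forall>u. char P u = exp (\<psi> u))"
proof -
  have "\<exists>S. real_distribution S \<and> (\<forall>u. char S u = char (Q j) u ^ k j) \<and>
    integrable S (\<lambda>x. x\<^sup>2) \<and> (\<integral>x. x\<^sup>2 \<partial>S) = real (k j) * (\<integral>x. x\<^sup>2 \<partial>Q j)" for j
    using convolution_power[OF Q k(1) sq mean, of j] by blast
  then obtain S where S: "\<And>j. real_distribution (S j)" "\<And>j u. char (S j) u = char (Q j) u ^ k j"
    "\<And>j. integrable (S j) (\<lambda>x. x\<^sup>2)" "\<And>j. (\<integral>x. x\<^sup>2 \<partial>S j) = real (k j) * (\<integral>x. x\<^sup>2 \<partial>Q j)"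
    by metis
  have char_lim: "(\<lambda>j. char (S j) u) \<longlonglongrightarrow> exp (\<psi> u)" for u
  proof -
    let ?w = "\<lambda>j. of_nat (k j) * (char (Q j) u - 1)"
    have inv: "(\<lambda>j. inverse (real (k j))) \<longlonglongrightarrow> 0"
      by (intro tendsto_inverse_0_at_top filterlim_compose[OF filterlim_real_sequentially k(2)])
    \<comment> \<open>This tends to 0, since \<open>?w j\<close> converges and \<open>k j\<close> tends to infinity.\<close>
    have "norm (char (S j) u - exp (?w j)) \<le> exp 2 * (norm (?w j))\<^sup>2 * inverse (real (k j))" for j
    proof -
      have kj: "real (k j) > 0" using k(1)[of j] by simp
      have "norm ((\<Prod>i\<in>{1..k j}. char (Q j) u) - exp (\<Sum>i\<in>{1..k j}. char (Q j) u - 1))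
        \<le> exp 2 * norm (char (Q j) u - 1) * (\<Sum>i\<in>{1..k j}. norm (char (Q j) u - 1))"
        by (intro norm_prod_minus_exp_sum_le real_distribution.cmod_char_le_1 Q) auto
      then have "norm (char (S j) u - exp (?w j)) \<le> exp 2 * norm (char (Q j) u - 1) * (real (k j) * norm (char (Q j) u - 1))"
        by (simp add: S(2))
      also have "\<dots> = exp 2 * (norm (?w j))\<^sup>2 * inverse (real (k j))"
        using kj by (simp add: norm_mult power2_eq_square)
      finally show ?thesis .
    qed
    moreover have "(\<lambda>j. exp 2 * (norm (?w j))\<^sup>2 * inverse (real (k j))) \<longlonglongrightarrow> exp 2 * (norm (\<psi> u))\<^sup>2 * 0"
      by (intro tendsto_intros lim inv)
    ultimately have "(\<lambda>j. char (S j) u - exp (?w j)) \<longlonglongrightarrow> 0"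
      by (intro Lim_null_comparison[OF always_eventually[OF allI], of "\<lambda>j. char (S j) u - exp (?w j)"]) simp_all
    then show ?thesis
      using tendsto_add[OF _ tendsto_exp[OF lim[of u]]] by fastforce
  qed
  have "tight S"
    by (intro tight_second_moment[of S C] S) (simp add: S C)
  from tight_imp_convergent_subsubsequence[OF this, of "\<lambda>n. n"]
  obtain r P where r: "strict_mono r" and P: "real_distribution P" and conv: "weak_conv_m (S \<circ> (\<lambda>n. n) \<circ> r) P"
    by (auto simp: strict_mono_def)
  have "char P u = exp (\<psi> u)" for u
  proof (rule LIMSEQ_unique)
    show "(\<lambda>n. char (S (r n)) u) \<longlonglongrightarrow> char P u"
      using levy_continuity1[of "\<lambda>n. S (r n)" P u] S(1) P conv by (simp add: comp_def)
    show "(\<lambda>n. char (S (r n)) u) \<longlonglongrightarrow> exp (\<psi> u)"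
      using LIMSEQ_subseq_LIMSEQ[OF char_lim r] by (simp add: comp_def)
  qed
  then show ?thesis using P by blast
qed

section \<open>Every exponent belongs to a probability law\<close>

text \<open>
  Read \<open>1 + w + \<i>y\<close> as the characteristic function at \<open>u\<close> of a variable with mean \<open>b\<close>, where \<open>y = u * b\<close>.
  Centering the variable multiplies it by \<open>exp (- \<i>y)\<close>, which removes the linear term up to second order.
\<close>

lemma norm_centred_char_le:
  fixes w :: complex and y :: real
  shows "norm (iexp (- y) * (1 + w + \<i> * complex_of_real y) - 1 - w) \<le> 3 / 2 * y\<^sup>2 + \<bar>y\<bar> * norm w"
proof -
  have 1: "norm (iexp (- y) - 1) \<le> \<bar>y\<bar>"
    using iexp_approx1[of "- y" 0] by simp
  have 2: "norm (iexp (- y) - 1 + \<i> * complex_of_real y) \<le> y\<^sup>2 / 2"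
    using norm_iexp_taylor1[of "- y"] by simp
  have "iexp (- y) * (1 + w + \<i> * complex_of_real y) - 1 - w =
     (iexp (- y) - 1 + \<i> * complex_of_real y) + ((iexp (- y) - 1) * (\<i> * complex_of_real y) + (iexp (- y) - 1) * w)"
    by (simp add: algebra_simps)
  also have "norm \<dots> \<le> y\<^sup>2 / 2 + (\<bar>y\<bar> * \<bar>y\<bar> + \<bar>y\<bar> * norm w)"
  proof (rule order_trans[OF norm_triangle_ineq], rule add_mono[OF 2],
      rule order_trans[OF norm_triangle_ineq], rule add_mono)
    show "norm ((iexp (- y) - 1) * (\<i> * complex_of_real y)) \<le> \<bar>y\<bar> * \<bar>y\<bar>"
      unfolding norm_mult[of _ "\<i> * complex_of_real y"] by (intro mult_mono 1) (simp_all add: norm_mult)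
    show "norm ((iexp (- y) - 1) * w) \<le> \<bar>y\<bar> * norm w"
      unfolding norm_mult by (intro mult_right_mono 1) simp
  qed
  also have "\<dots> = 3 / 2 * y\<^sup>2 + \<bar>y\<bar> * norm w"
    by (simp add: power2_eq_square)
  finally show ?thesis .
qed

text \<open>
  \<open>Q\<close> is one of \<open>J^4\<close> independent summands that together approximate the law of exponent
  \<open>m \<integral> k u d\<rho>\<close>. A summand jumps to \<open>x\<close> with probability \<open>m / (J^4 x\<^sup>2)\<close>, where \<open>x\<close> is drawn from \<open>\<rho>\<close>, and stays
  at 0 otherwise; then it is centered. Each jump contributes \<open>m / J^4\<close> to the second moment whatever
  its size. Jumps shorter than \<open>1 / J\<close>, also those of length 0, are replaced by \<open>1 / J\<close>, which keeps the
  jump probability at most 1 and bounds the mean by \<open>m / J^3\<close>. The number \<open>J^4\<close> of summands is large enough for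
  the square of the mean, times their number, to vanish as \<open>J\<close> grows.
\<close>

lemma thinned_step:
  assumes \<rho>: "real_distribution \<rho>" and m: "0 \<le> m" "m \<le> J" and J: "1 \<le> J"
  defines "T \<equiv> \<lambda>x. if \<bar>x\<bar> < 1 / J then 1 / J else x"
  obtains Q where "real_distribution Q" "integrable Q (\<lambda>x. x\<^sup>2)" "(\<integral>x. x \<partial>Q) = 0"
    "J^4 * (\<integral>x. x\<^sup>2 \<partial>Q) \<le> m"
    "\<And>u. norm (complex_of_real (J^4) * (char Q u - 1) - m *\<^sub>R (\<integral>x. kolmogorov_kernel u (T x) \<partial>\<rho>))
       \<le> 3 / 2 * u\<^sup>2 * m\<^sup>2 / J\<^sup>2 + \<bar>u\<bar> * m\<^sup>2 * u\<^sup>2 / (2 * J^3)"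
proof -
  interpret \<rho>: real_distribution \<rho> by fact
  define p where "p x = m / (J^4 * (T x)\<^sup>2)" for x
  have T_lower: "1 / J \<le> \<bar>T x\<bar>" for x using J by (auto simp: T_def)
  have T_nz: "T x \<noteq> 0" for x using T_lower[of x] J by auto
  have Jpos: "J > 0" using J by simp
  have T2: "1 \<le> J\<^sup>2 * (T x)\<^sup>2" for x
  proof -
    have "1 \<le> J * \<bar>T x\<bar>" using T_lower[of x] Jpos by (simp add: divide_le_eq mult.commute)
    then have "1 \<le> (J * \<bar>T x\<bar>)\<^sup>2" by (rule one_le_power)
    then show ?thesis by (simp add: power_mult_distrib)
  qed
  have p_nonneg: "0 \<le> p x" for x using m by (simp add: p_def)
  have p_le_1: "p x \<le> 1" for x
  proof -
    have "J * 1 \<le> J * J" using J by (intro mult_left_mono) auto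
    then have "m \<le> J\<^sup>2 * 1" using m by (simp add: power2_eq_square)
    also have "\<dots> \<le> J\<^sup>2 * (J\<^sup>2 * (T x)\<^sup>2)" by (intro mult_left_mono T2) simp
    also have "\<dots> = J^4 * (T x)\<^sup>2" by (simp add: power4_eq_xxxx power2_eq_square mult_ac)
    finally show ?thesis using Jpos T_nz[of x] by (simp add: p_def divide_le_eq)
  qed
  have T_meas: "T \<in> borel_measurable borel" unfolding T_def by measurable
  have p_meas: "p \<in> borel_measurable borel" unfolding p_def using T_meas by measurable
  interpret th: thinning \<rho> p T 0
    by (intro thinning.intro thinning_axioms.intro \<rho> p_meas T_meas p_nonneg p_le_1)
  let ?D = "thinned \<rho> p T 0"
  interpret D: real_distribution ?D by (rule th.real_distribution_thinned)
  have pT2: "p x * (T x)\<^sup>2 = m / J^4" for x using T_nz[of x] by (simp add: p_def)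
  have pT: "p x * \<bar>T x\<bar> \<le> m / J^3" for x
  proof -
    have "p x * \<bar>T x\<bar> * 1 \<le> p x * \<bar>T x\<bar> * (J * \<bar>T x\<bar>)"
      using T_lower[of x] Jpos by (intro mult_left_mono mult_nonneg_nonneg p_nonneg) (simp_all add: divide_le_eq mult.commute)
    also have "\<dots> = J * (p x * (T x)\<^sup>2)" by (simp add: power2_eq_square mult_ac)
    also have "\<dots> = m / J^3" unfolding pT2 using Jpos by (simp add: power4_eq_xxxx power3_eq_cube)
    finally show ?thesis by simp
  qed
  have pT_meas: "(\<lambda>x. p x * \<bar>T x\<bar>) \<in> borel_measurable borel" "(\<lambda>x. p x * T x) \<in> borel_measurable borel"
    using p_meas T_meas by measurable
  have int1: "integrable \<rho> (\<lambda>x. p x * norm (T x))"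
    by (intro \<rho>.integrable_const_bound[where B="m / J^3"] AE_I2)
       (use pT p_nonneg pT_meas in \<open>simp_all add: abs_mult\<close>)
  have int2: "integrable \<rho> (\<lambda>x. p x * norm ((T x)\<^sup>2))"
    by (simp add: pT2)
  have D_int1: "integrable ?D (\<lambda>x. x)" and D_b: "(\<integral>x. x \<partial>?D) = (\<integral>x. p x *\<^sub>R T x + (1 - p x) *\<^sub>R 0 \<partial>\<rho>)"
    by (intro th.integrable_thinned int1; simp)+
  have D_int2: "integrable ?D (\<lambda>x. x\<^sup>2)" and D_v: "(\<integral>x. x\<^sup>2 \<partial>?D) = (\<integral>x. p x *\<^sub>R (T x)\<^sup>2 + (1 - p x) *\<^sub>R 0\<^sup>2 \<partial>\<rho>)"
    by (intro th.integrable_thinned int2; simp)+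
  have var: "(\<integral>x. x\<^sup>2 \<partial>?D) = m / J^4"
    unfolding D_v using \<rho>.prob_space by (simp add: pT2)
  define b where "b = (\<integral>x. x \<partial>?D)"
  have b_eq: "b = (\<integral>x. p x * T x \<partial>\<rho>)" by (simp add: b_def D_b)
  have b: "\<bar>b\<bar> \<le> m / J^3"
  proof -
    have "\<bar>b\<bar> \<le> (\<integral>x. \<bar>p x * T x\<bar> \<partial>\<rho>)"
      unfolding b_eq by (rule integral_abs_bound)
    also have "\<dots> \<le> (\<integral>x. m / J^3 \<partial>\<rho>)"
    proof (rule integral_mono)
      show "integrable \<rho> (\<lambda>x. \<bar>p x * T x\<bar>)" using int1 p_nonneg by (simp add: abs_mult)
      show "\<bar>p x * T x\<bar> \<le> m / J^3" for x using pT[of x] p_nonneg[of x] by (simp add: abs_mult)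
    qed simp
    also have "\<dots> = m / J^3" using \<rho>.prob_space by simp
    finally show ?thesis .
  qed
  define I where "I u = (\<integral>x. kolmogorov_kernel u (T x) \<partial>\<rho>)" for u
  have I_int: "integrable \<rho> (\<lambda>x. kolmogorov_kernel u (T x))" for u
    by (intro \<rho>.integrable_const_bound[where B="u\<^sup>2 / 2"] AE_I2 norm_kolmogorov_kernel_le)
       (use T_meas in measurable)
  have I_le: "norm (I u) \<le> u\<^sup>2 / 2" for u
  proof -
    have "norm (I u) \<le> (\<integral>x. norm (kolmogorov_kernel u (T x)) \<partial>\<rho>)"
      unfolding I_def by (rule integral_norm_bound)
    also have "\<dots> \<le> (\<integral>x. u\<^sup>2 / 2 \<partial>\<rho>)"
      by (intro integral_mono integrable_norm I_int norm_kolmogorov_kernel_le) simp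
    also have "\<dots> = u\<^sup>2 / 2" using \<rho>.prob_space by simp
    finally show ?thesis .
  qed
  have char_D: "char ?D u = 1 + (m / J^4) *\<^sub>R I u + \<i> * complex_of_real (u * b)" for u
  proof -
    let ?f = "\<lambda>x. iexp (u * x) - 1 - \<i> * complex_of_real (u * x)"
    have pf: "p x *\<^sub>R ?f (T x) = (m / J^4) *\<^sub>R kolmogorov_kernel u (T x)" for x
    proof -
      have "p x *\<^sub>R ?f (T x) = (p x * (T x)\<^sup>2) *\<^sub>R kolmogorov_kernel u (T x)"
        unfolding square_mult_kolmogorov_kernel[symmetric] by (simp add: scaleR_conv_of_real)
      then show ?thesis by (simp only: pT2)
    qed
    have int_f: "integrable \<rho> (\<lambda>x. p x * norm (?f (T x)))"
    proof -
      have "p x * norm (?f (T x)) = norm ((m / J^4) *\<^sub>R kolmogorov_kernel u (T x))" for x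
        unfolding pf[symmetric] using p_nonneg[of x] by simp
      then show ?thesis using I_int[of u] by (simp del: norm_scaleR)
    qed
    have "(\<integral>x. ?f x \<partial>?D) = (\<integral>x. p x *\<^sub>R ?f (T x) + (1 - p x) *\<^sub>R ?f 0 \<partial>\<rho>)"
      by (intro th.integrable_thinned(2) int_f) measurable
    also have "\<dots> = (m / J^4) *\<^sub>R I u"
      unfolding pf by (simp add: I_def)
    finally have 1: "(\<integral>x. ?f x \<partial>?D) = (m / J^4) *\<^sub>R I u" .
    have i1: "integrable ?D (\<lambda>x. iexp (u * x))" 
      by (intro D.integrable_const_bound[where B=1] AE_I2) simp_all
    have i2: "integrable ?D (\<lambda>x. \<i> * complex_of_real (u * x))"
      by (intro integrable_mult_right integrable_of_real D_int1)
    have i2': "(\<integral>x. \<i> * complex_of_real (u * x) \<partial>?D) = \<i> * complex_of_real (u * b)"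
      unfolding b_def by (simp add: D_int1)
    have "(\<integral>x. ?f x \<partial>?D) = char ?D u - 1 - \<i> * complex_of_real (u * b)"
    proof -
      have "(\<integral>x. ?f x \<partial>?D) = (\<integral>x. iexp (u * x) - 1 \<partial>?D) - (\<integral>x. \<i> * complex_of_real (u * x) \<partial>?D)"
        by (intro Bochner_Integration.integral_diff i2 Bochner_Integration.integrable_diff i1) simp
      also have "(\<integral>x. iexp (u * x) - 1 \<partial>?D) = (\<integral>x. iexp (u * x) \<partial>?D) - (\<integral>x. 1 \<partial>?D)"
        by (intro Bochner_Integration.integral_diff i1) simp
      also have "(\<integral>x. (1::complex) \<partial>?D) = 1" using D.prob_space by simp
      finally show ?thesis unfolding i2' char_def .
    qed
    then have eq: "(m / J^4) *\<^sub>R I u = char ?D u - 1 - \<i> * complex_of_real (u * b)"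
      by (rule trans[OF 1[symmetric]])
    show ?thesis unfolding eq by simp
  qed
  define Q where "Q = distr ?D borel (\<lambda>x. x - b)"
  have shift: "(\<lambda>x. x - b) \<in> borel_measurable ?D" by measurable
  have sq_eq: "(x - b)\<^sup>2 = x\<^sup>2 - 2 * b * x + b\<^sup>2" for x
    by (simp add: power2_diff)
  have int_sq: "integrable ?D (\<lambda>x. x\<^sup>2 - 2 * b * x)"
    by (intro Bochner_Integration.integrable_diff D_int2 integrable_mult_right D_int1)
  have const: "(\<integral>x. c \<partial>?D) = c" for c :: real
    using D.prob_space by simp
  show thesis
  proof (rule that)
    show "real_distribution Q" unfolding Q_def by (intro D.real_distribution_distr shift)
    show "integrable Q (\<lambda>x. x\<^sup>2)"
      unfolding Q_def
      by (subst integrable_distr_eq[OF shift], simp, unfold sq_eq,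
          intro Bochner_Integration.integrable_add int_sq) simp
    have "(\<integral>x. x \<partial>Q) = (\<integral>x. x - b \<partial>?D)"
      unfolding Q_def by (rule integral_distr[OF shift]) simp
    also have "\<dots> = (\<integral>x. x \<partial>?D) - (\<integral>x. b \<partial>?D)"
      by (rule Bochner_Integration.integral_diff[OF D_int1]) simp
    finally show "(\<integral>x. x \<partial>Q) = 0"
      unfolding const b_def[symmetric] by simp
    have "(\<integral>x. x\<^sup>2 \<partial>Q) = (\<integral>x. (x - b)\<^sup>2 \<partial>?D)"
      unfolding Q_def by (rule integral_distr[OF shift]) simp
    also have "\<dots> = (\<integral>x. x\<^sup>2 - 2 * b * x \<partial>?D) + (\<integral>x. b\<^sup>2 \<partial>?D)"
      unfolding sq_eq by (rule Bochner_Integration.integral_add[OF int_sq]) simp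
    also have "(\<integral>x. x\<^sup>2 - 2 * b * x \<partial>?D) = (\<integral>x. x\<^sup>2 \<partial>?D) - (\<integral>x. 2 * b * x \<partial>?D)"
      by (intro Bochner_Integration.integral_diff D_int2 integrable_mult_right D_int1)
    also have "(\<integral>x. 2 * b * x \<partial>?D) = 2 * b * b"
      unfolding b_def by (rule integral_mult_right_zero)
    finally have "(\<integral>x. x\<^sup>2 \<partial>Q) = m / J^4 - 2 * b * b + b\<^sup>2"
      unfolding var const .
    also have "\<dots> \<le> m / J^4" by (simp add: power2_eq_square)
    finally show "J^4 * (\<integral>x. x\<^sup>2 \<partial>Q) \<le> m"
      using Jpos by (simp add: le_divide_eq mult.commute)
    fix u
    define w where "w = (m / J^4) *\<^sub>R I u"
    have "char Q u = (\<integral>x. iexp (- (u * b)) * iexp (u * x) \<partial>?D)"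
    proof -
      have "iexp (u * (x - b)) = iexp (- (u * b)) * iexp (u * x)" for x
        by (simp add: exp_add[symmetric] algebra_simps)
      then show ?thesis
        unfolding Q_def char_def by (subst integral_distr[OF shift]) simp_all
    qed
    also have "\<dots> = iexp (- (u * b)) * (1 + w + \<i> * complex_of_real (u * b))"
      unfolding w_def char_D[symmetric] by (simp add: char_def)
    finally have "norm (char Q u - 1 - w) \<le> 3 / 2 * (u * b)\<^sup>2 + \<bar>u * b\<bar> * norm w"
      by (simp only: norm_centred_char_le)
    also have "\<dots> \<le> 3 / 2 * (\<bar>u\<bar> * (m / J^3))\<^sup>2 + (\<bar>u\<bar> * (m / J^3)) * ((m / J^4) * (u\<^sup>2 / 2))"
    proof (intro add_mono mult_left_mono mult_mono)
      have ub: "\<bar>u * b\<bar> \<le> \<bar>u\<bar> * (m / J^3)" unfolding abs_mult by (intro mult_left_mono b) simp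
      then show "\<bar>u * b\<bar> \<le> \<bar>u\<bar> * (m / J^3)" .
      show "(u * b)\<^sup>2 \<le> (\<bar>u\<bar> * (m / J^3))\<^sup>2" using power_mono[OF ub, of 2] by simp
      show "norm w \<le> m / J^4 * (u\<^sup>2 / 2)"
      proof -
        have "norm w = m / J^4 * norm (I u)" using m Jpos by (simp add: w_def)
        then show ?thesis using I_le[of u] m Jpos by (simp only:) (intro mult_left_mono; simp)
      qed
    qed (use m Jpos in auto)
    finally have "J^4 * norm (char Q u - 1 - w) \<le> J^4 * (3 / 2 * (\<bar>u\<bar> * (m / J^3))\<^sup>2 + (\<bar>u\<bar> * (m / J^3)) * ((m / J^4) * (u\<^sup>2 / 2)))"
      by (rule mult_left_mono) (use Jpos in simp)
    also have "\<dots> = 3 / 2 * u\<^sup>2 * m\<^sup>2 / J\<^sup>2 + \<bar>u\<bar> * m\<^sup>2 * u\<^sup>2 / (2 * J^3)"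
      using Jpos by (simp add: power_divide power_mult_distrib field_simps power_numeral_reduce)
    finally have "J^4 * norm (char Q u - 1 - w) \<le> 3 / 2 * u\<^sup>2 * m\<^sup>2 / J\<^sup>2 + \<bar>u\<bar> * m\<^sup>2 * u\<^sup>2 / (2 * J^3)" .
    moreover have "complex_of_real (J^4) * (char Q u - 1) - m *\<^sub>R I u = complex_of_real (J^4) * (char Q u - 1 - w)"
      using Jpos by (simp add: w_def scaleR_conv_of_real right_diff_distrib)
    then have "norm (complex_of_real (J^4) * (char Q u - 1) - m *\<^sub>R I u) = J^4 * norm (char Q u - 1 - w)"
      using Jpos by (simp only: norm_mult norm_of_real) simp
    ultimately show "norm (complex_of_real (J^4) * (char Q u - 1) - m *\<^sub>R (\<integral>x. kolmogorov_kernel u (T x) \<partial>\<rho>))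
       \<le> 3 / 2 * u\<^sup>2 * m\<^sup>2 / J\<^sup>2 + \<bar>u\<bar> * m\<^sup>2 * u\<^sup>2 / (2 * J^3)"
      unfolding I_def by simp
  qed
qed


text \<open>
  The truncation at \<open>1 / J\<close> disappears as \<open>J\<close> grows because the kernel is continuous, also at 0: an atom of
  \<open>K\<close> at 0 is approximated by many jumps of length \<open>1 / J\<close>.
\<close>

theorem exp_Psi_is_char:
  assumes K: "dist_fun K"
  shows "\<exists>P. real_distribution P \<and> (\<forall>u. char P u = exp (Psi K u))"
proof -
  define m where "m = measure (interval_measure K) UNIV"
  obtain \<rho> where \<rho>: "real_distribution \<rho>" "interval_measure K = density \<rho> (\<lambda>_. ennreal m)"
    unfolding m_def by (rule finite_borel_measure_normalize[OF dist_fun_interval_measure(1)[OF K]])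
  interpret \<rho>: real_distribution \<rho> by fact
  have m: "0 \<le> m" by (simp add: m_def)
  have Psi: "Psi K u = m *\<^sub>R (\<integral>x. kolmogorov_kernel u x \<partial>\<rho>)" for u
    unfolding Psi_kolmogorov_kernel \<rho>(2) by (intro integral_density_const m) simp
  \<comment> \<open>Starting at \<open>n0\<close> ensures that \<open>J j\<close> is at least 1 and at least \<open>m\<close>.\<close>
  define n0 where "n0 = nat \<lceil>m\<rceil> + 1"
  define J where "J j = real (j + n0)" for j
  have J: "1 \<le> J j" "m \<le> J j" for j
    unfolding J_def n0_def by linarith+
  define T where "T j x = (if \<bar>x\<bar> < 1 / J j then 1 / J j else x)" for j x
  have J_inv: "(\<lambda>j. inverse (J j)) \<longlonglongrightarrow> 0"
    unfolding J_def by (intro tendsto_inverse_0_at_top filterlim_compose[OF filterlim_real_sequentially filterlim_add_const_nat_at_top])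
  have "\<exists>Q. real_distribution Q \<and> integrable Q (\<lambda>x. x\<^sup>2) \<and> (\<integral>x. x \<partial>Q) = 0 \<and>
    (J j)^4 * (\<integral>x. x\<^sup>2 \<partial>Q) \<le> m \<and>
    (\<forall>u. norm (complex_of_real ((J j)^4) * (char Q u - 1) - m *\<^sub>R (\<integral>x. kolmogorov_kernel u (T j x) \<partial>\<rho>))
       \<le> 3 / 2 * u\<^sup>2 * m\<^sup>2 / (J j)\<^sup>2 + \<bar>u\<bar> * m\<^sup>2 * u\<^sup>2 / (2 * (J j)^3))" for j
    unfolding T_def by (rule thinned_step[OF \<rho>(1) m J(2)[of j] J(1)[of j]]) blast
  then obtain Q where Q: "\<And>j. real_distribution (Q j)" "\<And>j. integrable (Q j) (\<lambda>x. x\<^sup>2)" "\<And>j. (\<integral>x. x \<partial>Q j) = 0"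
    "\<And>j. (J j)^4 * (\<integral>x. x\<^sup>2 \<partial>Q j) \<le> m"
    and Q_char: "\<And>j u. norm (complex_of_real ((J j)^4) * (char (Q j) u - 1) - m *\<^sub>R (\<integral>x. kolmogorov_kernel u (T j x) \<partial>\<rho>))
       \<le> 3 / 2 * u\<^sup>2 * m\<^sup>2 / (J j)\<^sup>2 + \<bar>u\<bar> * m\<^sup>2 * u\<^sup>2 / (2 * (J j)^3)"
    by metis
  define k where "k j = (j + n0)^4" for j
  have k_J: "real (k j) = (J j)^4" for j by (simp add: k_def J_def)
  have n0: "1 \<le> n0" by (simp add: n0_def)
  show ?thesis
  proof (rule exp_is_char[where Q=Q and k=k and C=m])
    show k1: "1 \<le> k j" for j using n0 by (simp add: k_def)
    have "j \<le> k j" for j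
      using power_increasing[of 1 4 "j + n0"] n0 by (simp add: k_def)
    then show "filterlim k at_top sequentially"
      by (intro filterlim_at_top_mono[OF filterlim_ident] always_eventually allI)
    show "real (k j) * (\<integral>x. x\<^sup>2 \<partial>Q j) \<le> m" for j
      unfolding k_J by (rule Q(4))
    fix u
    let ?c = "\<lambda>j. of_nat (k j) * (char (Q j) u - 1)" and ?I = "\<lambda>j. m *\<^sub>R (\<integral>x. kolmogorov_kernel u (T j x) \<partial>\<rho>)"
    have T_meas: "T j \<in> borel_measurable borel" for j unfolding T_def[abs_def] by measurable
    have T_lim: "(\<lambda>j. T j x) \<longlonglongrightarrow> x" for x
    proof -
      have "norm (T j x - x) \<le> 2 * inverse (J j)" for j
        using J(1)[of j] by (auto simp: T_def divide_inverse)
      moreover have "(\<lambda>j. 2 * inverse (J j)) \<longlonglongrightarrow> 0"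
        using tendsto_mult_left[OF J_inv, of 2] by simp
      ultimately have "(\<lambda>j. T j x - x) \<longlonglongrightarrow> 0"
        by (intro Lim_null_comparison[OF always_eventually[OF allI], of "\<lambda>j. T j x - x"])
      then show ?thesis by (simp add: LIM_zero_iff)
    qed
    have I_lim: "?I \<longlonglongrightarrow> Psi K u"
      unfolding Psi
    proof (intro tendsto_intros integral_dominated_convergence[where w="\<lambda>_. u\<^sup>2 / 2"])
      show "(\<lambda>x. kolmogorov_kernel u (T j x)) \<in> borel_measurable \<rho>" for j
        using T_meas[of j] by measurable
      show "AE x in \<rho>. (\<lambda>j. kolmogorov_kernel u (T j x)) \<longlonglongrightarrow> kolmogorov_kernel u x"
        by (intro AE_I2 isCont_tendsto_compose[OF isCont_kolmogorov_kernel T_lim])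
      show "AE x in \<rho>. norm (kolmogorov_kernel u (T j x)) \<le> u\<^sup>2 / 2" for j
        by (intro AE_I2 norm_kolmogorov_kernel_le)
    qed simp_all
    have bound: "norm (?c j - ?I j) \<le> 3 / 2 * u\<^sup>2 * m\<^sup>2 * (inverse (J j))\<^sup>2 + \<bar>u\<bar> * m\<^sup>2 * u\<^sup>2 / 2 * (inverse (J j))^3" for j
    proof -
      have "(of_nat (k j) :: complex) = complex_of_real ((J j)^4)"
        unfolding k_J[symmetric] by simp
      then have "norm (?c j - ?I j) \<le> 3 / 2 * u\<^sup>2 * m\<^sup>2 / (J j)\<^sup>2 + \<bar>u\<bar> * m\<^sup>2 * u\<^sup>2 / (2 * (J j)^3)"
        using Q_char[of j u] by (simp only:)
      also have "\<dots> = 3 / 2 * u\<^sup>2 * m\<^sup>2 * (inverse (J j))\<^sup>2 + \<bar>u\<bar> * m\<^sup>2 * u\<^sup>2 / 2 * (inverse (J j))^3"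
        by (simp only: divide_inverse inverse_mult_distrib power_inverse mult.assoc)
      finally show ?thesis .
    qed
    have "(\<lambda>j. 3 / 2 * u\<^sup>2 * m\<^sup>2 * (inverse (J j))\<^sup>2 + \<bar>u\<bar> * m\<^sup>2 * u\<^sup>2 / 2 * (inverse (J j))^3) \<longlonglongrightarrow>
        3 / 2 * u\<^sup>2 * m\<^sup>2 * 0\<^sup>2 + \<bar>u\<bar> * m\<^sup>2 * u\<^sup>2 / 2 * 0^3"
      by (intro tendsto_intros J_inv)
    then have "(\<lambda>j. ?c j - ?I j) \<longlonglongrightarrow> 0"
      by (intro Lim_null_comparison[OF always_eventually[OF allI[OF bound]]]) simp
    from tendsto_add[OF this I_lim] show "?c \<longlonglongrightarrow> Psi K u" by simp
  qed (rule Q)+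
qed

lemma assoc_law_char:
  assumes "dist_fun K"
  shows "real_distribution (assoc_law K)" and "char (assoc_law K) u = exp (Psi K u)"
proof -
  have "\<exists>!P. real_distribution P \<and> (\<forall>u. char P u = exp (Psi K u))"
  proof (rule ex_ex1I[OF exp_Psi_is_char[OF assms]])
    fix P P' assume *: "real_distribution P \<and> (\<forall>u. char P u = exp (Psi K u))"
      "real_distribution P' \<and> (\<forall>u. char P' u = exp (Psi K u))"
    then have "char P = char P'" by (auto simp: fun_eq_iff)
    then show "P = P'" using Levy_uniqueness * by blast
  qed
  from theI'[OF this] show "real_distribution (assoc_law K)" "char (assoc_law K) u = exp (Psi K u)"
    unfolding assoc_law_def by auto
qed

section \<open>The second-moment distribution function of a row\<close>

text \<open>
  Centering allows the term \<open>\<i>ux\<close> to be subtracted under the integral, which produces the kernel. The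
  second bound is summable along a row of bounded variance; the third is uniformly small along a
  negligible row.
\<close>

lemma (in real_distribution) char_minus_one:
  assumes sq: "integrable M (\<lambda>x. x\<^sup>2)" and mean: "expectation (\<lambda>x. x) = 0"
  shows "char M u - 1 = (\<integral>x. x\<^sup>2 *\<^sub>R kolmogorov_kernel u x \<partial>M)"
    and "norm (char M u - 1) \<le> u\<^sup>2 / 2 * expectation (\<lambda>x. x\<^sup>2)"
    and "0 \<le> \<epsilon> \<Longrightarrow> norm (char M u - 1) \<le> \<bar>u\<bar> * \<epsilon> + 2 * prob {x. \<epsilon> \<le> \<bar>x\<bar>}"
proof -
  have id: "integrable M (\<lambda>x. x)"
    by (rule square_integrable_imp_integrable[OF _ sq]) simp
  have i1: "integrable M (\<lambda>x. iexp (u * x))"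
    by (intro integrable_const_bound[where B=1] AE_I2) simp_all
  have i2: "integrable M (\<lambda>x. \<i> * complex_of_real (u * x))"
    by (intro integrable_mult_right integrable_of_real id)
  have i3: "integrable M (\<lambda>x. iexp (u * x) - 1)"
    by (intro Bochner_Integration.integrable_diff i1) simp
  have mean': "(\<integral>x. \<i> * complex_of_real (u * x) \<partial>M) = 0"
    using mean by simp
  have one: "(\<integral>x. (1::complex) \<partial>M) = 1" using prob_space by simp
  have e1: "char M u - 1 = (\<integral>x. iexp (u * x) - 1 \<partial>M)"
  proof -
    have "(\<integral>x. iexp (u * x) - 1 \<partial>M) = (\<integral>x. iexp (u * x) \<partial>M) - (\<integral>x. 1 \<partial>M)"
      by (intro Bochner_Integration.integral_diff i1) simp
    then show ?thesis unfolding one char_def by simp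
  qed
  also have "\<dots> = (\<integral>x. iexp (u * x) - 1 \<partial>M) - (\<integral>x. \<i> * complex_of_real (u * x) \<partial>M)"
    unfolding mean' by simp
  also have "\<dots> = (\<integral>x. iexp (u * x) - 1 - \<i> * complex_of_real (u * x) \<partial>M)"
    by (rule Bochner_Integration.integral_diff[OF i3 i2, symmetric])
  also have "\<dots> = (\<integral>x. x\<^sup>2 *\<^sub>R kolmogorov_kernel u x \<partial>M)"
    unfolding scaleR_conv_of_real square_mult_kolmogorov_kernel ..
  finally show e2: "char M u - 1 = (\<integral>x. x\<^sup>2 *\<^sub>R kolmogorov_kernel u x \<partial>M)" .
  have le: "norm (x\<^sup>2 *\<^sub>R kolmogorov_kernel u x) \<le> u\<^sup>2 / 2 * x\<^sup>2" for x
    using mult_left_mono[OF norm_kolmogorov_kernel_le[of u x], of "x\<^sup>2"] by (simp add: mult.commute)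
  have int_sq: "integrable M (\<lambda>x. u\<^sup>2 / 2 * x\<^sup>2)"
    by (intro integrable_mult_right sq)
  have int_k: "integrable M (\<lambda>x. x\<^sup>2 *\<^sub>R kolmogorov_kernel u x)"
    by (rule Bochner_Integration.integrable_bound[OF int_sq]) (simp, intro AE_I2, use le in simp)
  have "norm (char M u - 1) \<le> (\<integral>x. norm (x\<^sup>2 *\<^sub>R kolmogorov_kernel u x) \<partial>M)"
    unfolding e2 by (rule integral_norm_bound)
  also have "\<dots> \<le> (\<integral>x. u\<^sup>2 / 2 * x\<^sup>2 \<partial>M)"
    by (intro integral_mono integrable_norm int_k int_sq le)
  finally show "norm (char M u - 1) \<le> u\<^sup>2 / 2 * expectation (\<lambda>x. x\<^sup>2)" by simp
  assume "0 \<le> \<epsilon>"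
  have "norm (char M u - 1) \<le> (\<integral>x. norm (iexp (u * x) - 1) \<partial>M)"
    unfolding e1 by (rule integral_norm_bound)
  also have "\<dots> \<le> (\<integral>x. \<bar>u\<bar> * \<epsilon> + 2 * indicator {x. \<epsilon> \<le> \<bar>x\<bar>} x \<partial>M)"
  proof (intro integral_mono integrable_norm i3)
    show "integrable M (\<lambda>x. \<bar>u\<bar> * \<epsilon> + 2 * indicator {x. \<epsilon> \<le> \<bar>x\<bar>} x)"
      by (intro Bochner_Integration.integrable_add integrable_mult_right integrable_real_indicator)
         (simp_all add: less_top[symmetric])
    fix x
    show "norm (iexp (u * x) - 1) \<le> \<bar>u\<bar> * \<epsilon> + 2 * indicator {x. \<epsilon> \<le> \<bar>x\<bar>} x"
    proof (cases "\<epsilon> \<le> \<bar>x\<bar>")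
      case True
      have "norm (iexp (u * x) - 1) \<le> 2"
        using norm_triangle_ineq4[of "iexp (u * x)" 1] by simp
      moreover have "0 \<le> \<bar>u\<bar> * \<epsilon>" using \<open>0 \<le> \<epsilon>\<close> by simp
      ultimately show ?thesis using True by simp
    next
      case False
      have "norm (iexp (u * x) - 1) \<le> \<bar>u * x\<bar>"
        using iexp_approx1[of "u * x" 0] by simp
      also have "\<dots> \<le> \<bar>u\<bar> * \<epsilon>"
        unfolding abs_mult using False by (intro mult_left_mono) auto
      finally show ?thesis using False by simp
    qed
  qed
  also have "\<dots> = (\<integral>x. \<bar>u\<bar> * \<epsilon> \<partial>M) + (\<integral>x. 2 * indicator {x. \<epsilon> \<le> \<bar>x\<bar>} x \<partial>M)"
    by (intro Bochner_Integration.integral_add integrable_mult_right integrable_real_indicator)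
       (simp_all add: less_top[symmetric])
  also have "\<dots> = \<bar>u\<bar> * \<epsilon> + 2 * prob {x. \<epsilon> \<le> \<bar>x\<bar>}"
    using prob_space by simp
  finally show "norm (char M u - 1) \<le> \<bar>u\<bar> * \<epsilon> + 2 * prob {x. \<epsilon> \<le> \<bar>x\<bar>}" .
qed

text \<open>
  The measure \<open>x\<^sup>2 \<Sum>k. dF\<^sub>k x\<close>, obtained by weighting each pair of an index and an outcome by the square of
  the variable and pushing forward, so that the theory of product measures supplies its integrals.
\<close>

definition second_moment_measure :: "'a measure \<Rightarrow> 'i set \<Rightarrow> ('i \<Rightarrow> 'a \<Rightarrow> real) \<Rightarrow> real measure" where
  "second_moment_measure M A X =
     distr (density (count_space A \<Otimes>\<^sub>M M) (\<lambda>(k, \<omega>). ennreal ((X k \<omega>)\<^sup>2))) borel (\<lambda>(k, \<omega>). X k \<omega>)"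

lemma (in prob_space) integral_second_moment_measure:
  fixes f :: "real \<Rightarrow> 'b::{banach, second_countable_topology}"
  assumes A: "finite A" and rv: "\<And>k. k \<in> A \<Longrightarrow> random_variable borel (X k)"
    and sq: "\<And>k. k \<in> A \<Longrightarrow> integrable M (\<lambda>\<omega>. (X k \<omega>)\<^sup>2)"
    and f [measurable]: "f \<in> borel_measurable borel" and B: "\<And>x. norm (f x) \<le> B"
  shows "finite_borel_measure (second_moment_measure M A X)"
    and "(\<integral>x. f x \<partial>second_moment_measure M A X) = (\<Sum>k\<in>A. \<integral>\<omega>. (X k \<omega>)\<^sup>2 *\<^sub>R f (X k \<omega>) \<partial>M)"
proof -
  let ?C = "count_space A \<Otimes>\<^sub>M M"
  interpret C: sigma_finite_measure "count_space A" by (rule sigma_finite_measure_count_space_finite[OF A])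
  interpret P: pair_sigma_finite "count_space A" M ..
  have X_meas [measurable]: "(\<lambda>(k, \<omega>). X k \<omega>) \<in> borel_measurable ?C"
    by (rule measurable_pair_measure_countable1) (use A rv in \<open>auto intro: countable_finite\<close>)
  have X_meas' [measurable]: "(\<lambda>z. X (fst z) (snd z)) \<in> borel_measurable ?C"
    using X_meas by (simp add: case_prod_beta')
  let ?g = "\<lambda>z. (X (fst z) (snd z))\<^sup>2" and ?X = "\<lambda>z. X (fst z) (snd z)"
  have N_eq: "second_moment_measure M A X = distr (density ?C (\<lambda>z. ennreal (?g z))) borel ?X"
    by (simp add: second_moment_measure_def case_prod_beta')
  have rv_d: "?X \<in> measurable (density ?C (\<lambda>z. ennreal (?g z))) borel"
    using X_meas' by simp
  have g_int: "integrable ?C ?g"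
  proof (rule P.Fubini_integrable)
    show "?g \<in> borel_measurable ?C" by measurable
    show "integrable (count_space A) (\<lambda>x. \<integral>y. norm (?g (x, y)) \<partial>M)"
      by (rule integrable_count_space) (rule A)
    show "AE x in count_space A. integrable M (\<lambda>y. ?g (x, y))"
      using sq by (simp add: AE_count_space)
  qed
  show "finite_borel_measure (second_moment_measure M A X)"
    unfolding finite_borel_measure_def finite_borel_measure_axioms_def
  proof
    show "finite_measure (second_moment_measure M A X)"
    proof
      have "emeasure (second_moment_measure M A X) UNIV = (\<integral>\<^sup>+ z. ennreal (?g z) \<partial>?C)"
        unfolding N_eq by (subst emeasure_distr[OF rv_d]) (simp_all add: emeasure_density nn_integral_restrict_space[symmetric] cong: nn_integral_cong)
      also have "\<dots> < \<infinity>"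
        using g_int unfolding integrable_iff_bounded by simp
      finally show "emeasure (second_moment_measure M A X) (space (second_moment_measure M A X)) \<noteq> \<infinity>"
        by (simp add: second_moment_measure_def)
    qed
  qed (simp add: second_moment_measure_def)
  have f_int: "integrable ?C (\<lambda>z. ?g z *\<^sub>R f (?X z))"
  proof (rule Bochner_Integration.integrable_bound[OF integrable_mult_right[OF g_int, of B]])
    show "(\<lambda>z. ?g z *\<^sub>R f (?X z)) \<in> borel_measurable ?C" by measurable
    show "AE z in ?C. norm (?g z *\<^sub>R f (?X z)) \<le> norm (B * ?g z)"
    proof (rule AE_I2)
      fix z
      have "0 \<le> B" using norm_ge_zero[of "f 0"] B[of 0] by linarith
      then show "norm (?g z *\<^sub>R f (?X z)) \<le> norm (B * ?g z)"
        using mult_right_mono[OF B[of "?X z"], of "?g z"] by (simp add: abs_mult mult.commute)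
    qed
  qed
  have "(\<integral>x. f x \<partial>second_moment_measure M A X) = (\<integral>z. f (?X z) \<partial>density ?C (\<lambda>z. ennreal (?g z)))"
    unfolding N_eq by (rule integral_distr[OF rv_d f])
  also have "\<dots> = (\<integral>z. ?g z *\<^sub>R f (?X z) \<partial>?C)"
  proof (rule integral_density)
    show "(\<lambda>z. f (?X z)) \<in> borel_measurable ?C" by (rule measurable_compose[OF X_meas' f])
    show "?g \<in> borel_measurable ?C" by measurable
  qed simp
  also have "\<dots> = (\<integral>k. \<integral>\<omega>. ?g (k, \<omega>) *\<^sub>R f (?X (k, \<omega>)) \<partial>M \<partial>count_space A)"
    by (rule P.integral_fst'[OF f_int, symmetric])
  also have "\<dots> = (\<Sum>k\<in>A. \<integral>\<omega>. (X k \<omega>)\<^sup>2 *\<^sub>R f (X k \<omega>) \<partial>M)"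
    by (simp add: lebesgue_integral_count_space_finite[OF A])
  finally show "(\<integral>x. f x \<partial>second_moment_measure M A X) = (\<Sum>k\<in>A. \<integral>\<omega>. (X k \<omega>)\<^sup>2 *\<^sub>R f (X k \<omega>) \<partial>M)" .
qed

locale array_row = prob_space M for M :: "'a measure" +
  fixes A :: "'i set" and X :: "'i \<Rightarrow> 'a \<Rightarrow> real"
  assumes finite_A: "finite A" and indep: "indep_vars (\<lambda>_. borel) X A"
    and sq: "\<And>k. k \<in> A \<Longrightarrow> integrable M (\<lambda>\<omega>. (X k \<omega>)\<^sup>2)"
    and mean: "\<And>k. k \<in> A \<Longrightarrow> expectation (X k) = 0"
begin

abbreviation law where "law k \<equiv> distr M borel (X k)"

lemma rv: "k \<in> A \<Longrightarrow> random_variable borel (X k)"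
  using indep by (simp add: indep_vars_def)

lemma real_distribution_law: "k \<in> A \<Longrightarrow> real_distribution (law k)"
  by (intro real_distribution_distr rv)

lemma law_moments:
  assumes "k \<in> A"
  shows "integrable (law k) (\<lambda>x. x\<^sup>2)" "(\<integral>x. x \<partial>law k) = 0" "(\<integral>x. x\<^sup>2 \<partial>law k) = variance (X k)"
proof -
  show "integrable (law k) (\<lambda>x. x\<^sup>2)"
    by (subst integrable_distr_eq[OF rv[OF assms]]) (simp_all add: sq[OF assms])
  show "(\<integral>x. x \<partial>law k) = 0"
    by (subst integral_distr[OF rv[OF assms]]) (simp_all add: mean[OF assms])
  show "(\<integral>x. x\<^sup>2 \<partial>law k) = variance (X k)"
    by (subst integral_distr[OF rv[OF assms]]) (simp_all add: mean[OF assms])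
qed

abbreviation N where "N \<equiv> second_moment_measure M A X"

lemma finite_borel_measure_N: "finite_borel_measure N"
  using integral_second_moment_measure(1)[OF finite_A rv sq, where f="\<lambda>_. 0::real" and B=0] by simp

lemma integral_N:
  fixes f :: "real \<Rightarrow> 'b::{banach, second_countable_topology}"
  assumes "f \<in> borel_measurable borel" "\<And>x. norm (f x) \<le> B"
  shows "(\<integral>x. f x \<partial>N) = (\<Sum>k\<in>A. \<integral>x. x\<^sup>2 *\<^sub>R f x \<partial>law k)"
proof -
  have "(\<integral>x. f x \<partial>N) = (\<Sum>k\<in>A. \<integral>\<omega>. (X k \<omega>)\<^sup>2 *\<^sub>R f (X k \<omega>) \<partial>M)"
    by (rule integral_second_moment_measure(2)[OF finite_A rv sq assms])
  also have "\<dots> = (\<Sum>k\<in>A. \<integral>x. x\<^sup>2 *\<^sub>R f x \<partial>law k)"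
    by (intro sum.cong refl, subst integral_distr[OF rv]) (use assms(1) in measurable)
  finally show ?thesis .
qed

lemma measure_N_UNIV: "measure N UNIV = (\<Sum>k\<in>A. variance (X k))"
proof -
  interpret N: finite_borel_measure N by (rule finite_borel_measure_N)
  have "measure N UNIV = (\<integral>x. (1::real) \<partial>N)" using N.borel_UNIV by simp
  also have "\<dots> = (\<Sum>k\<in>A. variance (X k))"
    by (subst integral_N[where B=1]) (simp_all add: law_moments)
  finally show ?thesis .
qed

text \<open>
  The second-moment distribution function of a row is the cumulative function of this measure; in
  particular it comes normalized to limit 0 at \<open>-\<infinity>\<close>.
\<close>

lemma cdf_N: "cdf N x = (\<Sum>k\<in>A. LINT y:{..x}|interval_measure (cdf (law k)). y\<^sup>2)"
proof -
  interpret N: finite_borel_measure N by (rule finite_borel_measure_N)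
  have "cdf N x = (\<integral>y. indicator {..x} y \<partial>N)"
    using N.borel_UNIV by (simp add: cdf_def)
  also have "\<dots> = (\<Sum>k\<in>A. \<integral>y. y\<^sup>2 *\<^sub>R indicator {..x} y \<partial>law k)"
    by (rule integral_N[where B=1]) (auto split: split_indicator)
  also have "\<dots> = (\<Sum>k\<in>A. LINT y:{..x}|interval_measure (cdf (law k)). y\<^sup>2)"
  proof (intro sum.cong refl)
    fix k assume "k \<in> A"
    then have "interval_measure (cdf (law k)) = law k"
      by (intro interval_measure_cdf real_distribution.finite_borel_measure_M real_distribution_law)
    then show "(\<integral>y. y\<^sup>2 *\<^sub>R indicator {..x} y \<partial>law k) = (LINT y:{..x}|interval_measure (cdf (law k)). y\<^sup>2)"
      by (simp add: set_lebesgue_integral_def mult.commute)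
  qed
  finally show ?thesis .
qed

text \<open>
  The exponent belonging to a row is the sum of the \<open>\<phi>\<^sub>k - 1\<close>: the identity that connects
  characteristic functions of the summands with the second-moment distribution function.
\<close>

lemma kolmogorov_integral_N: "(\<integral>x. kolmogorov_kernel u x \<partial>N) = (\<Sum>k\<in>A. char (law k) u - 1)"
proof -
  have "(\<integral>x. kolmogorov_kernel u x \<partial>N) = (\<Sum>k\<in>A. \<integral>x. x\<^sup>2 *\<^sub>R kolmogorov_kernel u x \<partial>law k)"
    by (rule integral_N[OF _ norm_kolmogorov_kernel_le]) measurable
  also have "\<dots> = (\<Sum>k\<in>A. char (law k) u - 1)"
    by (intro sum.cong refl real_distribution.char_minus_one(1)[symmetric] real_distribution_law law_moments)
  finally show ?thesis .
qed

lemma char_sum_minus_exp_le: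
  assumes small: "\<And>k. k \<in> A \<Longrightarrow> prob {\<omega> \<in> space M. \<epsilon> \<le> \<bar>X k \<omega>\<bar>} \<le> s" and "0 \<le> \<epsilon>" "0 \<le> s"
  shows "norm (char (distr M borel (\<lambda>\<omega>. \<Sum>k\<in>A. X k \<omega>)) u - exp (\<integral>x. kolmogorov_kernel u x \<partial>N))
    \<le> exp 2 * (\<bar>u\<bar> * \<epsilon> + 2 * s) * (u\<^sup>2 / 2 * (\<Sum>k\<in>A. variance (X k)))"
proof -
  have d: "norm (char (law k) u - 1) \<le> \<bar>u\<bar> * \<epsilon> + 2 * s" if k: "k \<in> A" for k
  proof -
    have "measure (law k) {x. \<epsilon> \<le> \<bar>x\<bar>} = prob {\<omega> \<in> space M. \<epsilon> \<le> \<bar>X k \<omega>\<bar>}"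
      by (subst measure_distr[OF rv[OF k]]) (auto intro!: arg_cong[where f=prob])
    then have "measure (law k) {x. \<epsilon> \<le> \<bar>x\<bar>} \<le> s" using small[OF k] by simp
    then show ?thesis
      using real_distribution.char_minus_one(3)[OF real_distribution_law law_moments(1,2) \<open>0 \<le> \<epsilon>\<close>, OF k k k, of u] by linarith
  qed
  have "norm ((\<Prod>k\<in>A. char (law k) u) - exp (\<Sum>k\<in>A. char (law k) u - 1))
    \<le> exp 2 * (\<bar>u\<bar> * \<epsilon> + 2 * s) * (\<Sum>k\<in>A. norm (char (law k) u - 1))"
    by (intro norm_prod_minus_exp_sum_le real_distribution.cmod_char_le_1 real_distribution_law d finite_A)
  also have "\<dots> \<le> exp 2 * (\<bar>u\<bar> * \<epsilon> + 2 * s) * (\<Sum>k\<in>A. u\<^sup>2 / 2 * variance (X k))"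
  proof (intro mult_left_mono sum_mono)
    fix k assume k: "k \<in> A"
    show "norm (char (law k) u - 1) \<le> u\<^sup>2 / 2 * variance (X k)"
      using real_distribution.char_minus_one(2)[OF real_distribution_law law_moments(1,2), OF k k k, of u]
      unfolding law_moments(3)[OF k] .
  qed (use assms(2,3) in simp)
  finally show ?thesis
    unfolding char_distr_sum[OF indep] kolmogorov_integral_N sum_distrib_left[symmetric] .
qed

end

section \<open>Asymptotically negligible arrays\<close>

lemma weak_conv_m_Suc: "weak_conv_m (\<lambda>n. \<mu> (Suc n)) P \<longleftrightarrow> weak_conv_m \<mu> P"
  unfolding weak_conv_m_def weak_conv_def filterlim_sequentially_Suc[of "\<lambda>n. cdf (\<mu> n) x" for x] ..

lemma weak_conv_m_char:
  assumes "\<And>n. 1 \<le> n \<Longrightarrow> real_distribution (\<mu> n)" "real_distribution P"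
  shows "weak_conv_m \<mu> P \<longleftrightarrow> (\<forall>u. (\<lambda>n. char (\<mu> n) u) \<longlonglongrightarrow> char P u)"
proof
  assume "weak_conv_m \<mu> P"
  then have "weak_conv_m (\<lambda>n. \<mu> (Suc n)) P" by (simp add: weak_conv_m_Suc)
  then have "(\<lambda>n. char (\<mu> (Suc n)) u) \<longlonglongrightarrow> char P u" for u
    by (intro levy_continuity1 assms) simp_all
  then show "\<forall>u. (\<lambda>n. char (\<mu> n) u) \<longlonglongrightarrow> char P u"
    by (subst filterlim_sequentially_Suc[symmetric]) blast
next
  assume "\<forall>u. (\<lambda>n. char (\<mu> n) u) \<longlonglongrightarrow> char P u"
  then have *: "(\<lambda>n. char (\<mu> (Suc n)) u) \<longlonglongrightarrow> char P u" for u
    by (intro LIMSEQ_Suc) blast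
  have "weak_conv_m (\<lambda>n. \<mu> (Suc n)) P"
    by (intro levy_continuity assms *) simp_all
  then show "weak_conv_m \<mu> P" by (simp add: weak_conv_m_Suc)
qed

text \<open>
  Used to pass from the subsequences supplied by Helly's theorem to the full sequence.
\<close>

lemma tendsto_from_subsequences:
  fixes f :: "nat \<Rightarrow> 'b::metric_space"
  assumes "\<And>r. strict_mono (r :: nat \<Rightarrow> nat) \<Longrightarrow> \<exists>s. strict_mono (s :: nat \<Rightarrow> nat) \<and> (\<lambda>n. f (r (s n))) \<longlonglongrightarrow> l"
  shows "f \<longlonglongrightarrow> l"
proof (rule ccontr)
  assume "\<not> f \<longlonglongrightarrow> l"
  then obtain e where e: "e > 0" "\<not> (\<forall>\<^sub>F n in sequentially. dist (f n) l < e)"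
    by (auto simp: tendsto_iff)
  then have "infinite {n. \<not> dist (f n) l < e}"
    by (simp add: not_eventually INFM_iff_infinite cofinite_eq_sequentially[symmetric])
  from infinite_enumerate[OF this] obtain r :: "nat \<Rightarrow> nat" where r: "strict_mono r" "\<And>n. \<not> dist (f (r n)) l < e"
    by blast
  obtain s :: "nat \<Rightarrow> nat" where "(\<lambda>n. f (r (s n))) \<longlonglongrightarrow> l"
    using assms[OF r(1)] by blast
  from tendstoD[OF this e(1)] have "\<forall>\<^sub>F n in sequentially. False"
    by eventually_elim (use r(2) in blast)
  then show False by simp
qed

text \<open>
  Rows are indexed from 1, and row 0 carries no assumption, hence the shifts by \<open>Suc\<close> below.
\<close>

locale negligible_array =
  fixes M :: "nat \<Rightarrow> 'a measure" and kn :: "nat \<Rightarrow> nat" and X :: "nat \<Rightarrow> nat \<Rightarrow> 'a \<Rightarrow> real"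
  assumes arr: "centered_array M kn X" and bvh: "BVH M kn X" and uan: "UAN M kn X"
begin

abbreviation row_measure where "row_measure n \<equiv> second_moment_measure (M n) {1..kn n} (\<lambda>k. X k n)"
abbreviation Kn where "Kn \<equiv> array_df M kn X"
abbreviation S where "S \<equiv> row_sum_law M kn X"

lemma row: "1 \<le> n \<Longrightarrow> array_row (M n) {1..kn n} (\<lambda>k. X k n)"
  using arr by (auto simp: centered_array_def array_row_def array_row_axioms_def)

lemma finite_borel_measure_N: "1 \<le> n \<Longrightarrow> finite_borel_measure (row_measure n)"
  by (rule array_row.finite_borel_measure_N[OF row])

lemma array_df_eq_cdf: "1 \<le> n \<Longrightarrow> Kn n = cdf (row_measure n)"
  by (rule ext) (simp only: array_df_def array_row.cdf_N[OF row])

lemma Psi_array_df: "1 \<le> n \<Longrightarrow> Psi (Kn n) u = (\<integral>x. kolmogorov_kernel u x \<partial>row_measure n)"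
  by (simp only: array_df_eq_cdf Psi_cdf finite_borel_measure_N)

lemma real_distribution_S: "1 \<le> n \<Longrightarrow> real_distribution (S n)"
proof -
  assume "1 \<le> n"
  then interpret array_row "M n" "{1..kn n}" "\<lambda>k. X k n" by (rule row)
  show ?thesis
    unfolding row_sum_law_def by (intro real_distribution_distr borel_measurable_sum rv)
qed

lemma mass_bound: obtains C where "0 \<le> C" "\<And>n. 1 \<le> n \<Longrightarrow> measure (row_measure n) UNIV \<le> C"
proof -
  obtain B where B: "\<And>n. 1 \<le> n \<Longrightarrow> (\<Sum>k=1..kn n. prob_space.variance (M n) (X k n)) \<le> B"
    using bvh by (auto simp: BVH_def bdd_above_def)
  have "measure (row_measure n) UNIV \<le> \<bar>B\<bar>" if "1 \<le> n" for n
    using array_row.measure_N_UNIV[OF row[OF that]] B[OF that] by simp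
  then show thesis using that[of "\<bar>B\<bar>"] by simp
qed

text \<open>
  The bound for a single row involves \<open>\<bar>u\<bar> * \<epsilon>\<close> plus a supremum of tail probabilities. First \<open>\<epsilon>\<close> is chosen
  small, and then negligibility makes the supremum small for this \<open>\<epsilon>\<close>.
\<close>

lemma char_row_sum_asymp:
  "(\<lambda>n. char (S n) u - exp (Psi (Kn n) u)) \<longlonglongrightarrow> 0"
proof (rule tendstoI)
  fix e :: real assume "e > 0"
  obtain C where C: "0 \<le> C" "\<And>n. 1 \<le> n \<Longrightarrow> measure (row_measure n) UNIV \<le> C" using mass_bound by blast
  define c where "c = exp 2 * (u\<^sup>2 / 2 * C) + 1"
  have "0 \<le> exp 2 * (u\<^sup>2 / 2 * C)" using C(1) by simp
  then have c: "c > 0" "exp 2 * (u\<^sup>2 / 2 * C) \<le> c" unfolding c_def by linarith+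
  define \<epsilon> where "\<epsilon> = e / (2 * c * (\<bar>u\<bar> + 1))"
  have eps: "\<epsilon> > 0" "c * (\<bar>u\<bar> * \<epsilon>) \<le> e / 2"
  proof -
    show "\<epsilon> > 0" using \<open>e > 0\<close> c(1) by (simp add: \<epsilon>_def)
    have "c * (\<bar>u\<bar> * \<epsilon>) \<le> c * ((\<bar>u\<bar> + 1) * \<epsilon>)"
      using c(1) \<open>\<epsilon> > 0\<close> by (intro mult_left_mono mult_right_mono) auto
    also have "\<dots> = (c * (\<bar>u\<bar> + 1)) * (e / (2 * (c * (\<bar>u\<bar> + 1))))"
      by (simp only: \<epsilon>_def mult.assoc)
    also have "\<dots> = e / 2" using c(1) by (simp add: add_nonneg_eq_0_iff)
    finally show "c * (\<bar>u\<bar> * \<epsilon>) \<le> e / 2" .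
  qed
  define s where "s n = (SUP k\<in>{1..kn n}. measure (M n) {\<omega>\<in>space (M n). \<epsilon> \<le> \<bar>X k n \<omega>\<bar>})" for n
  have "s \<longlonglongrightarrow> 0" using uan eps(1) unfolding UAN_def s_def by blast
  then have "\<forall>\<^sub>F n in sequentially. dist (s n) 0 < e / (4 * c)"
    by (rule tendstoD) (use \<open>e > 0\<close> c(1) in simp)
  moreover have "\<forall>\<^sub>F n in sequentially. 1 \<le> kn n"
    using arr by (auto simp: centered_array_def filterlim_at_top)
  ultimately show "\<forall>\<^sub>F n in sequentially. dist (char (S n) u - exp (Psi (Kn n) u)) 0 < e"
    using eventually_ge_at_top[of 1]
  proof eventually_elim
    case (elim n)
    interpret array_row "M n" "{1..kn n}" "\<lambda>k. X k n" by (rule row[OF elim(3)])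
    have le_s: "prob {\<omega>\<in>space (M n). \<epsilon> \<le> \<bar>X k n \<omega>\<bar>} \<le> s n" if "k \<in> {1..kn n}" for k
      unfolding s_def by (rule cSUP_upper[OF that]) simp
    have s0: "0 \<le> s n"
      using order_trans[OF measure_nonneg le_s[of 1]] elim(2) by simp
    have "norm (char (S n) u - exp (Psi (Kn n) u)) \<le>
      exp 2 * (\<bar>u\<bar> * \<epsilon> + 2 * s n) * (u\<^sup>2 / 2 * (\<Sum>k\<in>{1..kn n}. variance (X k n)))"
      unfolding Psi_array_df[OF elim(3)] row_sum_law_def
      by (rule char_sum_minus_exp_le[OF le_s]) (use eps(1) s0 in auto)
    also have "\<dots> \<le> exp 2 * (\<bar>u\<bar> * \<epsilon> + 2 * s n) * (u\<^sup>2 / 2 * C)"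
      unfolding measure_N_UNIV[symmetric]
      by (intro mult_left_mono C(2) elim(3) mult_nonneg_nonneg add_nonneg_nonneg) (use eps(1) s0 in auto)
    also have "\<dots> = exp 2 * (u\<^sup>2 / 2 * C) * (\<bar>u\<bar> * \<epsilon> + 2 * s n)"
      by (simp only: mult_ac)
    also have "\<dots> \<le> c * (\<bar>u\<bar> * \<epsilon> + 2 * s n)"
      by (intro mult_right_mono c(2) add_nonneg_nonneg mult_nonneg_nonneg) (use eps(1) s0 in auto)
    also have "\<dots> = c * (\<bar>u\<bar> * \<epsilon>) + 2 * (c * s n)"
      by (simp only: distrib_left mult.left_commute)
    also have "\<dots> < e"
    proof -
      have "s n < e / (4 * c)" using elim(1) s0 by simp
      then have "c * s n < e / 4" using c(1) by (simp add: less_divide_eq mult_ac)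
      then show ?thesis using eps(2) by linarith
    qed
    finally show ?case by simp
  qed
qed

lemma Psi_tendsto:
  assumes K: "dist_fun K" and s: "\<And>n. 1 \<le> s n"
    and conv: "weak_conv (\<lambda>n x. Kn (s n) x - c n) K"
  shows "(\<lambda>n. Psi (Kn (s n)) u) \<longlonglongrightarrow> Psi K u"
proof -
  obtain C where C: "\<And>n. 1 \<le> n \<Longrightarrow> measure (row_measure n) UNIV \<le> C" using mass_bound by blast
  obtain a where a: "\<And>x. K x = a + cdf (interval_measure K) x"
    using dist_fun_interval_measure(2)[OF K] by blast
  have a': "cdf (interval_measure K) x = K x - a" for x using a[of x] by linarith
  have "weak_conv (\<lambda>n x. cdf (row_measure (s n)) x - (c n + a)) (cdf (interval_measure K))"
    unfolding weak_conv_def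
  proof (intro allI impI)
    fix x assume "isCont (cdf (interval_measure K)) x"
    then have "isCont (\<lambda>y. a + cdf (interval_measure K) y) x" by (intro continuous_intros)
    moreover have "(\<lambda>y. a + cdf (interval_measure K) y) = K" using a' by (intro ext) simp
    ultimately have "isCont K x" by (simp only:)
    then have "(\<lambda>n. Kn (s n) x - c n - a) \<longlonglongrightarrow> K x - a"
      using conv by (intro tendsto_intros) (simp add: weak_conv_def)
    then show "(\<lambda>n. cdf (row_measure (s n)) x - (c n + a)) \<longlonglongrightarrow> cdf (interval_measure K) x"
      unfolding a' by (simp only: array_df_eq_cdf[OF s] diff_diff_eq)
  qed
  then have "(\<lambda>n. \<integral>x. kolmogorov_kernel u x \<partial>row_measure (s n)) \<longlonglongrightarrow> (\<integral>x. kolmogorov_kernel u x \<partial>interval_measure K)"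
    by (intro vague_convergence_integral[where C=C and B="u\<^sup>2 / 2"] finite_borel_measure_N s C
        dist_fun_interval_measure(1) K isCont_kolmogorov_kernel norm_kolmogorov_kernel_le
        kolmogorov_kernel_at_infinity)
  then show ?thesis
    by (simp only: Psi_array_df[OF s] Psi_kolmogorov_kernel[of K])
qed

lemma char_row_sum_tendsto:
  assumes K: "dist_fun K" and s: "\<And>n. 1 \<le> s n" "filterlim s at_top sequentially"
    and conv: "weak_conv (\<lambda>n x. Kn (s n) x - c n) K"
  shows "(\<lambda>n. char (S (s n)) u) \<longlonglongrightarrow> exp (Psi K u)"
proof -
  have "(\<lambda>n. char (S (s n)) u - exp (Psi (Kn (s n)) u)) \<longlonglongrightarrow> 0"
    by (rule filterlim_compose[OF char_row_sum_asymp s(2)])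
  from tendsto_add[OF this tendsto_exp[OF Psi_tendsto[OF K s(1) conv, of u]]]
  show ?thesis by simp
qed

text \<open>
  The distribution functions of the rows take values in \<open>[0, C]\<close> by the variance bound, so Helly's
  selection theorem applies to them without any constants.
\<close>

lemma vague_subsequence:
  fixes r :: "nat \<Rightarrow> nat"
  assumes r: "strict_mono r"
  obtains s K where "strict_mono s" "dist_fun K" "weak_conv (\<lambda>n. Kn (Suc (r (s n)))) K"
    "\<And>u. (\<lambda>n. char (S (Suc (r (s n)))) u) \<longlonglongrightarrow> exp (Psi K u)"
proof -
  obtain C where C: "\<And>n. 1 \<le> n \<Longrightarrow> measure (row_measure n) UNIV \<le> C" using mass_bound by blast
  define f where "f n = Kn (Suc (r n))" for n
  have f: "f n = cdf (row_measure (Suc (r n)))" "finite_borel_measure (row_measure (Suc (r n)))" for n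
    unfolding f_def by (rule array_df_eq_cdf, simp, rule finite_borel_measure_N, simp)
  have "\<bar>f n x\<bar> \<le> C" for n x
  proof -
    interpret Nn: finite_borel_measure "row_measure (Suc (r n))" by (rule f)
    show ?thesis unfolding f(1)
      using Nn.cdf_nonneg[of x] Nn.cdf_bounded[of x] C[of "Suc (r n)"] Nn.borel_UNIV by simp
  qed
  moreover have "continuous (at_right x) (f n)" "mono (f n)" for n x
    unfolding f(1) by (rule dist_funD[OF dist_fun_cdf[OF f(2)]])+
  ultimately obtain s K where s: "strict_mono (s :: nat \<Rightarrow> nat)" and K: "\<And>x. continuous (at_right x) K" "mono K" "\<And>x. \<bar>K x\<bar> \<le> C"
    "\<And>x. isCont K x \<Longrightarrow> (\<lambda>n. f (s n) x) \<longlonglongrightarrow> K x"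
    using Helly_selection[of f C] by blast
  have dK: "dist_fun K"
    using K by (auto simp: dist_fun_def bounded_iff intro!: exI[of _ C])
  have conv: "weak_conv (\<lambda>n. Kn (Suc (r (s n)))) K"
    using K(4) unfolding weak_conv_def f_def by blast
  have mono: "strict_mono (\<lambda>n. Suc (r (s n)))"
    using r s by (auto simp: strict_mono_def)
  show thesis
  proof (rule that[OF s dK conv])
    fix u
    show "(\<lambda>n. char (S (Suc (r (s n)))) u) \<longlonglongrightarrow> exp (Psi K u)"
      by (rule char_row_sum_tendsto[where c="\<lambda>_. 0", OF dK _ filterlim_subseq[OF mono]]) (use conv in simp_all)
  qed
qed

text \<open>
  Along a subsequence the limit is \<open>exp (Psi K)\<close> for some \<open>K\<close>; its \<open>p\<close>-th root is \<open>exp (Psi (K / p))\<close>, which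
  is again a characteristic function.
\<close>

theorem weak_limit_infinitely_decomposable:
  assumes P: "real_distribution P" and conv: "weak_conv_m S P"
  shows "infinitely_decomposable P"
proof -
  obtain s K where s: "strict_mono s" and K: "dist_fun K"
    and lim: "\<And>u. (\<lambda>n. char (S (Suc (s n))) u) \<longlonglongrightarrow> exp (Psi K u)"
    using vague_subsequence[OF strict_mono_id] by (simp only: id_apply) blast
  have char_P: "char P u = exp (Psi K u)" for u
  proof (rule LIMSEQ_unique[OF _ lim])
    have "(\<lambda>n. char (S n) u) \<longlonglongrightarrow> char P u"
      using weak_conv_m_char[of S, OF real_distribution_S P] conv by blast
    from LIMSEQ_subseq_LIMSEQ[OF LIMSEQ_Suc[OF this] s]
    show "(\<lambda>n. char (S (Suc (s n))) u) \<longlonglongrightarrow> char P u" by (simp add: comp_def)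
  qed
  show ?thesis
    unfolding infinitely_decomposable_def
  proof (intro allI impI)
    fix p :: nat assume p: "1 \<le> p"
    define L where "L x = inverse (real p) * K x" for x
    have L: "dist_fun L" "Psi L u = complex_of_real (inverse (real p)) * Psi K u" for u
      unfolding L_def by (rule Psi_scale[OF K]; simp)+
    have "char P u = char (assoc_law L) u ^ p" for u
    proof -
      have "of_nat p * Psi L u = Psi K u" using p by (simp add: L(2))
      then show ?thesis
        unfolding assoc_law_char(2)[OF L(1)] char_P exp_of_nat_mult[symmetric] by simp
    qed
    then show "\<exists>Q. real_distribution Q \<and> (\<forall>u. char P u = char Q u ^ p)"
      using assoc_law_char(1)[OF L(1)] by blast
  qed
qed

theorem pre_weak_conv_imp_row_sum_conv:
  assumes K: "dist_fun K" and conv: "pre_weak_conv Kn K"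
  shows "weak_conv_m S (assoc_law K)"
proof -
  obtain c where c: "weak_conv (\<lambda>n x. Kn n x - c n) K"
    using conv by (auto simp: pre_weak_conv_def)
  then have "weak_conv (\<lambda>n x. Kn (Suc n) x - c (Suc n)) K"
    unfolding weak_conv_def by (auto intro: LIMSEQ_Suc[of "\<lambda>n. Kn n x - c n" for x])
  then have "(\<lambda>n. char (S (Suc n)) u) \<longlonglongrightarrow> exp (Psi K u)" for u
    by (intro char_row_sum_tendsto[where c="\<lambda>n. c (Suc n)", OF K _ filterlim_Suc]) simp_all
  then have "\<forall>u. (\<lambda>n. char (S n) u) \<longlonglongrightarrow> char (assoc_law K) u"
    unfolding assoc_law_char(2)[OF K] by (simp add: filterlim_sequentially_Suc[of "\<lambda>n. char (S n) u" for u])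
  then show ?thesis
    using weak_conv_m_char[of S, OF real_distribution_S assoc_law_char(1)[OF K]] by blast
qed

text \<open>
  A subsequential limit \<open>L\<close> has the same exponent as \<open>K\<close>, so it differs from \<open>K\<close> by a constant, which may
  depend on the subsequence. Pinning all functions at one continuity point \<open>x0\<close> removes this constant.
\<close>

theorem row_sum_conv_imp_pre_weak_conv:
  assumes K: "dist_fun K" and conv: "weak_conv_m S (assoc_law K)"
  shows "pre_weak_conv Kn K"
proof -
  obtain x0 where x0: "isCont K x0"
    using mono_continuity_point[OF dist_funD(1)[OF K], of 0 1] by auto
  have char_lim: "(\<lambda>n. char (S (Suc n)) u) \<longlonglongrightarrow> exp (Psi K u)" for u
  proof -
    have "(\<lambda>n. char (S n) u) \<longlonglongrightarrow> char (assoc_law K) u"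
      using conv weak_conv_m_char[of S, OF real_distribution_S assoc_law_char(1)[OF K]] by blast
    from LIMSEQ_Suc[OF this] show ?thesis by (simp only: assoc_law_char(2)[OF K])
  qed
  have "weak_conv (\<lambda>n x. Kn n x - (Kn n x0 - K x0)) K"
    unfolding weak_conv_def
  proof (intro allI impI)
    fix x assume x: "isCont K x"
    have "(\<lambda>n. Kn (Suc n) x - (Kn (Suc n) x0 - K x0)) \<longlonglongrightarrow> K x"
    proof (rule tendsto_from_subsequences)
      fix r :: "nat \<Rightarrow> nat" assume r: "strict_mono r"
      obtain s L where s: "strict_mono s" and L: "dist_fun L" and Lc: "weak_conv (\<lambda>n. Kn (Suc (r (s n)))) L"
        and lim: "\<And>u. (\<lambda>n. char (S (Suc (r (s n)))) u) \<longlonglongrightarrow> exp (Psi L u)"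
        using vague_subsequence[OF r] by blast
      have "exp (Psi K u) = exp (Psi L u)" for u
      proof (rule LIMSEQ_unique[OF _ lim])
        have "strict_mono (\<lambda>n. r (s n))" using r s by (auto simp: strict_mono_def)
        from LIMSEQ_subseq_LIMSEQ[OF char_lim this]
        show "(\<lambda>n. char (S (Suc (r (s n)))) u) \<longlonglongrightarrow> exp (Psi K u)" by (simp add: comp_def)
      qed
      then have "Psi K = Psi L" by (rule exp_Psi_inj[OF K L])
      then obtain d where d: "\<And>y. K y = L y + d" using Psi_inj[OF K L] by blast
      have L_eq: "L = (\<lambda>y. K y - d)" using d by auto
      have Lx: "isCont L x" "isCont L x0" unfolding L_eq by (intro continuous_intros x x0)+
      have "(\<lambda>n. Kn (Suc (r (s n))) x - (Kn (Suc (r (s n))) x0 - K x0)) \<longlonglongrightarrow> L x - (L x0 - K x0)"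
        using Lc Lx by (intro tendsto_intros) (auto simp: weak_conv_def)
      also have "L x - (L x0 - K x0) = K x" by (simp add: L_eq)
      finally show "\<exists>s. strict_mono s \<and> (\<lambda>n. Kn (Suc (r (s n))) x - (Kn (Suc (r (s n))) x0 - K x0)) \<longlonglongrightarrow> K x"
        using s by blast
    qed
    then show "(\<lambda>n. Kn n x - (Kn n x0 - K x0)) \<longlonglongrightarrow> K x"
      by (simp only: filterlim_sequentially_Suc[of "\<lambda>n. Kn n x - (Kn n x0 - K x0)"])
  qed
  then show ?thesis unfolding pre_weak_conv_def by (intro exI[of _ "\<lambda>n. Kn n x0 - K x0"])
qed

lemma Kn_nonneg: "1 \<le> n \<Longrightarrow> 0 \<le> Kn n x"
  by (simp only: array_df_eq_cdf finite_borel_measure.cdf_nonneg finite_borel_measure_N)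

text \<open>
  If no mass escapes to \<open>-\<infinity>\<close>, then far to the left both \<open>Kn n\<close> and \<open>K\<close> are small, and there the
  constants are all that could separate them.
\<close>

lemma pre_weak_conv_imp_weak_conv:
  assumes K: "dist_fun K" "(K \<longlongrightarrow> 0) at_bot" and esc: "no_escape_at_bot Kn"
    and conv: "pre_weak_conv Kn K"
  shows "weak_conv Kn K"
proof -
  obtain c where c: "\<And>x. isCont K x \<Longrightarrow> (\<lambda>n. Kn n x - c n) \<longlonglongrightarrow> K x"
    using conv by (auto simp: pre_weak_conv_def weak_conv_def)
  have c0: "c \<longlonglongrightarrow> 0"
  proof (rule tendstoI)
    fix e :: real assume "e > 0"
    define \<epsilon> where "\<epsilon> = e / 3"
    have eps: "\<epsilon> > 0" using \<open>e > 0\<close> by (simp add: \<epsilon>_def)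
    obtain a where a: "\<forall>\<^sub>F n in sequentially. Kn n a < \<epsilon>"
      using esc eps unfolding no_escape_at_bot_def by blast
    obtain a' where a': "\<And>x. x \<le> a' \<Longrightarrow> \<bar>K x\<bar> < \<epsilon>"
      using tendstoD[OF K(2) eps] by (auto simp: eventually_at_bot_linorder)
    have "min a a' - 1 < min a a'" by (rule minus_one_less)
    from mono_continuity_point[OF dist_funD(1)[OF K(1)] this]
    obtain y where y: "y < min a a'" "isCont K y" by blast
    have "\<forall>\<^sub>F n in sequentially. dist (Kn n y - c n) (K y) < \<epsilon>"
      by (rule tendstoD[OF c[OF y(2)] eps])
    then show "\<forall>\<^sub>F n in sequentially. dist (c n) 0 < e"
      using a eventually_ge_at_top[of 1]
    proof eventually_elim
      case (elim n)
      have "Kn n y \<le> Kn n a"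
        unfolding array_df_eq_cdf[OF elim(3)]
        by (intro finite_borel_measure.cdf_nondecreasing finite_borel_measure_N elim(3)) (use y(1) in simp)
      moreover have "\<bar>K y\<bar> < \<epsilon>" using a'[of y] y(1) by simp
      \<comment> \<open>One \<open>\<epsilon>\<close> each for the distance of \<open>Kn n y - c n\<close> from \<open>K y\<close>, for \<open>Kn n y\<close>, and for \<open>K y\<close>.\<close>
      ultimately have "\<bar>c n\<bar> < 3 * \<epsilon>"
        using elim(1,2) Kn_nonneg[OF elim(3), of y] unfolding dist_real_def by linarith
      then show ?case by (simp add: \<epsilon>_def)
    qed
  qed
  show ?thesis
    unfolding weak_conv_def
  proof (intro allI impI)
    fix x assume "isCont K x"
    from tendsto_add[OF c[OF this] c0] show "(\<lambda>n. Kn n x) \<longlonglongrightarrow> K x" by simp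
  qed
qed

end

section \<open>Decompositions into independent copies\<close>

text \<open>
  Under the product law of \<open>X\<close> and \<open>Y\<close>, Fubini's theorem makes \<open>X + y\<close> square integrable for almost every
  value \<open>y\<close> of \<open>Y\<close>, and a single such \<open>y\<close> suffices.
\<close>

lemma (in prob_space) indep_summand_square_integrable:
  fixes X Y :: "'a \<Rightarrow> real"
  assumes indep: "indep_var borel X borel Y" and sq: "integrable M (\<lambda>\<omega>. (X \<omega> + Y \<omega>)\<^sup>2)"
  shows "integrable M (\<lambda>\<omega>. (X \<omega>)\<^sup>2)"
proof -
  note rv = indep_var_rv1[OF indep] indep_var_rv2[OF indep]
  interpret DX: real_distribution "distr M borel X" by (rule real_distribution_distr[OF rv(1)])
  interpret DY: real_distribution "distr M borel Y" by (rule real_distribution_distr[OF rv(2)])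
  interpret P: pair_prob_space "distr M borel X" "distr M borel Y" ..
  interpret P': pair_prob_space "distr M borel Y" "distr M borel X" ..
  have pair: "distr M borel X \<Otimes>\<^sub>M distr M borel Y = distr M (borel \<Otimes>\<^sub>M borel) (\<lambda>\<omega>. (X \<omega>, Y \<omega>))"
    using indep by (simp add: indep_var_distribution_eq)
  have rvp: "(\<lambda>\<omega>. (X \<omega>, Y \<omega>)) \<in> measurable M (borel \<Otimes>\<^sub>M borel)"
    by (intro measurable_Pair rv)
  have "integrable (distr M borel X \<Otimes>\<^sub>M distr M borel Y) (\<lambda>z. (fst z + snd z)\<^sup>2)"
    unfolding pair by (subst integrable_distr_eq[OF rvp]) (simp_all only: fst_conv snd_conv sq, measurable)
  from P'.AE_integrable_fst'[OF P.integrable_product_swap[OF this]]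
  have ae: "AE y in distr M borel Y. integrable (distr M borel X) (\<lambda>x. (x + y)\<^sup>2)"
    by (simp only: prod.case fst_conv snd_conv)
  have "\<exists>y. integrable (distr M borel X) (\<lambda>x. (x + y)\<^sup>2)"
  proof (rule ccontr)
    assume none: "\<nexists>y. integrable (distr M borel X) (\<lambda>x. (x + y)\<^sup>2)"
    have "AE y in distr M borel Y. False"
      by (rule AE_mp[OF ae]) (use none in \<open>intro AE_I2 impI, blast\<close>)
    then show False by (simp only: DY.AE_const)
  qed
  then obtain y where y: "integrable (distr M borel X) (\<lambda>x. (x + y)\<^sup>2)" ..
  have lin: "integrable (distr M borel X) (\<lambda>x. x + y)"
    by (rule DX.square_integrable_imp_integrable[OF _ y]) simp
  have "integrable (distr M borel X) (\<lambda>x. (x + y)\<^sup>2 - 2 * y * (x + y) + y\<^sup>2)"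
    by (intro Bochner_Integration.integrable_add Bochner_Integration.integrable_diff integrable_mult_right lin y) simp
  also have "(\<lambda>x. (x + y)\<^sup>2 - 2 * y * (x + y) + y\<^sup>2) = (\<lambda>x. x\<^sup>2)"
    by (simp add: power2_eq_square algebra_simps)
  finally show ?thesis
    by (subst (asm) integrable_distr_eq[OF rv(1)]) simp_all
qed

text \<open>
  The summands are coordinates of a product of copies of the law whose characteristic function is an
  \<open>n\<close>-th root.
\<close>

lemma iid_decomposition_exists:
  assumes P: "real_distribution P" and dec: "infinitely_decomposable P" and n: "1 \<le> n"
  shows "\<exists>(M :: (nat \<Rightarrow> real) measure) Y. iid_decomposition P n M Y"
proof -
  obtain Q where Q: "real_distribution Q" "\<And>u. char P u = char Q u ^ n"
    using dec n unfolding infinitely_decomposable_def by blast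
  define M where "M = PiM {1..n} (\<lambda>_. Q)"
  note iid = iid_coordinates[OF Q(1) n, folded M_def]
  interpret M: prob_space M by (rule iid(1))
  have rv: "(\<lambda>\<omega>. \<Sum>k\<in>{1..n}. \<omega> k) \<in> borel_measurable M"
    using iid(3) by (intro borel_measurable_sum) (simp add: M.indep_vars_def)
  have "distr M borel (\<lambda>\<omega>. \<Sum>k\<in>{1..n}. \<omega> k) = P"
  proof (rule Levy_uniqueness[OF M.real_distribution_distr[OF rv] P])
    show "char (distr M borel (\<lambda>\<omega>. \<Sum>k\<in>{1..n}. \<omega> k)) = char P"
      unfolding M.char_distr_sum[OF iid(3), abs_def] using iid(2) by (intro ext) (simp add: Q(2))
  qed
  then have "iid_decomposition P n M (\<lambda>k \<omega>. \<omega> k)"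
    unfolding iid_decomposition_def by (intro conjI ballI iid(1,3)) (simp_all only: iid(2))
  then show ?thesis by blast
qed

text \<open>
  The moments of the sum are shared equally by the \<open>n\<close> summands, once these are known to be square
  integrable.
\<close>

lemma iid_decomposition_moments:
  assumes P: "real_distribution P" and sq: "integrable P (\<lambda>x. x\<^sup>2)" and mean: "(\<integral>x. x \<partial>P) = 0"
    and n: "1 \<le> n" and dec: "iid_decomposition P n M Y" and k: "k \<in> {1..n}"
  shows "integrable M (\<lambda>\<omega>. (Y k \<omega>)\<^sup>2)" "prob_space.expectation M (Y k) = 0"
    "real n * prob_space.expectation M (\<lambda>\<omega>. (Y k \<omega>)\<^sup>2) = (\<integral>x. x\<^sup>2 \<partial>P)"
proof -
  interpret M: prob_space M using dec by (simp add: iid_decomposition_def)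
  have indep: "M.indep_vars (\<lambda>_. borel) Y {1..n}"
    and same: "\<And>i j. i \<in> {1..n} \<Longrightarrow> j \<in> {1..n} \<Longrightarrow> distr M borel (Y i) = distr M borel (Y j)"
    and sum_P: "distr M borel (\<lambda>\<omega>. \<Sum>i\<in>{1..n}. Y i \<omega>) = P"
    using dec unfolding iid_decomposition_def by (blast, blast, blast)
  have rv: "M.random_variable borel (Y i)" if "i \<in> {1..n}" for i
    using indep that by (simp add: M.indep_vars_def)
  have rv_sum: "M.random_variable borel (\<lambda>\<omega>. \<Sum>i\<in>{1..n}. Y i \<omega>)"
    by (intro borel_measurable_sum rv)
  have sum_sq: "integrable M (\<lambda>\<omega>. (\<Sum>i\<in>{1..n}. Y i \<omega>)\<^sup>2)"
    using sq integrable_distr[OF rv_sum, of "\<lambda>x. x\<^sup>2"] unfolding sum_P by simp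
  have sq_i: "integrable M (\<lambda>\<omega>. (Y i \<omega>)\<^sup>2)" if i: "i \<in> {1..n}" for i
  proof -
    have ins: "insert i ({1..n} - {i}) = {1..n}" using i by auto
    have "M.indep_var borel (Y i) borel (\<lambda>\<omega>. \<Sum>j\<in>{1..n} - {i}. Y j \<omega>)"
      by (rule M.indep_vars_sum) (simp, simp, unfold ins, rule indep)
    moreover have "Y i \<omega> + (\<Sum>j\<in>{1..n} - {i}. Y j \<omega>) = (\<Sum>j\<in>{1..n}. Y j \<omega>)" for \<omega>
      by (rule sum.remove[symmetric]) (simp, rule i)
    ultimately show ?thesis
      using M.indep_summand_square_integrable[of "Y i" "\<lambda>\<omega>. \<Sum>j\<in>{1..n} - {i}. Y j \<omega>"] sum_sq
      by (simp only:)
  qed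
  have E_sum: "M.expectation (\<lambda>\<omega>. f (\<Sum>i\<in>{1..n}. Y i \<omega>)) = (\<integral>x. f x \<partial>P)"
    if f: "f \<in> borel_measurable borel" for f :: "real \<Rightarrow> real"
    using integral_distr[OF rv_sum f] unfolding sum_P by (rule sym)
  have int_i: "integrable M (Y i)" if "i \<in> {1..n}" for i
    by (rule M.square_integrable_imp_integrable[OF rv[OF that] sq_i[OF that]])
  have E_same: "M.expectation (\<lambda>\<omega>. f (Y i \<omega>)) = M.expectation (\<lambda>\<omega>. f (Y k \<omega>))"
    if "i \<in> {1..n}" and f: "f \<in> borel_measurable borel" for i and f :: "real \<Rightarrow> real"
    using integral_distr[OF rv[OF that(1)] f] integral_distr[OF rv[OF k] f]
    unfolding same[OF that(1) k] by (rule trans[OF sym])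
  have "(\<Sum>i\<in>{1..n}. M.expectation (Y i)) = (\<Sum>i\<in>{1..n}. M.expectation (Y k))"
    by (intro sum.cong refl E_same[of _ "\<lambda>x. x"]) simp_all
  then have "real n * M.expectation (Y k) = (\<Sum>i\<in>{1..n}. M.expectation (Y i))"
    by simp
  also have "\<dots> = M.expectation (\<lambda>\<omega>. \<Sum>i\<in>{1..n}. Y i \<omega>)"
    by (rule Bochner_Integration.integral_sum[symmetric]) (rule int_i)
  also have "\<dots> = 0"
    by (rule trans[OF E_sum[of "\<lambda>x. x"] mean]) measurable
  finally have mean_k: "M.expectation (Y k) = 0" using n by simp
  have mean_i: "M.expectation (Y i) = 0" if "i \<in> {1..n}" for i
    by (rule trans[OF E_same[OF that, of "\<lambda>x. x"] mean_k]) simp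
  have "(\<Sum>i\<in>{1..n}. M.expectation (\<lambda>\<omega>. (Y i \<omega>)\<^sup>2)) = (\<Sum>i\<in>{1..n}. M.expectation (\<lambda>\<omega>. (Y k \<omega>)\<^sup>2))"
    by (intro sum.cong refl E_same[of _ "\<lambda>x. x\<^sup>2"]) simp_all
  then have "real n * M.expectation (\<lambda>\<omega>. (Y k \<omega>)\<^sup>2) = (\<Sum>i\<in>{1..n}. M.expectation (\<lambda>\<omega>. (Y i \<omega>)\<^sup>2))"
    by simp
  also have "\<dots> = M.expectation (\<lambda>\<omega>. (\<Sum>i\<in>{1..n}. Y i \<omega>)\<^sup>2)"
    by (rule conjunct2[OF M.second_moment_indep_sum[OF finite_atLeastAtMost indep sq_i mean_i], symmetric])
  also have "\<dots> = (\<integral>x. x\<^sup>2 \<partial>P)"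
    by (rule E_sum[of "\<lambda>x. x\<^sup>2"]) measurable
  finally show "real n * M.expectation (\<lambda>\<omega>. (Y k \<omega>)\<^sup>2) = (\<integral>x. x\<^sup>2 \<partial>P)" .
  show "integrable M (\<lambda>\<omega>. (Y k \<omega>)\<^sup>2)" "M.expectation (Y k) = 0"
    by (rule sq_i[OF k], rule mean_k)
qed

theorem iid_decomposition_array:
  assumes P: "real_distribution P" and sq: "integrable P (\<lambda>x. x\<^sup>2)" and mean: "(\<integral>x. x \<partial>P) = 0"
    and dec: "\<And>n. 1 \<le> n \<Longrightarrow> iid_decomposition P n (M n) (\<lambda>k. X k n)"
  shows "centered_array M (\<lambda>n. n) X" "BVH M (\<lambda>n. n) X" "UAN M (\<lambda>n. n) X"
    "weak_conv_m (row_sum_law M (\<lambda>n. n) X) P"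
proof -
  note mom = iid_decomposition_moments[OF P sq mean]
  define v where "v = (\<integral>x. x\<^sup>2 \<partial>P)"
  have ps: "prob_space (M n)" and ind: "prob_space.indep_vars (M n) (\<lambda>_. borel) (\<lambda>k. X k n) {1..n}"
    and sum_P: "row_sum_law M (\<lambda>n. n) X n = P" if "1 \<le> n" for n
    using dec[OF that] by (simp_all add: iid_decomposition_def row_sum_law_def)
  show "centered_array M (\<lambda>n. n) X"
    unfolding centered_array_def
  proof (intro conjI allI impI ballI)
    show "filterlim (\<lambda>n. n) at_top sequentially" by (rule filterlim_ident)
    fix n :: nat assume n: "1 \<le> n"
    show "prob_space (M n)" "prob_space.indep_vars (M n) (\<lambda>_. borel) (\<lambda>k. X k n) {1..n}"
      by (rule ps[OF n], rule ind[OF n])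
    fix k assume k: "k \<in> {1..n}"
    show "integrable (M n) (\<lambda>\<omega>. (X k n \<omega>)\<^sup>2)" "prob_space.expectation (M n) (X k n) = 0"
      by (rule mom(1)[OF n dec[OF n] k], rule mom(2)[OF n dec[OF n] k])
  qed
  have second: "prob_space.expectation (M n) (\<lambda>\<omega>. (X k n \<omega>)\<^sup>2) = v / real n" if "1 \<le> n" "k \<in> {1..n}" for n k
    using mom(3)[OF that(1) dec[OF that(1)] that(2)] that(1) unfolding v_def[symmetric]
    by (subst eq_divide_eq) (simp add: mult.commute[of _ "real n"])
  show "BVH M (\<lambda>n. n) X"
    unfolding BVH_def bdd_above_def
  proof (intro exI[of _ v] ballI)
    fix y assume "y \<in> (\<lambda>n. \<Sum>k = 1..n. prob_space.variance (M n) (X k n)) ` {1..}"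
    then obtain n where n: "1 \<le> n" and y: "y = (\<Sum>k = 1..n. prob_space.variance (M n) (X k n))" by auto
    have "y = (\<Sum>k = 1..n. v / real n)"
      unfolding y by (intro sum.cong refl) (simp only: mom(2)[OF n dec[OF n]] diff_zero second[OF n])
    then show "y \<le> v" using n by simp
  qed
  show "UAN M (\<lambda>n. n) X"
    unfolding UAN_def
  proof (intro allI impI)
    fix \<epsilon> :: real assume eps: "0 < \<epsilon>"
    let ?p = "\<lambda>n k. measure (M n) {\<omega> \<in> space (M n). \<epsilon> \<le> \<bar>X k n \<omega>\<bar>}"
    have le: "?p n k \<le> v / \<epsilon>\<^sup>2 * inverse (real n)" if n: "1 \<le> n" and k: "k \<in> {1..n}" for n k
    proof -
      interpret prob_space "M n" by (rule ps[OF n])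
      have "?p n k \<le> expectation (\<lambda>\<omega>. (X k n \<omega>)\<^sup>2) / \<epsilon>\<^sup>2"
        by (rule second_moment_method[OF _ mom(1)[OF n dec[OF n] k] eps])
           (use ind[OF n] k in \<open>simp add: indep_vars_def\<close>)
      also have "\<dots> = v / \<epsilon>\<^sup>2 * inverse (real n)"
        unfolding second[OF n k] by (simp add: divide_inverse)
      finally show ?thesis .
    qed
    show "(\<lambda>n. SUP k\<in>{1..n}. ?p n k) \<longlonglongrightarrow> 0"
    proof (rule tendsto_sandwich)
      show "\<forall>\<^sub>F n in sequentially. 0 \<le> (SUP k\<in>{1..n}. ?p n k)"
        using eventually_ge_at_top[of 1]
      proof eventually_elim
        case (elim n)
        have "?p n 1 \<le> (SUP k\<in>{1..n}. ?p n k)" by (rule cSUP_upper) (use elim in simp_all)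
        then show ?case by (rule order_trans[OF measure_nonneg])
      qed
      show "\<forall>\<^sub>F n in sequentially. (SUP k\<in>{1..n}. ?p n k) \<le> v / \<epsilon>\<^sup>2 * inverse (real n)"
        using eventually_ge_at_top[of 1]
      proof eventually_elim
        case (elim n)
        show ?case by (rule cSUP_least) (use elim le[OF elim] in auto)
      qed
      show "(\<lambda>n. v / \<epsilon>\<^sup>2 * inverse (real n)) \<longlonglongrightarrow> 0"
        using tendsto_mult_left[OF lim_inverse_n, of "v / \<epsilon>\<^sup>2"] by simp
    qed simp
  qed
  have "weak_conv_m (\<lambda>n. row_sum_law M (\<lambda>n. n) X (Suc n)) P"
    by (simp add: sum_P weak_conv_m_def weak_conv_def)
  then show "weak_conv_m (row_sum_law M (\<lambda>n. n) X) P" by (simp only: weak_conv_m_Suc)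
qed

section \<open>The central limit theorem for negligible arrays\<close>

theorem theorem1:
  shows
    "(\<forall>(M :: nat \<Rightarrow> 'a measure) kn X P.
        centered_array M kn X \<and> BVH M kn X \<and> UAN M kn X \<and>
        real_distribution P \<and> weak_conv_m (row_sum_law M kn X) P
        \<longrightarrow> infinitely_decomposable P)
     \<and>
     (\<forall>(N :: 'b measure) Z P.
        prob_space N \<and> Z \<in> borel_measurable N \<and> integrable N (\<lambda>\<omega>. (Z \<omega>)\<^sup>2) \<and>
        prob_space.expectation N Z = 0 \<and> P = distr N borel Z \<and> infinitely_decomposable P
        \<longrightarrow>
        (\<forall>n\<ge>1. \<exists>(M :: (nat \<Rightarrow> real) measure) Y. iid_decomposition P n M Y) \<and>
        (\<forall>(M :: nat \<Rightarrow> 'c measure) X.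
           (\<forall>n\<ge>1. iid_decomposition P n (M n) (\<lambda>k. X k n)) \<longrightarrow>
           centered_array M (\<lambda>n. n) X \<and> BVH M (\<lambda>n. n) X \<and> UAN M (\<lambda>n. n) X \<and>
           weak_conv_m (row_sum_law M (\<lambda>n. n) X) P) \<and>
        (\<exists>(M :: nat \<Rightarrow> (nat \<Rightarrow> real) measure) kn X.
           centered_array M kn X \<and> BVH M kn X \<and> UAN M kn X \<and>
           weak_conv_m (row_sum_law M kn X) P))
     \<and>
     (\<forall>(M :: nat \<Rightarrow> 'd measure) kn X K.
        centered_array M kn X \<and> BVH M kn X \<and> UAN M kn X \<and> dist_fun K
        \<longrightarrow>
        (weak_conv_m (row_sum_law M kn X) (assoc_law K) \<longleftrightarrow>
           pre_weak_conv (array_df M kn X) K) \<and>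
        (weak_conv (array_df M kn X) K \<longrightarrow>
           weak_conv_m (row_sum_law M kn X) (assoc_law K)) \<and>
        ((K \<longlongrightarrow> 0) at_bot \<and> no_escape_at_bot (array_df M kn X) \<longrightarrow>
           (weak_conv_m (row_sum_law M kn X) (assoc_law K) \<longleftrightarrow>
              weak_conv (array_df M kn X) K)))
     \<and>
     (\<forall>K L. dist_fun K \<and> dist_fun L \<longrightarrow>
        (Psi K = Psi L \<longleftrightarrow> (\<exists>c. \<forall>x. K x = L x + c)))
     \<and>
     (\<forall>K. dist_fun K \<longrightarrow>
        real_distribution (assoc_law K) \<and> (\<forall>u. char (assoc_law K) u = exp (Psi K u)))"
proof (intro conjI)
  show "\<forall>(M :: nat \<Rightarrow> 'a measure) kn X P.
        centered_array M kn X \<and> BVH M kn X \<and> UAN M kn X \<and>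
        real_distribution P \<and> weak_conv_m (row_sum_law M kn X) P
        \<longrightarrow> infinitely_decomposable P"
  proof (intro allI impI, elim conjE)
    fix M :: "nat \<Rightarrow> 'a measure" and kn X P
    assume "centered_array M kn X" "BVH M kn X" "UAN M kn X"
      and P: "real_distribution P" "weak_conv_m (row_sum_law M kn X) P"
    then interpret negligible_array M kn X by (intro negligible_array.intro)
    show "infinitely_decomposable P" by (rule weak_limit_infinitely_decomposable[OF P])
  qed
next
  show "\<forall>(N :: 'b measure) Z P.
        prob_space N \<and> Z \<in> borel_measurable N \<and> integrable N (\<lambda>\<omega>. (Z \<omega>)\<^sup>2) \<and>
        prob_space.expectation N Z = 0 \<and> P = distr N borel Z \<and> infinitely_decomposable P
        \<longrightarrow>
        (\<forall>n\<ge>1. \<exists>(M :: (nat \<Rightarrow> real) measure) Y. iid_decomposition P n M Y) \<and>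
        (\<forall>(M :: nat \<Rightarrow> 'c measure) X.
           (\<forall>n\<ge>1. iid_decomposition P n (M n) (\<lambda>k. X k n)) \<longrightarrow>
           centered_array M (\<lambda>n. n) X \<and> BVH M (\<lambda>n. n) X \<and> UAN M (\<lambda>n. n) X \<and>
           weak_conv_m (row_sum_law M (\<lambda>n. n) X) P) \<and>
        (\<exists>(M :: nat \<Rightarrow> (nat \<Rightarrow> real) measure) kn X.
           centered_array M kn X \<and> BVH M kn X \<and> UAN M kn X \<and>
           weak_conv_m (row_sum_law M kn X) P)"
  proof (intro allI impI, elim conjE)
    fix N :: "'b measure" and Z P
    assume N: "prob_space N" and Z: "Z \<in> borel_measurable N" "integrable N (\<lambda>\<omega>. (Z \<omega>)\<^sup>2)"
      "prob_space.expectation N Z = 0" and P_eq: "P = distr N borel Z" and dec: "infinitely_decomposable P"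
    interpret N: prob_space N by (rule N)
    have P: "real_distribution P" unfolding P_eq by (rule N.real_distribution_distr[OF Z(1)])
    have sq: "integrable P (\<lambda>x. x\<^sup>2)"
      unfolding P_eq by (subst integrable_distr_eq[OF Z(1)]) (simp_all add: Z(2))
    have mean: "(\<integral>x. x \<partial>P) = 0"
      unfolding P_eq by (subst integral_distr[OF Z(1)]) (simp_all add: Z(3))
    note arr = iid_decomposition_array[OF P sq mean]
    have ex: "\<exists>(M :: (nat \<Rightarrow> real) measure) Y. iid_decomposition P n M Y" if "1 \<le> n" for n
      by (rule iid_decomposition_exists[OF P dec that])
    have "\<exists>D :: (nat \<Rightarrow> real) measure \<times> (nat \<Rightarrow> (nat \<Rightarrow> real) \<Rightarrow> real).
        1 \<le> n \<longrightarrow> iid_decomposition P n (fst D) (snd D)" for n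
    proof (cases "1 \<le> n")
      case True
      then obtain M :: "(nat \<Rightarrow> real) measure" and Y where "iid_decomposition P n M Y"
        using ex by blast
      then show ?thesis by (intro exI[of _ "(M, Y)"]) simp
    qed simp
    then obtain D :: "nat \<Rightarrow> (nat \<Rightarrow> real) measure \<times> (nat \<Rightarrow> (nat \<Rightarrow> real) \<Rightarrow> real)"
      where D: "\<And>n. 1 \<le> n \<Longrightarrow> iid_decomposition P n (fst (D n)) (snd (D n))"
      using choice[of "\<lambda>n D. 1 \<le> n \<longrightarrow> iid_decomposition P n (fst D) (snd D)"] by blast
    let ?M = "\<lambda>n. fst (D n)" and ?Y = "\<lambda>k n. snd (D n) k"
    show "(\<forall>n\<ge>1. \<exists>(M :: (nat \<Rightarrow> real) measure) Y. iid_decomposition P n M Y) \<and>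
        (\<forall>(M :: nat \<Rightarrow> 'c measure) X.
           (\<forall>n\<ge>1. iid_decomposition P n (M n) (\<lambda>k. X k n)) \<longrightarrow>
           centered_array M (\<lambda>n. n) X \<and> BVH M (\<lambda>n. n) X \<and> UAN M (\<lambda>n. n) X \<and>
           weak_conv_m (row_sum_law M (\<lambda>n. n) X) P) \<and>
        (\<exists>(M :: nat \<Rightarrow> (nat \<Rightarrow> real) measure) kn X.
           centered_array M kn X \<and> BVH M kn X \<and> UAN M kn X \<and>
           weak_conv_m (row_sum_law M kn X) P)"
    proof (intro conjI)
      show "\<forall>n\<ge>1. \<exists>(M :: (nat \<Rightarrow> real) measure) Y. iid_decomposition P n M Y"
        using ex by (intro allI impI)
      show "\<forall>(M :: nat \<Rightarrow> 'c measure) X.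
           (\<forall>n\<ge>1. iid_decomposition P n (M n) (\<lambda>k. X k n)) \<longrightarrow>
           centered_array M (\<lambda>n. n) X \<and> BVH M (\<lambda>n. n) X \<and> UAN M (\<lambda>n. n) X \<and>
           weak_conv_m (row_sum_law M (\<lambda>n. n) X) P"
        by (intro allI impI conjI arr; elim allE impE; assumption)
      have "centered_array ?M (\<lambda>n. n) ?Y \<and> BVH ?M (\<lambda>n. n) ?Y \<and> UAN ?M (\<lambda>n. n) ?Y \<and>
          weak_conv_m (row_sum_law ?M (\<lambda>n. n) ?Y) P"
        by (intro conjI arr D)
      then show "\<exists>(M :: nat \<Rightarrow> (nat \<Rightarrow> real) measure) kn X.
           centered_array M kn X \<and> BVH M kn X \<and> UAN M kn X \<and>
           weak_conv_m (row_sum_law M kn X) P"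
        by (intro exI)
    qed
  qed
next
  show "\<forall>(M :: nat \<Rightarrow> 'd measure) kn X K.
        centered_array M kn X \<and> BVH M kn X \<and> UAN M kn X \<and> dist_fun K
        \<longrightarrow>
        (weak_conv_m (row_sum_law M kn X) (assoc_law K) \<longleftrightarrow>
           pre_weak_conv (array_df M kn X) K) \<and>
        (weak_conv (array_df M kn X) K \<longrightarrow>
           weak_conv_m (row_sum_law M kn X) (assoc_law K)) \<and>
        ((K \<longlongrightarrow> 0) at_bot \<and> no_escape_at_bot (array_df M kn X) \<longrightarrow>
           (weak_conv_m (row_sum_law M kn X) (assoc_law K) \<longleftrightarrow>
              weak_conv (array_df M kn X) K))"
  proof (intro allI impI, elim conjE)
    fix M :: "nat \<Rightarrow> 'd measure" and kn X K
    assume "centered_array M kn X" "BVH M kn X" "UAN M kn X" and K: "dist_fun K"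
    then interpret negligible_array M kn X by (intro negligible_array.intro)
    have iff: "weak_conv_m S (assoc_law K) \<longleftrightarrow> pre_weak_conv Kn K"
      using row_sum_conv_imp_pre_weak_conv[OF K] pre_weak_conv_imp_row_sum_conv[OF K] by blast
    have imp: "pre_weak_conv Kn K" if "weak_conv Kn K"
      unfolding pre_weak_conv_def using that by (intro exI[of _ "\<lambda>_. 0"]) simp
    show "(weak_conv_m S (assoc_law K) \<longleftrightarrow> pre_weak_conv Kn K) \<and>
        (weak_conv Kn K \<longrightarrow> weak_conv_m S (assoc_law K)) \<and>
        ((K \<longlongrightarrow> 0) at_bot \<and> no_escape_at_bot Kn \<longrightarrow>
           (weak_conv_m S (assoc_law K) \<longleftrightarrow> weak_conv Kn K))"
      using iff imp pre_weak_conv_imp_weak_conv[OF K] by blast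
  qed
next
  show "\<forall>K L. dist_fun K \<and> dist_fun L \<longrightarrow> (Psi K = Psi L \<longleftrightarrow> (\<exists>c. \<forall>x. K x = L x + c))"
  proof (intro allI impI, elim conjE)
    fix K L assume KL: "dist_fun K" "dist_fun L"
    show "Psi K = Psi L \<longleftrightarrow> (\<exists>c. \<forall>x. K x = L x + c)"
    proof
      show "Psi K = Psi L \<Longrightarrow> \<exists>c. \<forall>x. K x = L x + c" by (rule Psi_inj[OF KL])
      assume "\<exists>c. \<forall>x. K x = L x + c"
      then obtain c where "\<And>x. K x = L x + c" by blast
      then show "Psi K = Psi L" by (rule Psi_shift)
    qed
  qed
next
  show "\<forall>K. dist_fun K \<longrightarrow> real_distribution (assoc_law K) \<and> (\<forall>u. char (assoc_law K) u = exp (Psi K u))"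
    by (intro allI impI conjI assoc_law_char)
qed

end
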